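(* Let $n\ge 1$ and let $G$ be any $GBS_n$ group with finite monodromy. Then there is an integer $r\geq 0$ such that $G$ has a finite index subgroup isomorphic to $\mathbb{Z}^n\times F_r$, where $F_r$ is the free group of rank $r$.
   Context: Let $n\ge 1$. A generalised rank $n$ Baumslag-Solitar group ($GBS_n$ group) is a group $G$ which is the fundamental group of a finite (connected) graph of groups in which all vertex and edge groups are isomorphic to $\mathbb{Z}^n$; a $GBS_n$ group is understood to come with such a decomposition. $G$ then acts without edge inversions and cocompactly on the Bass-Serre tree $T$ of the decomposition, which is locally finite. Modular homomorphism and monodromy: choose a base vertex $v_0$ of $T$, a finite index subgroup $A\cong\mathbb{Z}^n$ of $\mathrm{Stab}_G(v_0)\cong\mathbb{Z}^n$ (called a base $\mathbb{Z}^n$-subgroup of $G$) and an ordered basis $a_1,\ldots,a_n$ of $A$. For any $g\in G$ the subgroups $A$ and $g^{-1}Ag$ are commensurable, so there is $m>0$ such that $\langle a_1^m,\ldots,a_n^m\rangle$ is a finite index subgroup of $A\cap g^{-1}Ag$. Hence there are unique integers $g_{ij}$ with $g a_j^m g^{-1}=a_1^{g_{1j}}\cdots a_n^{g_{nj}}$ for each $j$. The modular homomorphism $\mathcal{M}:G\to GL(n,\mathbb{Q})$ sends $g$ to the matrix with $(i,j)$ entry $g_{ij}/m$. This is independent of $m$, is a homomorphism, and changing the choices of $v_0$, $A$ and basis changes $\mathcal{M}$ only by conjugation in $GL(n,\mathbb{Q})$. The monodromy of $G$ is the image $\mathcal{M}(G)$. *)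

theory Defs
  imports
    "HOL-Algebra.Algebra"
    "Graph_Theory.Bidirected_Digraph"
    "Graph_Theory.Digraph_Component"
    "Jordan_Normal_Form.Matrix"
begin

section \<open>Monoids given by generators and relations\<close>

inductive word_cong :: "'x set \<Rightarrow> ('x list \<times> 'x list) set \<Rightarrow> 'x list \<Rightarrow> 'x list \<Rightarrow> bool"
  for S R where
  refl: "w \<in> lists S \<Longrightarrow> word_cong S R w w"
| sym: "word_cong S R u w \<Longrightarrow> word_cong S R w u"
| trans: "word_cong S R u v \<Longrightarrow> word_cong S R v w \<Longrightarrow> word_cong S R u w"
| rel: "(l, r) \<in> R \<Longrightarrow> l \<in> lists S \<Longrightarrow> r \<in> lists S \<Longrightarrow> p \<in> lists S \<Longrightarrow> q \<in> lists S
         \<Longrightarrow> word_cong S R (p @ l @ q) (p @ r @ q)"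

definition word_rel :: "'x set \<Rightarrow> ('x list \<times> 'x list) set \<Rightarrow> ('x list \<times> 'x list) set" where
  "word_rel S R = {(u, w). word_cong S R u w}"

definition presented :: "'x set \<Rightarrow> ('x list \<times> 'x list) set \<Rightarrow> 'x list set monoid" where
  "presented S R =
     \<lparr> carrier = lists S // word_rel S R,
       monoid.mult = (\<lambda>C D. \<Union>u\<in>C. \<Union>w\<in>D. word_rel S R `` {u @ w}),
       one = word_rel S R `` {[]} \<rparr>"

section \<open>The groups of rank n and r\<close>

definition Zn_group :: "nat \<Rightarrow> (nat \<Rightarrow> int) monoid" where
  "Zn_group n = product_group {..<n} (\<lambda>_. integer_group)"

text \<open>The letter \<open>(i, True)\<close> is the i-th free generator and \<open>(i, False)\<close> its inverse; the relations
  are free cancellation, so the presented monoid is the free group.\<close>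

definition free_group :: "nat \<Rightarrow> (nat \<times> bool) list set monoid" where
  "free_group r = presented ({..<r} \<times> UNIV) {([(i, b), (i, \<not> b)], []) | i b. i < r}"

section \<open>Graphs of groups\<close>

text \<open>Graphs are in the sense of Serre: every geometric edge is a pair of oppositely oriented
  arcs, interchanged by the fixed-point-free involution \<open>arc_rev\<close>.
  The map \<open>edge_map e\<close> embeds the edge group of \<open>e\<close> in the vertex group of the head of \<open>e\<close>;
  the embedding at the tail is \<open>edge_map\<close> of the reversed arc.\<close>

record ('v, 'e, 'a, 'b) graph_of_groups =
  graph :: "('v, 'e) pre_digraph"
  arc_rev :: "'e \<Rightarrow> 'e"
  vertex_group :: "'v \<Rightarrow> 'a monoid"
  edge_group :: "'e \<Rightarrow> 'b monoid"
  edge_map :: "'e \<Rightarrow> 'b \<Rightarrow> 'a"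

definition graph_of_groups :: "('v, 'e, 'a, 'b) graph_of_groups \<Rightarrow> bool" where
  "graph_of_groups \<G> \<longleftrightarrow>
     bidirected_digraph (graph \<G>) (arc_rev \<G>) \<and>
     Digraph_Component.connected (graph \<G>) \<and>
     (\<forall>v\<in>verts (graph \<G>). group (vertex_group \<G> v)) \<and>
     (\<forall>e\<in>arcs (graph \<G>).
        group (edge_group \<G> e) \<and>
        edge_group \<G> (arc_rev \<G> e) = edge_group \<G> e \<and>
        edge_map \<G> e \<in> mon (edge_group \<G> e) (vertex_group \<G> (head (graph \<G>) e)))"

section \<open>The fundamental group\<close>

datatype ('v, 'e, 'a) letter = Vtx 'v 'a | Edg 'e

definition letters :: "('v, 'e, 'a, 'b) graph_of_groups \<Rightarrow> ('v, 'e, 'a) letter set" where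
  "letters \<G> =
     {Vtx v g | v g. v \<in> verts (graph \<G>) \<and> g \<in> carrier (vertex_group \<G> v)} \<union>
     {Edg e | e. e \<in> arcs (graph \<G>)}"

definition relations ::
  "('v, 'e, 'a, 'b) graph_of_groups \<Rightarrow> (('v, 'e, 'a) letter list \<times> ('v, 'e, 'a) letter list) set" where
  "relations \<G> =
     {([Vtx v g, Vtx v h], [Vtx v (g \<otimes>\<^bsub>vertex_group \<G> v\<^esub> h)]) | v g h.
        v \<in> verts (graph \<G>) \<and> g \<in> carrier (vertex_group \<G> v) \<and> h \<in> carrier (vertex_group \<G> v)} \<union>
     {([Vtx v \<one>\<^bsub>vertex_group \<G> v\<^esub>], []) | v. v \<in> verts (graph \<G>)} \<union>
     {([Edg e, Edg (arc_rev \<G> e)], []) | e. e \<in> arcs (graph \<G>)} \<union>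
     {([Edg e, Vtx (head (graph \<G>) e) (edge_map \<G> e c), Edg (arc_rev \<G> e)],
       [Vtx (tail (graph \<G>) e) (edge_map \<G> (arc_rev \<G> e) c)]) | e c.
        e \<in> arcs (graph \<G>) \<and> c \<in> carrier (edge_group \<G> e)}"

text \<open>Serre's group \<open>F(\<G>)\<close>, generated by the vertex groups and the arcs. The letters are closed
  under inversion modulo the relations, so the presented monoid is the presented group.\<close>

definition path_group :: "('v, 'e, 'a, 'b) graph_of_groups \<Rightarrow> ('v, 'e, 'a) letter list set monoid" where
  "path_group \<G> = presented (letters \<G>) (relations \<G>)"

definition word_class ::
  "('v, 'e, 'a, 'b) graph_of_groups \<Rightarrow> ('v, 'e, 'a) letter list \<Rightarrow> ('v, 'e, 'a) letter list set" where
  "word_class \<G> w = word_rel (letters \<G>) (relations \<G>) `` {w}"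

text \<open>The words carried by the paths of the graph from \<open>u\<close> to \<open>w\<close>.\<close>

fun path_word :: "('v, 'e, 'a, 'b) graph_of_groups \<Rightarrow> 'v \<Rightarrow> ('v, 'e, 'a) letter list \<Rightarrow> 'v \<Rightarrow> bool" where
  "path_word \<G> u [] w \<longleftrightarrow> u \<in> verts (graph \<G>) \<and> u = w"
| "path_word \<G> u (Vtx v g # p) w \<longleftrightarrow>
     v \<in> verts (graph \<G>) \<and> u = v \<and> g \<in> carrier (vertex_group \<G> v) \<and> path_word \<G> v p w"
| "path_word \<G> u (Edg e # p) w \<longleftrightarrow>
     e \<in> arcs (graph \<G>) \<and> u = tail (graph \<G>) e \<and> path_word \<G> (head (graph \<G>) e) p w"

definition path_classes ::
  "('v, 'e, 'a, 'b) graph_of_groups \<Rightarrow> 'v \<Rightarrow> 'v \<Rightarrow> ('v, 'e, 'a) letter list set set" where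
  "path_classes \<G> u w = {word_class \<G> p | p. path_word \<G> u p w}"

definition fundamental_group ::
  "('v, 'e, 'a, 'b) graph_of_groups \<Rightarrow> 'v \<Rightarrow> ('v, 'e, 'a) letter list set monoid" where
  "fundamental_group \<G> x = (path_group \<G>)\<lparr>carrier := path_classes \<G> x x\<rparr>"

section \<open>The action on the vertices of the Bass-Serre tree\<close>

text \<open>The vertices above \<open>v\<close> of the Bass-Serre tree based at \<open>x\<close> are the cosets \<open>p G\<^sub>v\<close>, for \<open>p\<close> in
  the path classes from \<open>x\<close> to \<open>v\<close>; the fundamental group at \<open>x\<close> acts by left multiplication.\<close>

definition vertex_subgroup ::
  "('v, 'e, 'a, 'b) graph_of_groups \<Rightarrow> 'v \<Rightarrow> ('v, 'e, 'a) letter list set set" where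
  "vertex_subgroup \<G> v = {word_class \<G> [Vtx v g] | g. g \<in> carrier (vertex_group \<G> v)}"

definition tree_verts ::
  "('v, 'e, 'a, 'b) graph_of_groups \<Rightarrow> 'v \<Rightarrow> ('v \<times> ('v, 'e, 'a) letter list set set) set" where
  "tree_verts \<G> x =
     {(v, p <#\<^bsub>path_group \<G>\<^esub> vertex_subgroup \<G> v) | v p.
        v \<in> verts (graph \<G>) \<and> p \<in> path_classes \<G> x v}"

definition tree_act ::
  "('v, 'e, 'a, 'b) graph_of_groups \<Rightarrow> ('v, 'e, 'a) letter list set \<Rightarrow>
   'v \<times> ('v, 'e, 'a) letter list set set \<Rightarrow> 'v \<times> ('v, 'e, 'a) letter list set set" where
  "tree_act \<G> q = (\<lambda>(v, C). (v, q <#\<^bsub>path_group \<G>\<^esub> C))"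

section \<open>Generalised Baumslag-Solitar groups\<close>

text \<open>\<open>\<phi>\<close> identifies the abstract group \<open>G\<close> with the fundamental group of the decomposition.\<close>

definition GBS_group ::
  "nat \<Rightarrow> 'g monoid \<Rightarrow> ('v, 'e, 'a, 'b) graph_of_groups \<Rightarrow> 'v \<Rightarrow>
   ('g \<Rightarrow> ('v, 'e, 'a) letter list set) \<Rightarrow> bool" where
  "GBS_group n G \<G> x \<phi> \<longleftrightarrow>
     graph_of_groups \<G> \<and> fin_digraph (graph \<G>) \<and>
     (\<forall>v\<in>verts (graph \<G>). vertex_group \<G> v \<cong> Zn_group n) \<and>
     (\<forall>e\<in>arcs (graph \<G>). edge_group \<G> e \<cong> Zn_group n) \<and>
     x \<in> verts (graph \<G>) \<and>
     group G \<and> \<phi> \<in> iso G (fundamental_group \<G> x)"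

section \<open>Finite index subgroups and the modular homomorphism\<close>

definition finite_index_subgroup :: "'g set \<Rightarrow> 'g monoid \<Rightarrow> bool" where
  "finite_index_subgroup H G \<longleftrightarrow> subgroup H G \<and> finite (rcosets\<^bsub>G\<^esub> H)"

text \<open>The product \<open>a\<^sub>0\<^bsup>k 0\<^esup> \<dots> a\<^sub>n\<^sub>-\<^sub>1\<^bsup>k (n-1)\<^esup>\<close>; indices start at 0, as for the library's matrices.\<close>

definition pow_prod :: "'g monoid \<Rightarrow> nat \<Rightarrow> (nat \<Rightarrow> 'g) \<Rightarrow> (nat \<Rightarrow> int) \<Rightarrow> 'g" where
  "pow_prod G n a k = foldr (\<otimes>\<^bsub>G\<^esub>) (map (\<lambda>i. a i [^]\<^bsub>G\<^esub> k i) [0..<n]) \<one>\<^bsub>G\<^esub>"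

definition ordered_basis :: "'g monoid \<Rightarrow> 'g set \<Rightarrow> nat \<Rightarrow> (nat \<Rightarrow> 'g) \<Rightarrow> bool" where
  "ordered_basis G A n a \<longleftrightarrow>
     subgroup A G \<and> (\<forall>i<n. a i \<in> A) \<and> pow_prod G n a \<in> iso (Zn_group n) (G\<lparr>carrier := A\<rparr>)"

definition base_subgroup ::
  "'g monoid \<Rightarrow> ('v, 'e, 'a, 'b) graph_of_groups \<Rightarrow> 'v \<Rightarrow> ('g \<Rightarrow> ('v, 'e, 'a) letter list set) \<Rightarrow>
   'v \<times> ('v, 'e, 'a) letter list set set \<Rightarrow> 'g set \<Rightarrow> bool" where
  "base_subgroup G \<G> x \<phi> v0 A \<longleftrightarrow>
     v0 \<in> tree_verts \<G> x \<and>
     finite_index_subgroup A (G\<lparr>carrier := stabilizer G (\<lambda>g. tree_act \<G> (\<phi> g)) v0\<rparr>)"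

definition modular_exponent ::
  "'g monoid \<Rightarrow> 'g set \<Rightarrow> nat \<Rightarrow> (nat \<Rightarrow> 'g) \<Rightarrow> 'g \<Rightarrow> nat \<Rightarrow> bool" where
  "modular_exponent G A n a g m \<longleftrightarrow>
     0 < m \<and>
     finite_index_subgroup
       (generate G {a i [^]\<^bsub>G\<^esub> m | i. i < n})
       (G\<lparr>carrier := A \<inter> {inv\<^bsub>G\<^esub> g \<otimes>\<^bsub>G\<^esub> x \<otimes>\<^bsub>G\<^esub> g | x. x \<in> A}\<rparr>)"

text \<open>The description determines the matrix uniquely: it does not depend on \<open>m\<close>.\<close>

definition modular_hom :: "'g monoid \<Rightarrow> 'g set \<Rightarrow> nat \<Rightarrow> (nat \<Rightarrow> 'g) \<Rightarrow> 'g \<Rightarrow> rat mat" where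
  "modular_hom G A n a g =
     (THE M. \<exists>m (k :: nat \<Rightarrow> nat \<Rightarrow> int).
        modular_exponent G A n a g m \<and>
        (\<forall>j<n. g \<otimes>\<^bsub>G\<^esub> (a j [^]\<^bsub>G\<^esub> m) \<otimes>\<^bsub>G\<^esub> inv\<^bsub>G\<^esub> g = pow_prod G n a (\<lambda>i. k i j)) \<and>
        M = mat n n (\<lambda>(i, j). of_int (k i j) / of_nat m))"

definition monodromy :: "'g monoid \<Rightarrow> 'g set \<Rightarrow> nat \<Rightarrow> (nat \<Rightarrow> 'g) \<Rightarrow> rat mat set" where
  "monodromy G A n a = modular_hom G A n a ` carrier G"

end

(*
  Conjugation by paths embeds every vertex group in the rational span Q^n of A, compatibly with
  the edge groups up to the monodromy M of loops. This gives a homomorphism delta from the path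
  group to the affine group of pairs in Q^n x M, which is injective on vertex groups, maps them to
  translations and sends the arcs to linear maps. The translation parts have bounded denominators
  and, M being finite, some lattice d Z^n is contained in every image under M of every edge group.
  Hence the elements mapped to translations by d Z^n form a subgroup H of finite index. A copy of
  d Z^n in the base vertex group commutes with H, and so H is the product of this copy and of the
  kernel K of delta on the fundamental group. K acts freely on the Bass-Serre tree with finite
  quotient graph, so it is free of finite rank. Instead of the tree, the proof uses the cosets of
  the vertex and edge groups in the image of delta: a spanning tree of the graph they form gives
  generators of K, and reading words along this graph gives a well-defined inverse map to the free
  group.
*)
theory Submission
  imports Defs "Jordan_Normal_Form.Determinant"
begin

section \<open>Presented groups\<close>

text \<open>Letters and relations do not show directly that the vertex groups embed in the path
  group or that the Bass-Serre graph has no circuits. Embedding comes from rank: a vertex group is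
  commensurable with \<open>A\<close> along paths, so its coordinate map from Z^n to Q^n has
  spanning image and is injective. Freeness comes from maps in both directions, each checked on
  defining relations only. The map to the free group is a cocycle, because a path yields an element
  of the free group only relative to the state where it starts; on the kernel the state does not
  change and the cocycle becomes a homomorphism. Finite monodromy makes two bounds uniform: a common
  denominator N of all translation parts, and the scale d of the lattice. Since (1/N) Z^n has
  finitely many classes modulo d Z^n, counting pairs (linear part, class) gives both the finite
  index of H and the finiteness of the quotient graph. The lattice must lie in the edge groups, not
  merely in the vertex groups, because only edge elements can be moved across arcs; this is why its
  copy commutes with H.\<close>

lemma word_cong_in_lists:
  "word_cong S R u w \<Longrightarrow> u \<in> lists S \<and> w \<in> lists S"
  by (induction rule: word_cong.induct) auto

lemma word_cong_context:
  assumes "word_cong S R u w" "p \<in> lists S" "q \<in> lists S"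
  shows "word_cong S R (p @ u @ q) (p @ w @ q)"
  using assms
proof (induction rule: word_cong.induct)
  case (refl w)
  then show ?case by (intro word_cong.refl) auto
next
  case (sym u w)
  then show ?case by (blast intro: word_cong.sym)
next
  case (trans u v w)
  then show ?case by (blast intro: word_cong.trans)
next
  case (rel l r p' q')
  then show ?case using word_cong.rel[of l r R S "p @ p'" "q' @ q"] by simp
qed

lemma word_cong_append:
  assumes "word_cong S R u u'" "word_cong S R w w'"
  shows "word_cong S R (u @ w) (u' @ w')"
proof -
  have "word_cong S R ([] @ u @ w) ([] @ u' @ w)"
    using assms word_cong_in_lists[OF assms(1)] word_cong_in_lists[OF assms(2)]
    by (intro word_cong_context) auto
  moreover have "word_cong S R (u' @ w @ []) (u' @ w' @ [])"
    using assms word_cong_in_lists[OF assms(1)] word_cong_in_lists[OF assms(2)]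
    by (intro word_cong_context) auto
  ultimately show ?thesis using word_cong.trans by fastforce
qed

lemma equiv_word_rel: "equiv (lists S) (word_rel S R)"
proof (rule equivI)
  show "word_rel S R \<subseteq> lists S \<times> lists S" unfolding word_rel_def using word_cong_in_lists
    by fastforce
  show "refl_on (lists S) (word_rel S R)" by (simp add: refl_on_def word_rel_def word_cong.refl)
  show "sym (word_rel S R)" unfolding sym_def word_rel_def using word_cong.sym by fast
  show "trans (word_rel S R)" unfolding trans_def word_rel_def using word_cong.trans by fast
qed

definition cls :: "'x set \<Rightarrow> ('x list \<times> 'x list) set \<Rightarrow> 'x list \<Rightarrow> 'x list set" where
  "cls S R w = word_rel S R `` {w}"

lemma mem_cls_iff: "u \<in> cls S R w \<longleftrightarrow> word_cong S R w u"
  by (simp add: cls_def word_rel_def)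

lemma cls_eq_iff:
  "u \<in> lists S \<Longrightarrow> w \<in> lists S \<Longrightarrow> cls S R u = cls S R w \<longleftrightarrow> word_cong S R u w"
  using eq_equiv_class_iff[OF equiv_word_rel, of u S w R] by (simp add: word_rel_def cls_def)

lemma carrier_presented: "carrier (presented S R) = cls S R ` lists S"
  by (auto simp: presented_def quotient_def cls_def)

lemma cls_in_presented [simp]: "w \<in> lists S \<Longrightarrow> cls S R w \<in> carrier (presented S R)"
  by (auto simp: carrier_presented)

lemma one_presented: "\<one>\<^bsub>presented S R\<^esub> = cls S R []"
  by (simp add: presented_def cls_def)

text \<open>The product of two classes is a union over all pairs of representatives. All members of
  the union are the same class by congruence, and the index sets are nonempty by reflexivity, so the
  union collapses.\<close>

lemma mult_presented:
  assumes "u \<in> lists S" "w \<in> lists S"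
  shows "cls S R u \<otimes>\<^bsub>presented S R\<^esub> cls S R w = cls S R (u @ w)"
proof -
  have "cls S R (u' @ w') = cls S R (u @ w)" if "u' \<in> cls S R u" "w' \<in> cls S R w" for u' w'
  proof -
    have "word_cong S R u u'" "word_cong S R w w'" using that by (simp_all add: mem_cls_iff)
    then have "word_cong S R (u @ w) (u' @ w')" by (rule word_cong_append)
    moreover from this have "u @ w \<in> lists S \<and> u' @ w' \<in> lists S" by (rule word_cong_in_lists)
    ultimately show ?thesis using cls_eq_iff by metis
  qed
  moreover have "u \<in> cls S R u" "w \<in> cls S R w"
    using assms by (auto simp: mem_cls_iff intro: word_cong.refl)
  ultimately have "(\<Union>u'\<in>cls S R u. \<Union>w'\<in>cls S R w. cls S R (u' @ w')) = cls S R (u @ w)" by blast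
  then show ?thesis by (simp add: presented_def cls_def)
qed

lemma monoid_presented: "monoid (presented S R)"
proof (rule monoidI)
  show "x \<otimes>\<^bsub>presented S R\<^esub> y \<in> carrier (presented S R)"
    if "x \<in> carrier (presented S R)" "y \<in> carrier (presented S R)" for x y
  proof -
    from that obtain u w where "x = cls S R u" "y = cls S R w" "u \<in> lists S" "w \<in> lists S"
      by (auto simp: carrier_presented)
    moreover from this have "cls S R (u @ w) \<in> carrier (presented S R)"
      by (intro cls_in_presented) simp
    ultimately show ?thesis by (simp only: mult_presented)
  qed
  show "x \<otimes>\<^bsub>presented S R\<^esub> y \<otimes>\<^bsub>presented S R\<^esub> z = x \<otimes>\<^bsub>presented S R\<^esub> (y \<otimes>\<^bsub>presented S R\<^esub> z)"
    if "x \<in> carrier (presented S R)" "y \<in> carrier (presented S R)" "z \<in> carrier (presented S R)"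
    for x y z
  proof -
    from that obtain u v w where "x = cls S R u" "y = cls S R v" "z = cls S R w"
      and "u \<in> lists S" "v \<in> lists S" "w \<in> lists S"
      by (auto simp: carrier_presented)
    moreover from this have "u @ v \<in> lists S" "v @ w \<in> lists S" by simp_all
    ultimately show ?thesis by (simp only: mult_presented append_assoc)
  qed
  show "\<one>\<^bsub>presented S R\<^esub> \<in> carrier (presented S R)" by (simp add: one_presented)
  fix x assume "x \<in> carrier (presented S R)"
  then obtain w where w: "w \<in> lists S" and x: "x = cls S R w" by (auto simp: carrier_presented)
  show "\<one>\<^bsub>presented S R\<^esub> \<otimes>\<^bsub>presented S R\<^esub> x = x"
    using mult_presented[of "[]" S w R] w by (simp add: one_presented x)
  show "x \<otimes>\<^bsub>presented S R\<^esub> \<one>\<^bsub>presented S R\<^esub> = x"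
    using mult_presented[of w S "[]" R] w by (simp add: one_presented x)
qed

text \<open>Left inverses of the letters suffice: a word is inverted letter by letter in reverse
  order, and a monoid with left inverses is a group.\<close>

lemma group_presented:
  assumes "\<And>s. s \<in> S \<Longrightarrow> \<exists>t\<in>S. word_cong S R [t, s] []"
  shows "group (presented S R)"
proof (rule monoid.group_l_invI[OF monoid_presented])
  fix x assume "x \<in> carrier (presented S R)"
  then obtain w where w: "w \<in> lists S" and x: "x = cls S R w" by (auto simp: carrier_presented)
  from w have "\<exists>u\<in>lists S. word_cong S R (u @ w) []"
  proof (induction w)
    case Nil
    show ?case by (rule bexI[of _ "[]"]) (auto intro: word_cong.refl)
  next
    case (Cons s w)
    then obtain u where u: "u \<in> lists S" "word_cong S R (u @ w) []" by auto
    obtain t where t: "t \<in> S" "word_cong S R [t, s] []" using assms Cons.hyps by auto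
    have "word_cong S R (u @ [t, s] @ w) (u @ [] @ w)"
      using t u Cons.hyps by (intro word_cong_context) auto
    then have "word_cong S R ((u @ [t]) @ s # w) (u @ w)" by simp
    then have "word_cong S R ((u @ [t]) @ s # w) []" using u(2) by (rule word_cong.trans)
    with u t show ?case by (intro bexI[of _ "u @ [t]"]) auto
  qed
  then obtain u where u: "u \<in> lists S" "word_cong S R (u @ w) []" by auto
  with w have "cls S R (u @ w) = cls S R []" by (subst cls_eq_iff) auto
  with u w x show "\<exists>y\<in>carrier (presented S R). y \<otimes>\<^bsub>presented S R\<^esub> x = \<one>\<^bsub>presented S R\<^esub>"
    by (intro bexI[of _ "cls S R u"]) (auto simp: mult_presented one_presented)
qed

section \<open>Homomorphisms and cocycles out of a presented monoid\<close>

text \<open>A cocycle records a word read by an automaton with state set \<open>P\<close>, in which a letter \<open>s\<close>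
  multiplies the state by \<open>d s\<close> on the right and outputs \<open>f s p\<close>.\<close>

primrec cocycle ::
  "('p, 'm) monoid_scheme \<Rightarrow> ('q, 'k) monoid_scheme \<Rightarrow> ('x \<Rightarrow> 'p) \<Rightarrow> ('x \<Rightarrow> 'p \<Rightarrow> 'q) \<Rightarrow>
   'x list \<Rightarrow> 'p \<Rightarrow> 'q" where
  "cocycle P Q d f [] p = \<one>\<^bsub>Q\<^esub>"
| "cocycle P Q d f (s # w) p = f s p \<otimes>\<^bsub>Q\<^esub> cocycle P Q d f w (p \<otimes>\<^bsub>P\<^esub> d s)"

definition word_prod :: "('p, 'm) monoid_scheme \<Rightarrow> ('x \<Rightarrow> 'p) \<Rightarrow> 'x list \<Rightarrow> 'p" where
  "word_prod P d w = foldr (\<lambda>s. (\<otimes>\<^bsub>P\<^esub>) (d s)) w \<one>\<^bsub>P\<^esub>"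

lemma word_prod_simps [simp]:
  "word_prod P d [] = \<one>\<^bsub>P\<^esub>"
  "word_prod P d (s # w) = d s \<otimes>\<^bsub>P\<^esub> word_prod P d w"
  by (simp_all add: word_prod_def)

context
  fixes S :: "'x set" and P :: "('p, 'm) monoid_scheme" and d :: "'x \<Rightarrow> 'p"
  assumes P: "monoid P" and d: "d \<in> S \<rightarrow> carrier P"
begin

lemma word_prod_closed: "w \<in> lists S \<Longrightarrow> word_prod P d w \<in> carrier P"
  proof (induction w)
  case (Cons a w)
  then have "d a \<in> carrier P" using d by auto
  with Cons P show ?case by (simp add: monoid.m_closed)
qed (use P in simp)

lemma word_prod_append:
  "u \<in> lists S \<Longrightarrow> w \<in> lists S \<Longrightarrow> word_prod P d (u @ w) = word_prod P d u \<otimes>\<^bsub>P\<^esub> word_prod P d w"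
proof (induction u)
  case Nil
  then show ?case using P by (simp add: word_prod_closed)
next
  case (Cons a u)
  then have "d a \<in> carrier P" using d by auto
  with Cons show ?case using P by (simp add: monoid.m_assoc word_prod_closed)
qed

lemma word_prod_cong:
  assumes R: "\<And>l r. (l, r) \<in> R \<Longrightarrow> l \<in> lists S \<Longrightarrow> r \<in> lists S \<Longrightarrow> word_prod P d l = word_prod P d r"
    and "word_cong S R u w"
  shows "word_prod P d u = word_prod P d w"
  using assms(2) by (induction rule: word_cong.induct) (simp_all add: word_prod_append R)

text \<open>The universal property of the presentation. The map is evaluated on an arbitrary
  representative, which is legitimate because \<open>word_prod\<close> is constant on
  classes.\<close>

lemma presented_hom_exists:
  assumes R: "\<And>l r. (l, r) \<in> R \<Longrightarrow> l \<in> lists S \<Longrightarrow> r \<in> lists S \<Longrightarrow> word_prod P d l = word_prod P d r"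
  obtains h where "h \<in> hom (presented S R) P" "\<And>w. w \<in> lists S \<Longrightarrow> h (cls S R w) = word_prod P d w"
proof
  let ?h = "\<lambda>C. word_prod P d (SOME w. w \<in> C)"
  show h: "?h (cls S R w) = word_prod P d w" if "w \<in> lists S" for w
  proof -
    have "w \<in> cls S R w" using that by (simp add: mem_cls_iff word_cong.refl)
    then have "(SOME w'. w' \<in> cls S R w) \<in> cls S R w" by (rule someI)
    then have "word_cong S R w (SOME w'. w' \<in> cls S R w)" by (simp add: mem_cls_iff)
    from word_prod_cong[OF R this] show ?thesis by simp
  qed
  show "?h \<in> hom (presented S R) P"
  proof (rule homI)
    fix x y assume "x \<in> carrier (presented S R)" "y \<in> carrier (presented S R)"
    then obtain u w where "x = cls S R u" "y = cls S R w" "u \<in> lists S" "w \<in> lists S"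
      by (auto simp: carrier_presented)
    moreover from this have "u @ w \<in> lists S" by simp
    ultimately show "?h (x \<otimes>\<^bsub>presented S R\<^esub> y) = ?h x \<otimes>\<^bsub>P\<^esub> ?h y"
      by (simp only: mult_presented h word_prod_append)
  next
    fix x assume "x \<in> carrier (presented S R)"
    then obtain u where "x = cls S R u" "u \<in> lists S" by (auto simp: carrier_presented)
    then show "?h x \<in> carrier P" by (simp only: h word_prod_closed)
  qed
qed

context
  fixes Q :: "('q, 'k) monoid_scheme" and f :: "'x \<Rightarrow> 'p \<Rightarrow> 'q"
  assumes Q: "monoid Q" and f: "\<And>s p. s \<in> S \<Longrightarrow> p \<in> carrier P \<Longrightarrow> f s p \<in> carrier Q"
begin

lemma cocycle_closed: "w \<in> lists S \<Longrightarrow> p \<in> carrier P \<Longrightarrow> cocycle P Q d f w p \<in> carrier Q"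
proof (induction w arbitrary: p)
  case (Cons a w)
  then have "d a \<in> carrier P" using d by auto
  with Cons P Q f show ?case by (simp add: monoid.m_closed)
qed (use Q in simp)

text \<open>The crossed homomorphism rule: the second word is read from the state in which the first
  one ends.\<close>

lemma cocycle_append:
  "u \<in> lists S \<Longrightarrow> w \<in> lists S \<Longrightarrow> p \<in> carrier P \<Longrightarrow>
   cocycle P Q d f (u @ w) p = cocycle P Q d f u p \<otimes>\<^bsub>Q\<^esub> cocycle P Q d f w (p \<otimes>\<^bsub>P\<^esub> word_prod P d u)"
proof (induction u arbitrary: p)
  case Nil
  then show ?case using P Q by (simp add: cocycle_closed)
next
  case (Cons a u)
  then have a: "d a \<in> carrier P" using d by auto
  with Cons show ?case using P Q f
    by (simp add: monoid.m_assoc monoid.m_closed word_prod_closed cocycle_closed)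
qed

text \<open>The two sides of a relation must produce the same output and also lead to the same
  state; otherwise the letters after them would be read from different states.\<close>

lemma presented_cocycle_exists:
  assumes R: "\<And>l r. (l, r) \<in> R \<Longrightarrow> l \<in> lists S \<Longrightarrow> r \<in> lists S \<Longrightarrow> word_prod P d l = word_prod P d r"
    and Rf: "\<And>l r p. (l, r) \<in> R \<Longrightarrow> l \<in> lists S \<Longrightarrow> r \<in> lists S \<Longrightarrow> p \<in> carrier P \<Longrightarrow>
      cocycle P Q d f l p = cocycle P Q d f r p"
  obtains h where "\<And>w p. w \<in> lists S \<Longrightarrow> p \<in> carrier P \<Longrightarrow> h (cls S R w) p = cocycle P Q d f w p"
proof
  let ?h = "\<lambda>C. cocycle P Q d f (SOME w. w \<in> C)"
  fix w p assume w: "w \<in> lists S" and p: "p \<in> carrier P"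
  have cong: "cocycle P Q d f u p = cocycle P Q d f v p"
    if "word_cong S R u v" "p \<in> carrier P" for u v p
    using that
  proof (induction arbitrary: p rule: word_cong.induct)
    case (rel l r p' q)
    then show ?case using P
      by (simp add: cocycle_append R Rf word_prod_append word_prod_closed monoid.m_closed)
  qed simp_all
  have "w \<in> cls S R w" using w by (simp add: mem_cls_iff word_cong.refl)
  then have "(SOME w'. w' \<in> cls S R w) \<in> cls S R w" by (rule someI)
  then have "word_cong S R w (SOME w'. w' \<in> cls S R w)" by (simp add: mem_cls_iff)
  from cong[OF this p] show "?h (cls S R w) p = cocycle P Q d f w p" by simp
qed

end

end

section \<open>Free groups of finite rank\<close>

definition free_letters :: "nat \<Rightarrow> (nat \<times> bool) set" where
  "free_letters r = {..<r} \<times> UNIV"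

definition free_relations :: "nat \<Rightarrow> ((nat \<times> bool) list \<times> (nat \<times> bool) list) set" where
  "free_relations r = {([(i, b), (i, \<not> b)], []) | i b. i < r}"

lemma free_group_eq: "free_group r = presented (free_letters r) (free_relations r)"
  unfolding free_group_def free_letters_def free_relations_def by simp

lemma mem_free_letters [simp]: "(i, b) \<in> free_letters r \<longleftrightarrow> i < r"
  by (simp add: free_letters_def)

lemma free_relationsI: "i < r \<Longrightarrow> ([(i, b), (i, \<not> b)], []) \<in> free_relations r"
  by (auto simp: free_relations_def)

definition free_gen :: "nat \<Rightarrow> nat \<times> bool \<Rightarrow> (nat \<times> bool) list set" where
  "free_gen r s = cls (free_letters r) (free_relations r) [s]"

lemma group_free_group: "group (free_group r)"
  unfolding free_group_eq
proof (rule group_presented)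
  fix s assume "s \<in> free_letters r"
  then obtain i b where s: "s = (i, b)" "i < r" by (auto simp: free_letters_def)
  have "word_cong (free_letters r) (free_relations r)
      ([] @ [(i, \<not> b), (i, \<not> \<not> b)] @ []) ([] @ [] @ [])"
    using s by (intro word_cong.rel free_relationsI) (auto simp: free_letters_def)
  with s show "\<exists>t\<in>free_letters r. word_cong (free_letters r) (free_relations r) [t, s] []"
    by (intro bexI[of _ "(i, \<not> b)"]) auto
qed

lemma free_gen_in_carrier [simp]: "i < r \<Longrightarrow> free_gen r (i, b) \<in> carrier (free_group r)"
  by (simp add: free_gen_def free_group_eq)

lemma free_gen_inv:
  assumes "i < r" shows "inv\<^bsub>free_group r\<^esub> free_gen r (i, b) = free_gen r (i, \<not> b)"
proof -
  have "word_cong (free_letters r) (free_relations r) ([] @ [(i, \<not> b), (i, \<not> \<not> b)] @ []) ([] @ [] @ [])"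
    using assms by (intro word_cong.rel free_relationsI) (auto simp: free_letters_def)
  then have "word_cong (free_letters r) (free_relations r) [(i, \<not> b), (i, b)] []" by simp
  then have "free_gen r (i, \<not> b) \<otimes>\<^bsub>free_group r\<^esub> free_gen r (i, b) = \<one>\<^bsub>free_group r\<^esub>"
    using assms by (simp add: free_gen_def free_group_eq mult_presented one_presented cls_eq_iff)
  then show ?thesis
    using group.inv_equality[OF group_free_group _ free_gen_in_carrier free_gen_in_carrier] assms
      by blast
qed

text \<open>The universal property of the free group: sending \<open>(i, False)\<close> to the
  inverse of \<open>k i\<close> makes the cancellation relations hold in \<open>K\<close> for both
  signs.\<close>

lemma free_group_hom_exists:
  assumes K: "group K" and k: "\<And>i. i < r \<Longrightarrow> k i \<in> carrier K"
  obtains h where "h \<in> hom (free_group r) K" "\<And>i. i < r \<Longrightarrow> h (free_gen r (i, True)) = k i"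
proof -
  interpret K: group K by fact
  let ?d = "\<lambda>(i, b). if b then k i else inv\<^bsub>K\<^esub> k i"
  have d: "?d \<in> free_letters r \<rightarrow> carrier K" using k
    by (auto simp: free_letters_def split: if_splits)
  obtain h where "h \<in> hom (presented (free_letters r) (free_relations r)) K"
    and h: "\<And>w. w \<in> lists (free_letters r) \<Longrightarrow>
      h (cls (free_letters r) (free_relations r) w) = word_prod K ?d w"
    by (rule presented_hom_exists[OF K.monoid_axioms d, of "free_relations r"])
      (use k in \<open>auto simp: free_relations_def split: if_splits\<close>)
  moreover have "h (free_gen r (i, True)) = k i" if "i < r" for i
    unfolding free_gen_def using that k by (subst h) auto
  ultimately show thesis using that by (simp add: free_group_eq)
qed

lemma free_group_induct [consumes 1, case_names one gen]:
  assumes "y \<in> carrier (free_group r)"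
    and "Pr \<one>\<^bsub>free_group r\<^esub>"
    and "\<And>i b y. i < r \<Longrightarrow> y \<in> carrier (free_group r) \<Longrightarrow> Pr y \<Longrightarrow>
      Pr (free_gen r (i, b) \<otimes>\<^bsub>free_group r\<^esub> y)"
  shows "Pr y"
proof -
  obtain w where w: "w \<in> lists (free_letters r)" and y: "y = cls (free_letters r) (free_relations r) w"
    using assms(1) by (auto simp: free_group_eq carrier_presented)
  from w have "Pr (cls (free_letters r) (free_relations r) w)"
  proof (induction w)
    case Nil
    then show ?case using assms(2) by (simp add: free_group_eq one_presented)
  next
    case (Cons s w)
    then obtain i b where s: "s = (i, b)" "i < r" by (auto simp: free_letters_def)
    have "cls (free_letters r) (free_relations r) (s # w) = free_gen r s \<otimes>\<^bsub>free_group r\<^esub> cls (free_letters r) (free_relations r) w"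
      using Cons s by (simp add: free_gen_def free_group_eq mult_presented)
    then show ?case using assms(3)[OF s(2), of "cls (free_letters r) (free_relations r) w"] Cons s
      by (simp add: free_group_eq)
  qed
  with y show ?thesis by simp
qed

section \<open>The path group\<close>

locale graph_groups =
  fixes \<G> :: "('v, 'e, 'a, 'b) graph_of_groups"
  assumes graph_of_groups: "graph_of_groups \<G>"
begin

abbreviation "V \<equiv> verts (graph \<G>)"
abbreviation "E \<equiv> arcs (graph \<G>)"
abbreviation "src \<equiv> tail (graph \<G>)"
abbreviation "tgt \<equiv> head (graph \<G>)"
abbreviation "rev_arc \<equiv> arc_rev \<G>"
abbreviation "VG \<equiv> vertex_group \<G>"
abbreviation "EG \<equiv> edge_group \<G>"
abbreviation "inc \<equiv> edge_map \<G>"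
abbreviation "F \<equiv> path_group \<G>"
abbreviation path_product (infixl "\<star>" 70) where "y \<star> z \<equiv> y \<otimes>\<^bsub>F\<^esub> z"
abbreviation "Paths \<equiv> path_classes \<G>"

sublocale bidirected_digraph "graph \<G>" "arc_rev \<G>"
  using graph_of_groups by (simp add: graph_of_groups_def)

lemma group_VG: "v \<in> V \<Longrightarrow> group (VG v)"
  and group_EG: "e \<in> E \<Longrightarrow> group (EG e)"
  and EG_rev: "e \<in> E \<Longrightarrow> EG (rev_arc e) = EG e"
  and inc_mon: "e \<in> E \<Longrightarrow> inc e \<in> mon (EG e) (VG (tgt e))"
  using graph_of_groups by (auto simp: graph_of_groups_def)

lemma inc_hom: "e \<in> E \<Longrightarrow> inc e \<in> hom (EG e) (VG (tgt e))"
  and inc_inj: "e \<in> E \<Longrightarrow> inj_on (inc e) (carrier (EG e))"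
  using inc_mon by (auto simp: mon_def)

lemma inc_closed: "e \<in> E \<Longrightarrow> i \<in> carrier (EG e) \<Longrightarrow> inc e i \<in> carrier (VG (tgt e))"
  using inc_hom by (auto simp: hom_def)

text \<open>The edge groups of an arc and of its reverse are equal, not just isomorphic, so
  \<open>inc (rev_arc e)\<close> embeds \<open>EG e\<close> itself at the tail.\<close>

lemma inc_rev_hom: "e \<in> E \<Longrightarrow> inc (rev_arc e) \<in> hom (EG e) (VG (src e))"
  using inc_hom[of "rev_arc e"] EG_rev[of e] by simp

lemma inc_rev_inj: "e \<in> E \<Longrightarrow> inj_on (inc (rev_arc e)) (carrier (EG e))"
  using inc_inj[of "rev_arc e"] EG_rev[of e] by simp

lemma inc_rev_closed:
  "e \<in> E \<Longrightarrow> i \<in> carrier (EG e) \<Longrightarrow> inc (rev_arc e) i \<in> carrier (VG (src e))"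
  using inc_rev_hom by (auto simp: hom_def)

section \<open>Vertex and arc elements of the path group\<close>

definition vt :: "'v \<Rightarrow> 'a \<Rightarrow> ('v, 'e, 'a) letter list set" where
  "vt v c = word_class \<G> [Vtx v c]"

definition ed :: "'e \<Rightarrow> ('v, 'e, 'a) letter list set" where
  "ed e = word_class \<G> [Edg e]"

abbreviation "tail_elt e i \<equiv> vt (src e) (inc (rev_arc e) i)"
abbreviation "head_elt e i \<equiv> vt (tgt e) (inc e i)"

lemma word_class_eq_cls: "word_class \<G> w = cls (letters \<G>) (relations \<G>) w"
  by (simp add: word_class_def cls_def)

lemma Vtx_letter [simp]: "Vtx v c \<in> letters \<G> \<longleftrightarrow> v \<in> V \<and> c \<in> carrier (VG v)"
  by (auto simp: letters_def)

lemma Edg_letter [simp]: "Edg e \<in> letters \<G> \<longleftrightarrow> e \<in> E"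
  by (auto simp: letters_def)

lemma relations_cong:
  assumes "(l, r) \<in> relations \<G>" "l \<in> lists (letters \<G>)" "r \<in> lists (letters \<G>)"
  shows "word_cong (letters \<G>) (relations \<G>) l r"
  using word_cong.rel[OF assms, of "[]" "[]"] by simp

lemma relations_cases:
  assumes "(l, r) \<in> relations \<G>"
  obtains v g h where "v \<in> V" "g \<in> carrier (VG v)" "h \<in> carrier (VG v)"
      "l = [Vtx v g, Vtx v h]" "r = [Vtx v (g \<otimes>\<^bsub>VG v\<^esub> h)]"
  | v where "v \<in> V" "l = [Vtx v \<one>\<^bsub>VG v\<^esub>]" "r = []"
  | e where "e \<in> E" "l = [Edg e, Edg (rev_arc e)]" "r = []"
  | e i where "e \<in> E" "i \<in> carrier (EG e)" "l = [Edg e, Vtx (tgt e) (inc e i), Edg (rev_arc e)]"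
      "r = [Vtx (src e) (inc (rev_arc e) i)]"
  using assms unfolding relations_def by blast

lemma relations_intros:
  "v \<in> V \<Longrightarrow> g \<in> carrier (VG v) \<Longrightarrow> h \<in> carrier (VG v) \<Longrightarrow>
    ([Vtx v g, Vtx v h], [Vtx v (g \<otimes>\<^bsub>VG v\<^esub> h)]) \<in> relations \<G>"
  "v \<in> V \<Longrightarrow> ([Vtx v \<one>\<^bsub>VG v\<^esub>], []) \<in> relations \<G>"
  "e \<in> E \<Longrightarrow> ([Edg e, Edg (rev_arc e)], []) \<in> relations \<G>"
  "e \<in> E \<Longrightarrow> i \<in> carrier (EG e) \<Longrightarrow>
    ([Edg e, Vtx (tgt e) (inc e i), Edg (rev_arc e)], [Vtx (src e) (inc (rev_arc e) i)]) \<in> relations \<G>"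
  unfolding relations_def by blast+

lemma group_path_group: "group F"
  unfolding path_group_def
proof (rule group_presented)
  fix s assume s: "s \<in> letters \<G>"
  show "\<exists>t\<in>letters \<G>. word_cong (letters \<G>) (relations \<G>) [t, s] []"
  proof (cases s)
    case (Vtx v c)
    with s have v: "v \<in> V" "c \<in> carrier (VG v)" by auto
    interpret group "VG v" using group_VG v by blast
    have "word_cong (letters \<G>) (relations \<G>) [Vtx v (inv\<^bsub>VG v\<^esub> c), Vtx v c] [Vtx v \<one>\<^bsub>VG v\<^esub>]"
      using relations_cong[OF relations_intros(1)[OF v(1) inv_closed[OF v(2)] v(2)]] v by simp
    moreover have "word_cong (letters \<G>) (relations \<G>) [Vtx v \<one>\<^bsub>VG v\<^esub>] []"
      using relations_cong[OF relations_intros(2)[OF v(1)]] v by simp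
    ultimately have "word_cong (letters \<G>) (relations \<G>) [Vtx v (inv\<^bsub>VG v\<^esub> c), Vtx v c] []"
      by (rule word_cong.trans)
    then show ?thesis using Vtx v by (intro bexI[of _ "Vtx v (inv\<^bsub>VG v\<^esub> c)"]) auto
  next
    case (Edg e)
    with s have "e \<in> E" by simp
    then have "word_cong (letters \<G>) (relations \<G>) [Edg (rev_arc e), Edg (rev_arc (rev_arc e))] []"
      by (intro relations_cong relations_intros(3)) auto
    with Edg \<open>e \<in> E\<close> show ?thesis by (intro bexI[of _ "Edg (rev_arc e)"]) auto
  qed
qed

sublocale F: group F by (rule group_path_group)

lemma word_class_closed [simp]: "w \<in> lists (letters \<G>) \<Longrightarrow> word_class \<G> w \<in> carrier F"
  by (simp add: word_class_eq_cls path_group_def)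

lemma word_class_append:
  "u \<in> lists (letters \<G>) \<Longrightarrow> w \<in> lists (letters \<G>) \<Longrightarrow>
    word_class \<G> (u @ w) = word_class \<G> u \<star> word_class \<G> w"
  by (simp add: word_class_eq_cls path_group_def mult_presented)

lemma word_class_Nil: "word_class \<G> [] = \<one>\<^bsub>F\<^esub>"
  by (simp add: word_class_eq_cls path_group_def one_presented)

lemma word_class_Cons:
  assumes "s \<in> letters \<G>" "w \<in> lists (letters \<G>)"
  shows "word_class \<G> (s # w) = (case s of Vtx v c \<Rightarrow> vt v c | Edg e \<Rightarrow> ed e) \<star> word_class \<G> w"
  using word_class_append[of "[s]" w] assms by (cases s) (auto simp: vt_def ed_def)

lemma word_class_relation:
  assumes "(l, r) \<in> relations \<G>" "l \<in> lists (letters \<G>)" "r \<in> lists (letters \<G>)"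
  shows "word_class \<G> l = word_class \<G> r"
  using relations_cong[OF assms] assms by (simp add: word_class_eq_cls cls_eq_iff)

lemma vt_closed [simp]: "v \<in> V \<Longrightarrow> c \<in> carrier (VG v) \<Longrightarrow> vt v c \<in> carrier F"
  by (simp add: vt_def)

lemma ed_closed [simp]: "e \<in> E \<Longrightarrow> ed e \<in> carrier F"
  by (simp add: ed_def)

lemma vt_mult:
  assumes "v \<in> V" "c \<in> carrier (VG v)" "d \<in> carrier (VG v)"
  shows "vt v (c \<otimes>\<^bsub>VG v\<^esub> d) = vt v c \<star> vt v d"
proof -
  interpret group "VG v" using group_VG assms(1) .
  show ?thesis
    using word_class_relation[OF relations_intros(1)[OF assms]] assms
    by (simp add: word_class_Cons word_class_Nil)
qed

lemma vt_one: "v \<in> V \<Longrightarrow> vt v \<one>\<^bsub>VG v\<^esub> = \<one>\<^bsub>F\<^esub>"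
proof -
  assume v: "v \<in> V"
  interpret group "VG v" using group_VG v .
  show ?thesis
    using word_class_relation[OF relations_intros(2)[OF v]] v
    by (simp add: word_class_Cons word_class_Nil)
qed

lemma vt_hom: "v \<in> V \<Longrightarrow> vt v \<in> hom (VG v) F"
  by (auto intro!: homI simp: vt_mult)

lemma vt_inv:
  assumes "v \<in> V" "c \<in> carrier (VG v)"
  shows "vt v (inv\<^bsub>VG v\<^esub> c) = inv\<^bsub>F\<^esub> vt v c"
proof -
  interpret group_hom "VG v" F "vt v"
    using group_VG assms vt_hom by (auto simp: group_hom_def group_hom_axioms_def)
  show ?thesis using assms by simp
qed

lemma ed_rev_mult: "e \<in> E \<Longrightarrow> ed e \<star> ed (rev_arc e) = \<one>\<^bsub>F\<^esub>"
  using word_class_relation[OF relations_intros(3)[of e]]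
  by (simp add: word_class_Cons word_class_Nil)

lemma ed_rev: "e \<in> E \<Longrightarrow> ed (rev_arc e) = inv\<^bsub>F\<^esub> ed e"
  using ed_rev_mult[of "rev_arc e"] F.inv_equality[of "ed (rev_arc e)" "ed e"] by simp

text \<open>The edge relation solved for the form in which it is applied throughout: an edge element
  passes across its arc, changing from its image at the head to its image at the tail.\<close>

lemma ed_vt:
  assumes "e \<in> E" "i \<in> carrier (EG e)"
  shows "ed e \<star> head_elt e i = tail_elt e i \<star> ed e"
proof -
  have "ed e \<star> (head_elt e i \<star> ed (rev_arc e)) = tail_elt e i"
    using word_class_relation[OF relations_intros(4)[OF assms]] assms
    by (simp add: word_class_Cons word_class_Nil inc_closed inc_rev_closed)
  then show ?thesis
    using assms
      by (simp add: ed_rev F.inv_solve_right' F.m_assoc[symmetric] inc_closed inc_rev_closed)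
qed

section \<open>Elements of the path group carried by paths\<close>

lemma path_word_in_lists: "path_word \<G> u p w \<Longrightarrow> p \<in> lists (letters \<G>) \<and> u \<in> V \<and> w \<in> V"
proof (induction p arbitrary: u)
  case (Cons s p)
  then show ?case by (cases s) auto
qed auto

lemma path_classes_closed: "y \<in> Paths u w \<Longrightarrow> y \<in> carrier F"
  unfolding path_classes_def using path_word_in_lists word_class_closed by blast

lemma path_classes_verts: "y \<in> Paths u w \<Longrightarrow> u \<in> V \<and> w \<in> V"
  unfolding path_classes_def using path_word_in_lists by blast

lemma path_one [simp]: "u \<in> V \<Longrightarrow> \<one>\<^bsub>F\<^esub> \<in> Paths u u"
  unfolding path_classes_def by (auto intro!: exI[of _ "[]"] simp: word_class_Nil)

lemma path_vt_mult:
  assumes "y \<in> Paths v w" "c \<in> carrier (VG v)"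
  shows "vt v c \<star> y \<in> Paths v w"
proof -
  obtain p where p: "path_word \<G> v p w" "y = word_class \<G> p" using assms
    by (auto simp: path_classes_def)
  then have "path_word \<G> v (Vtx v c # p) w" using assms path_word_in_lists by auto
  moreover have "vt v c \<star> y = word_class \<G> (Vtx v c # p)"
    using p assms path_word_in_lists[OF p(1)] by (simp add: word_class_Cons)
  ultimately show ?thesis by (auto simp: path_classes_def)
qed

lemma path_ed_mult:
  assumes "y \<in> Paths (tgt e) w" "e \<in> E"
  shows "ed e \<star> y \<in> Paths (src e) w"
proof -
  obtain p where p: "path_word \<G> (tgt e) p w" "y = word_class \<G> p"
    using assms by (auto simp: path_classes_def)
  then have "path_word \<G> (src e) (Edg e # p) w" using assms by auto
  moreover have "ed e \<star> y = word_class \<G> (Edg e # p)"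
    using p assms path_word_in_lists[OF p(1)] by (simp add: word_class_Cons)
  ultimately show ?thesis by (auto simp: path_classes_def)
qed

text \<open>Letters are peeled off at the front, so the end vertex \<open>w\<close> stays fixed
  while the start vertex varies. Statements proved by this rule therefore have to be general in the
  start vertex and in any data attached to it.\<close>

lemma path_induct [consumes 1, case_names one vt ed]:
  assumes "y \<in> Paths u w"
    and "Pr w \<one>\<^bsub>F\<^esub>"
    and "\<And>v c y. v \<in> V \<Longrightarrow> c \<in> carrier (VG v) \<Longrightarrow> y \<in> Paths v w \<Longrightarrow> Pr v y \<Longrightarrow> Pr v (vt v c \<star> y)"
    and "\<And>e y. e \<in> E \<Longrightarrow> y \<in> Paths (tgt e) w \<Longrightarrow> Pr (tgt e) y \<Longrightarrow> Pr (src e) (ed e \<star> y)"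
  shows "Pr u y"
proof -
  obtain p where p: "path_word \<G> u p w" "y = word_class \<G> p"
    using assms(1) by (auto simp: path_classes_def)
  from p(1) have "Pr u (word_class \<G> p)"
  proof (induction p arbitrary: u)
    case Nil
    then show ?case using assms(2) by (simp add: word_class_Nil)
  next
    case (Cons s p)
    show ?case
    proof (cases s)
      case (Vtx v c)
      with Cons.prems have *: "v \<in> V" "u = v" "c \<in> carrier (VG v)" "path_word \<G> v p w" by auto
      with Cons.IH have "Pr v (vt v c \<star> word_class \<G> p)"
        by (intro assms(3)) (auto simp: path_classes_def)
      with Vtx * path_word_in_lists[OF *(4)] show ?thesis by (simp add: word_class_Cons)
    next
      case (Edg e)
      with Cons.prems have *: "e \<in> E" "u = src e" "path_word \<G> (tgt e) p w" by auto
      with Cons.IH have "Pr (src e) (ed e \<star> word_class \<G> p)"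
        by (intro assms(4)) (auto simp: path_classes_def)
      with Edg * path_word_in_lists[OF *(3)] show ?thesis by (simp add: word_class_Cons)
    qed
  qed
  with p show ?thesis by simp
qed

lemma path_vt [simp]: "v \<in> V \<Longrightarrow> c \<in> carrier (VG v) \<Longrightarrow> vt v c \<in> Paths v v"
  using path_vt_mult[of "\<one>\<^bsub>F\<^esub>" v v c] by simp

lemma path_ed [simp]: "e \<in> E \<Longrightarrow> ed e \<in> Paths (src e) (tgt e)"
  using path_ed_mult[of "\<one>\<^bsub>F\<^esub>" e "tgt e"] by simp

lemma path_mult:
  assumes "y \<in> Paths u v" "z \<in> Paths v w"
  shows "y \<star> z \<in> Paths u w"
  using assms
proof (induction rule: path_induct)
  case one
  then show ?case by (simp add: path_classes_closed)
next
  case (vt v c y)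
  then show ?case using path_vt_mult[of "y \<star> z" v w c] by (simp add: F.m_assoc path_classes_closed)
next
  case (ed e y)
  then show ?case using path_ed_mult[of "y \<star> z" e w] by (simp add: F.m_assoc path_classes_closed)
qed

lemma path_inv:
  assumes "y \<in> Paths u w"
  shows "inv\<^bsub>F\<^esub> y \<in> Paths w u"
  using assms
proof (induction rule: path_induct)
  case one
  then show ?case using assms path_classes_verts by simp
next
  case (vt v c y)
  then interpret group "VG v" using group_VG by blast
  have "inv\<^bsub>F\<^esub> y \<star> vt v (inv\<^bsub>VG v\<^esub> c) \<in> Paths w v" using vt by (intro path_mult[OF vt(4)]) auto
  with vt show ?case by (simp add: F.inv_mult_group path_classes_closed vt_inv)
next
  case (ed e y)
  have "inv\<^bsub>F\<^esub> y \<star> ed (rev_arc e) \<in> Paths w (src e)"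
    using ed path_ed[of "rev_arc e"] by (intro path_mult[OF ed(3)]) auto
  with ed show ?case by (simp add: F.inv_mult_group path_classes_closed ed_rev)
qed

lemma path_exists:
  assumes "u \<in> V" "w \<in> V"
  shows "\<exists>y. y \<in> Paths u w"
proof -
  have "u \<rightarrow>\<^sup>*\<^bsub>mk_symmetric (graph \<G>)\<^esub> w"
    using graph_of_groups assms
    by (auto simp: graph_of_groups_def Digraph_Component.connected_def elim!: strongly_connectedE)
  \<comment> \<open>Arcs occur in opposite pairs, so passing to the symmetric closure adds nothing
    to reachability.\<close>
  then have "u \<rightarrow>\<^sup>*\<^bsub>graph \<G>\<^esub> w" by (simp add: reachable_mk_symmetric_eq[OF sym_arcs])
  then show ?thesis
  proof (induction rule: reachable_induct)
    case base
    then show ?case using path_one by blast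
  next
    case (step w w')
    then obtain y e where "y \<in> Paths u w" "e \<in> E" "src e = w" "tgt e = w'"
      by (auto simp: arcs_ends_def arc_to_ends_def)
    then show ?case using path_mult[OF \<open>y \<in> Paths u w\<close>] path_ed[of e] by blast
  qed
qed

lemma fundamental_group_simps [simp]:
  "carrier (fundamental_group \<G> u) = Paths u u"
  "\<one>\<^bsub>fundamental_group \<G> u\<^esub> = \<one>\<^bsub>F\<^esub>"
  "(\<otimes>\<^bsub>fundamental_group \<G> u\<^esub>) = (\<otimes>\<^bsub>F\<^esub>)"
  by (simp_all add: fundamental_group_def)

end

section \<open>Kernels that meet the vertex groups trivially\<close>

text \<open>The target \<open>P\<close> is an arbitrary group here; for the theorem it becomes the
  affine group. The second assumption says that the kernel meets the image of every vertex group
  trivially, which is the algebraic form of a free action on the vertices of the Bass-Serre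
  tree.\<close>

locale kernel_cover = graph_groups \<G> + P: group P
  for \<G> :: "('v, 'e, 'a, 'b) graph_of_groups" and P :: "('p, 'm) monoid_scheme" +
  fixes \<delta> :: "('v, 'e, 'a) letter list set \<Rightarrow> 'p" and x :: 'v
  assumes \<delta>_hom: "\<delta> \<in> hom F P"
    and \<delta>_inj: "v \<in> V \<Longrightarrow> c \<in> carrier (VG v) \<Longrightarrow> \<delta> (vt v c) = \<one>\<^bsub>P\<^esub> \<Longrightarrow> vt v c = \<one>\<^bsub>F\<^esub>"
    and base_vertex: "x \<in> V"
begin

section \<open>States and the arcs of the quotient graph\<close>

abbreviation state_product (infixl "\<diamond>" 70) where "p \<diamond> q \<equiv> p \<otimes>\<^bsub>P\<^esub> q"

sublocale \<delta>: group_hom F P \<delta>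
  using \<delta>_hom F.is_group P.is_group by (simp add: group_hom_def group_hom_axioms_def)

text \<open>Two elements of \<open>Paths x v\<close> have the same image under
  \<open>\<delta>\<close> exactly when they differ on the left by an element of the kernel. Hence
  states are kernel orbits of paths, and cosets of states under vertex and edge groups form the
  quotient of the Bass-Serre tree by the kernel.\<close>

definition states :: "'v \<Rightarrow> 'p set" where
  "states v = \<delta> ` Paths x v"

text \<open>An arc of the quotient graph, as a coset of the edge group embedded at the tail. The
  label \<open>e\<close> keeps arcs over different arcs of the graph apart even when their cosets
  agree as sets.\<close>

definition carc :: "'e \<Rightarrow> 'p \<Rightarrow> 'e \<times> 'p set" where
  "carc e p = (e, (\<lambda>i. p \<diamond> \<delta> (tail_elt e i)) ` carrier (EG e))"

definition crev :: "'e \<times> 'p set \<Rightarrow> 'e \<times> 'p set" where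
  "crev a = (rev_arc (fst a), (\<lambda>q. q \<diamond> \<delta> (ed (fst a))) ` snd a)"

definition orb :: "'v \<Rightarrow> 'p \<Rightarrow> 'p set" where
  "orb v p = (\<lambda>c. p \<diamond> \<delta> (vt v c)) ` carrier (VG v)"

lemma states_closed: "p \<in> states v \<Longrightarrow> p \<in> carrier P"
  by (auto simp: states_def path_classes_closed)

lemma states_verts: "p \<in> states v \<Longrightarrow> v \<in> V"
  using path_classes_verts by (auto simp: states_def)

lemma states_one: "\<one>\<^bsub>P\<^esub> \<in> states x"
  unfolding states_def using base_vertex by (metis \<delta>.hom_one image_eqI path_one)

lemma states_mult:
  assumes "p \<in> states u" "y \<in> Paths u v"
  shows "p \<diamond> \<delta> y \<in> states v"
proof -
  obtain z where z: "z \<in> Paths x u" "p = \<delta> z" using assms by (auto simp: states_def)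
  then have "p \<diamond> \<delta> y = \<delta> (z \<star> y)" using assms by (simp add: path_classes_closed)
  then show ?thesis unfolding states_def using path_mult[OF z(1) assms(2)] by blast
qed

lemma states_vt: "p \<in> states v \<Longrightarrow> c \<in> carrier (VG v) \<Longrightarrow> p \<diamond> \<delta> (vt v c) \<in> states v"
  by (rule states_mult) (auto dest: states_verts)

lemma states_ed: "p \<in> states (src e) \<Longrightarrow> e \<in> E \<Longrightarrow> p \<diamond> \<delta> (ed e) \<in> states (tgt e)"
  by (rule states_mult) auto

text \<open>Conjugation by \<open>ed e\<close> exchanges the two images of the edge group, so
  translating an edge coset at the tail by \<open>\<delta> (ed e)\<close> yields the edge coset at
  the head.\<close>

lemma carc_rev_eq:
  assumes "e \<in> E" "p \<in> carrier P"
  shows "carc (rev_arc e) (p \<diamond> \<delta> (ed e)) = crev (carc e p)"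
proof -
  have "p \<diamond> \<delta> (ed e) \<diamond> \<delta> (head_elt e i) =
      p \<diamond> \<delta> (tail_elt e i) \<diamond> \<delta> (ed e)" if "i \<in> carrier (EG e)" for i
  proof -
    have "\<delta> (ed e) \<diamond> \<delta> (head_elt e i) = \<delta> (tail_elt e i) \<diamond> \<delta> (ed e)"
      using ed_vt[OF assms(1) that] that assms
      by (simp flip: \<delta>.hom_mult add: inc_closed inc_rev_closed)
    then show ?thesis using that assms by (simp add: P.m_assoc inc_closed inc_rev_closed)
  qed
  then show ?thesis using assms EG_rev by (auto simp: carc_def crev_def image_image)
qed

lemma crev_crev:
  assumes "e \<in> E" "p \<in> carrier P"
  shows "crev (crev (carc e p)) = carc e p"
proof -
  have "crev (crev (carc e p)) = carc e (p \<diamond> \<delta> (ed e) \<diamond> \<delta> (ed (rev_arc e)))"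
    using carc_rev_eq[OF assms] carc_rev_eq[of "rev_arc e" "p \<diamond> \<delta> (ed e)"] assms by simp
  also have "p \<diamond> \<delta> (ed e) \<diamond> \<delta> (ed (rev_arc e)) = p"
    using assms by (simp add: P.m_assoc ed_rev)
  finally show ?thesis .
qed

lemma carc_vt:
  assumes "e \<in> E" "p \<in> carrier P" "i \<in> carrier (EG e)"
  shows "carc e (p \<diamond> \<delta> (tail_elt e i)) = carc e p"
proof -
  interpret EG: group "EG e" using group_EG assms by blast
  let ?f = "\<lambda>i. \<delta> (tail_elt e i)"
  have mult: "?f (j \<otimes>\<^bsub>EG e\<^esub> k) = ?f j \<diamond> ?f k" if "j \<in> carrier (EG e)" "k \<in> carrier (EG e)" for j k
    using that assms inc_rev_hom[OF assms(1)] by (simp add: vt_mult inc_rev_closed hom_mult)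
  have cl: "?f j \<in> carrier P" if "j \<in> carrier (EG e)" for j
    using that assms by (simp add: inc_rev_closed)
  have "(\<lambda>j. p \<diamond> ?f i \<diamond> ?f j) ` carrier (EG e) = (\<lambda>j. p \<diamond> ?f j) ` (\<lambda>j. i \<otimes>\<^bsub>EG e\<^esub> j) ` carrier (EG e)"
    using assms cl by (auto simp: image_image mult P.m_assoc intro!: image_cong)
  also have "(\<lambda>j. i \<otimes>\<^bsub>EG e\<^esub> j) ` carrier (EG e) = carrier (EG e)"
    using EG.surj_const_mult[OF assms(3)] .
  finally show ?thesis by (simp add: carc_def)
qed

lemma carc_eqD:
  assumes "carc e p = carc e' p'" "e \<in> E" "p' \<in> carrier P"
  obtains i where "e' = e" "i \<in> carrier (EG e)" "p' = p \<diamond> \<delta> (tail_elt e i)"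
proof -
  have e: "e' = e" using assms by (simp add: carc_def)
  interpret EG: group "EG e" using group_EG assms by blast
  have "inc (rev_arc e) \<one>\<^bsub>EG e\<^esub> = \<one>\<^bsub>VG (src e)\<^esub>"
    using hom_one[OF inc_rev_hom[OF assms(2)]] group_EG group_VG assms by simp
  then have "p' = p' \<diamond> \<delta> (vt (src e) (inc (rev_arc e) \<one>\<^bsub>EG e\<^esub>))"
    using assms by (simp add: vt_one)
  then have "p' \<in> snd (carc e' p')" unfolding carc_def e by auto
  then have "p' \<in> snd (carc e p)" using assms by simp
  then show thesis using that e by (auto simp: carc_def)
qed

lemma orb_vt:
  assumes "v \<in> V" "p \<in> carrier P" "c \<in> carrier (VG v)"
  shows "orb v (p \<diamond> \<delta> (vt v c)) = orb v p"
proof -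
  interpret VG: group "VG v" using group_VG assms by blast
  have "orb v (p \<diamond> \<delta> (vt v c)) = (\<lambda>d. p \<diamond> \<delta> (vt v d)) ` (\<lambda>d. c \<otimes>\<^bsub>VG v\<^esub> d) ` carrier (VG v)"
    using assms by (auto simp: orb_def image_image vt_mult P.m_assoc intro!: image_cong)
  also have "(\<lambda>d. c \<otimes>\<^bsub>VG v\<^esub> d) ` carrier (VG v) = carrier (VG v)"
    using VG.surj_const_mult[OF assms(3)] .
  finally show ?thesis by (simp add: orb_def)
qed

section \<open>Distance from the base vertex and the choice of parents\<close>

inductive reach :: "nat \<Rightarrow> 'v \<Rightarrow> 'p \<Rightarrow> bool" where
  base: "reach 0 x \<one>\<^bsub>P\<^esub>"
| vt: "reach k v p \<Longrightarrow> c \<in> carrier (VG v) \<Longrightarrow> reach k v (p \<diamond> \<delta> (vt v c))"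
| ed: "reach k (src e) p \<Longrightarrow> e \<in> E \<Longrightarrow> reach (Suc k) (tgt e) (p \<diamond> \<delta> (ed e))"

lemma reach_states: "reach k v p \<Longrightarrow> p \<in> states v"
  by (induction rule: reach.induct) (auto intro: states_one states_vt states_ed)

lemma reach_exists: "p \<in> states v \<Longrightarrow> \<exists>k. reach k v p"
proof -
  \<comment> \<open>The starting state is general because path induction removes letters at the
    front while \<open>reach\<close> adds them at the end.\<close>
  have *: "\<exists>k. reach k w (p \<diamond> \<delta> y)" if "y \<in> Paths u w" "\<exists>k. reach k u p" "p \<in> carrier P" for u w y p
    using that
  proof (induction arbitrary: p rule: path_induct)
    case one
    then show ?case by simp
  next
    case (vt v c y)
    then have "\<exists>k. reach k v (p \<diamond> \<delta> (vt v c))" using reach.vt by blast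
    with vt show ?case by (simp add: path_classes_closed flip: P.m_assoc)
  next
    case (ed e y)
    then have "\<exists>k. reach k (tgt e) (p \<diamond> \<delta> (ed e))" using reach.ed by blast
    with ed show ?case by (simp add: path_classes_closed flip: P.m_assoc)
  qed
  assume "p \<in> states v"
  then obtain y where y: "y \<in> Paths x v" "p = \<delta> y" by (auto simp: states_def)
  with *[OF y(1), of "\<one>\<^bsub>P\<^esub>"] show ?thesis using reach.base by (auto simp: path_classes_closed)
qed

lemma reach_vt_iff:
  assumes "v \<in> V" "p \<in> carrier P" "c \<in> carrier (VG v)"
  shows "reach k v (p \<diamond> \<delta> (vt v c)) \<longleftrightarrow> reach k v p"
proof
  interpret VG: group "VG v" using group_VG assms by blast
  assume "reach k v (p \<diamond> \<delta> (vt v c))"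
  then have "reach k v (p \<diamond> \<delta> (vt v c) \<diamond> \<delta> (vt v (inv\<^bsub>VG v\<^esub> c)))"
    using assms by (intro reach.vt[of k v "p \<diamond> \<delta> (vt v c)"]) auto
  also have "p \<diamond> \<delta> (vt v c) \<diamond> \<delta> (vt v (inv\<^bsub>VG v\<^esub> c)) = p"
    using assms by (simp add: vt_inv P.m_assoc)
  finally show "reach k v p" .
qed (use assms in \<open>auto intro: reach.vt\<close>)

text \<open>Consecutive vertex letters at the end merge into the single element \<open>c\<close>,
  which exposes the last arc of a path in the quotient graph.\<close>

lemma reach_inversion:
  assumes "reach k v p"
  shows "k = 0 \<and> v = x \<and> (\<exists>c\<in>carrier (VG x). p = \<delta> (vt x c)) \<or>
    (\<exists>k' e p'. \<exists>c\<in>carrier (VG v). k = Suc k' \<and> e \<in> E \<and> tgt e = v \<and> reach k' (src e) p' \<and>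
      p = p' \<diamond> \<delta> (ed e) \<diamond> \<delta> (vt v c))"
  using assms
proof (induction rule: reach.induct)
  case base
  interpret VG: group "VG x" using group_VG base_vertex by blast
  show ?case using base_vertex by (auto intro!: bexI[of _ "\<one>\<^bsub>VG x\<^esub>"] simp: vt_one)
next
  case (vt k v p c)
  have v: "v \<in> V" using reach_states[OF vt(1)] states_verts by blast
  interpret VG: group "VG v" using group_VG v by blast
  from vt(3) show ?case
  proof
    assume "k = 0 \<and> v = x \<and> (\<exists>c\<in>carrier (VG x). p = \<delta> (vt x c))"
    then obtain d where d: "k = 0" "v = x" "d \<in> carrier (VG v)" "p = \<delta> (vt v d)" by auto
    have "d \<otimes>\<^bsub>VG v\<^esub> c \<in> carrier (VG v)" using d(3) vt(2) by (rule VG.m_closed)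
    with d show ?thesis using vt(2) v
      by (intro disjI1) (auto intro!: bexI[of _ "d \<otimes>\<^bsub>VG v\<^esub> c"] simp: vt_mult)
  next
    assume "\<exists>k' e p'. \<exists>c\<in>carrier (VG v). k = Suc k' \<and> e \<in> E \<and> tgt e = v \<and> reach k' (src e) p' \<and>
      p = p' \<diamond> \<delta> (ed e) \<diamond> \<delta> (vt v c)"
    then obtain k' e p' d where *: "d \<in> carrier (VG v)" "k = Suc k'" "e \<in> E" "tgt e = v" "reach k' (src e) p'"
      "p = p' \<diamond> \<delta> (ed e) \<diamond> \<delta> (vt v d)" by blast
    have "p' \<in> carrier P" using * reach_states states_closed by blast
    then have "p \<diamond> \<delta> (vt v c) = p' \<diamond> \<delta> (ed e) \<diamond> \<delta> (vt v (d \<otimes>\<^bsub>VG v\<^esub> c))"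
      using * vt(2) v by (simp add: vt_mult P.m_assoc)
    moreover have "d \<otimes>\<^bsub>VG v\<^esub> c \<in> carrier (VG v)" using *(1) vt(2) by (rule VG.m_closed)
    ultimately show ?thesis using *(2-5)
      by (intro disjI2 exI[of _ k'] exI[of _ e] exI[of _ p'] bexI[of _ "d \<otimes>\<^bsub>VG v\<^esub> c"] conjI)
  qed
next
  case (ed k e p)
  interpret VG: group "VG (tgt e)" using group_VG ed by simp
  have "p \<in> carrier P" using ed reach_states states_closed by blast
  then have "p \<diamond> \<delta> (ed e) = p \<diamond> \<delta> (ed e) \<diamond> \<delta> (vt (tgt e) \<one>\<^bsub>VG (tgt e)\<^esub>)"
    using ed by (simp add: vt_one)
  then show ?case using ed(1,2)
    by (intro disjI2 exI[of _ k] exI[of _ e] exI[of _ p] bexI[of _ "\<one>\<^bsub>VG (tgt e)\<^esub>"] conjI)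
      (rule HOL.refl VG.one_closed | assumption)+
qed

text \<open>The distance from the base vertex in the quotient graph: \<open>reach\<close> counts
  arcs and passes over vertex letters for free, so the value is constant on
  \<open>orb v p\<close>.\<close>

definition level :: "'v \<Rightarrow> 'p \<Rightarrow> nat" where
  "level v p = (LEAST k. reach k v p)"

lemma reach_level: "p \<in> states v \<Longrightarrow> reach (level v p) v p"
  unfolding level_def by (rule LeastI_ex[OF reach_exists])

lemma level_le: "reach k v p \<Longrightarrow> level v p \<le> k"
  unfolding level_def by (rule Least_le)

lemma level_vt:
  "v \<in> V \<Longrightarrow> p \<in> carrier P \<Longrightarrow> c \<in> carrier (VG v) \<Longrightarrow> level v (p \<diamond> \<delta> (vt v c)) = level v p"
  by (simp add: level_def reach_vt_iff)

lemma level_0: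
  assumes "p \<in> states v" "level v p = 0"
  obtains c where "v = x" "c \<in> carrier (VG x)" "p = \<delta> (vt x c)"
  using reach_inversion[OF reach_level[OF assms(1)]] assms(2) that by auto

text \<open>The state \<open>p\<close> enters only through its orbit and its level, both of which
  are unchanged by the vertex group. All states of one orbit therefore receive the same parent, and
  the arcs chosen form a tree.\<close>

definition is_parent :: "'v \<Rightarrow> 'p \<Rightarrow> 'e \<times> 'p \<Rightarrow> bool" where
  "is_parent v p = (\<lambda>(e, p'). e \<in> E \<and> tgt e = v \<and> p' \<in> states (src e) \<and> p' \<diamond> \<delta> (ed e) \<in> orb v p \<and>
     Suc (level (src e) p') = level v p)"

definition parent :: "'v \<Rightarrow> 'p \<Rightarrow> 'e \<times> 'p" where
  "parent v p = (SOME a. is_parent v p a)"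

lemma parent_vt:
  "v \<in> V \<Longrightarrow> p \<in> carrier P \<Longrightarrow> c \<in> carrier (VG v) \<Longrightarrow> parent v (p \<diamond> \<delta> (vt v c)) = parent v p"
  by (simp add: parent_def is_parent_def level_vt orb_vt)

text \<open>The last arc of a shortest path works. Its source has level at most \<open>k\<close>,
  and it cannot be closer, since crossing the arc would then reach \<open>p\<close> in fewer steps
  than its level.\<close>

lemma is_parent_parent:
  assumes "p \<in> states v" "level v p \<noteq> 0"
  shows "is_parent v p (parent v p)"
proof -
  have v: "v \<in> V" "p \<in> carrier P" using assms states_closed states_verts by auto
  interpret VG: group "VG v" using group_VG v by blast
  obtain k e p' c where *: "c \<in> carrier (VG v)" "level v p = Suc k" "e \<in> E" "tgt e = v" "reach k (src e) p'"
      "p = p' \<diamond> \<delta> (ed e) \<diamond> \<delta> (vt v c)"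
    using reach_inversion[OF reach_level[OF assms(1)]] assms(2) by auto
  have p': "p' \<in> states (src e)" using *(5) by (rule reach_states)
  then have p'P: "p' \<in> carrier P" by (rule states_closed)
  have pp: "p' \<diamond> \<delta> (ed e) \<in> carrier P" using p'P * by simp
  have "level (src e) p' \<le> k" using * level_le by blast
  moreover have "level v p = level v (p' \<diamond> \<delta> (ed e))"
    using * level_vt[OF v(1) pp *(1)] by simp
  moreover have "level v (p' \<diamond> \<delta> (ed e)) \<le> Suc (level (src e) p')"
    using level_le[OF reach.ed[OF reach_level[OF p'] *(3)]] * by simp
  moreover have "p' \<diamond> \<delta> (ed e) = p' \<diamond> \<delta> (ed e) \<diamond> \<delta> (vt v \<one>\<^bsub>VG v\<^esub>)"
    using pp v by (simp add: vt_one)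
  then have "p' \<diamond> \<delta> (ed e) \<in> orb v (p' \<diamond> \<delta> (ed e))"
    unfolding orb_def using VG.one_closed by (rule image_eqI)
  then have "p' \<diamond> \<delta> (ed e) \<in> orb v p" using * orb_vt[OF v(1) pp *(1)] by simp
  ultimately have "is_parent v p (e, p')" using * p' by (simp add: is_parent_def)
  then show ?thesis unfolding parent_def by (rule someI)
qed

section \<open>The section along the spanning tree\<close>

definition vlift :: "'v \<Rightarrow> 'p \<Rightarrow> ('v, 'e, 'a) letter list set" where
  "vlift v q = (SOME y. \<exists>c\<in>carrier (VG v). y = vt v c \<and> \<delta> y = q)"

text \<open>The assumption \<open>\<delta>_inj\<close> determines the element \<open>vt v c\<close>
  of the path group from its image, though not necessarily \<open>c\<close> itself. This is why
  \<open>vlift\<close> chooses an element of the path group.\<close>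

lemma vlift_vt:
  assumes v: "v \<in> V" and c: "c \<in> carrier (VG v)"
  shows "vlift v (\<delta> (vt v c)) = vt v c"
proof -
  interpret VG: group "VG v" using group_VG v by blast
  let ?Q = "\<lambda>y. \<exists>d\<in>carrier (VG v). y = vt v d \<and> \<delta> y = \<delta> (vt v c)"
  have "?Q (vlift v (\<delta> (vt v c)))" unfolding vlift_def
    by (rule someI[of ?Q "vt v c"]) (use c in blast)
  then obtain d where d: "d \<in> carrier (VG v)" "vlift v (\<delta> (vt v c)) = vt v d" "\<delta> (vt v d) = \<delta> (vt v c)"
    by auto
  have "\<delta> (vt v (d \<otimes>\<^bsub>VG v\<^esub> inv\<^bsub>VG v\<^esub> c)) = \<one>\<^bsub>P\<^esub>" using v c d(1,3) by (simp add: vt_mult vt_inv)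
  then have "vt v (d \<otimes>\<^bsub>VG v\<^esub> inv\<^bsub>VG v\<^esub> c) = \<one>\<^bsub>F\<^esub>" using v c d(1) by (intro \<delta>_inj) auto
  then have "vt v d \<star> inv\<^bsub>F\<^esub> vt v c = \<one>\<^bsub>F\<^esub>" using v c d(1) by (simp add: vt_mult vt_inv)
  then have "vt v d \<star> inv\<^bsub>F\<^esub> vt v c \<star> vt v c = vt v c" using v c by simp
  then have "vt v d = vt v c" using v c d(1) by (simp add: F.m_assoc)
  with d show ?thesis by simp
qed

text \<open>The recursion follows the chain of parents back to the base vertex. Crossing the parent
  arc reaches only some state in the orbit of \<open>p\<close>; the last factor is the vertex
  element that corrects it to \<open>p\<close>.\<close>

primrec sect :: "nat \<Rightarrow> 'v \<Rightarrow> 'p \<Rightarrow> ('v, 'e, 'a) letter list set" where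
  "sect 0 v p = vlift v p"
| "sect (Suc k) v p = (let (e, p') = parent v p in
     sect k (src e) p' \<star> ed e \<star> vlift v (inv\<^bsub>P\<^esub> (p' \<diamond> \<delta> (ed e)) \<diamond> p))"

text \<open>A section of \<open>\<delta>\<close> over the states, equivariant under the vertex groups, along a spanning
  tree of the quotient of the Bass-Serre tree by the kernel of \<open>\<delta>\<close>.\<close>

definition \<sigma> :: "'v \<Rightarrow> 'p \<Rightarrow> ('v, 'e, 'a) letter list set" where
  "\<sigma> v p = sect (level v p) v p"

lemma \<sigma>_level_0:
  assumes "level x (\<delta> (vt x c)) = 0" "c \<in> carrier (VG x)"
  shows "\<sigma> x (\<delta> (vt x c)) = vt x c"
  using assms base_vertex by (simp add: \<sigma>_def vlift_vt)

lemma \<sigma>_step: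
  assumes p: "p \<in> states v" and l: "level v p \<noteq> 0" and par: "parent v p = (e, p')"
  obtains c where "c \<in> carrier (VG v)" "p = p' \<diamond> \<delta> (ed e) \<diamond> \<delta> (vt v c)"
    "\<sigma> v p = \<sigma> (src e) p' \<star> ed e \<star> vt v c"
    "e \<in> E" "tgt e = v" "p' \<in> states (src e)" "Suc (level (src e) p') = level v p"
proof -
  have v: "v \<in> V" "p \<in> carrier P" using p states_closed states_verts by auto
  interpret VG: group "VG v" using group_VG v by blast
  have ip: "e \<in> E" "tgt e = v" "p' \<in> states (src e)" "p' \<diamond> \<delta> (ed e) \<in> orb v p"
     "Suc (level (src e) p') = level v p"
    using is_parent_parent[OF p l] par by (simp_all add: is_parent_def)
  then obtain d where d: "d \<in> carrier (VG v)" "p' \<diamond> \<delta> (ed e) = p \<diamond> \<delta> (vt v d)"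
    by (auto simp: orb_def)
  have p': "p' \<in> carrier P" using ip states_closed by blast
  have pp: "p = p' \<diamond> \<delta> (ed e) \<diamond> \<delta> (vt v (inv\<^bsub>VG v\<^esub> d))"
    using d v by (simp add: vt_inv P.m_assoc)
  have "inv\<^bsub>P\<^esub> (p' \<diamond> \<delta> (ed e)) \<diamond> p = \<delta> (vt v (inv\<^bsub>VG v\<^esub> d))"
    using d v by (subst d(2)) (simp add: P.inv_mult_group P.m_assoc vt_inv)
  then have "vlift v (inv\<^bsub>P\<^esub> (p' \<diamond> \<delta> (ed e)) \<diamond> p) = vt v (inv\<^bsub>VG v\<^esub> d)"
    using vlift_vt v d by simp
  then have "\<sigma> v p = \<sigma> (src e) p' \<star> ed e \<star> vt v (inv\<^bsub>VG v\<^esub> d)"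
    unfolding \<sigma>_def using ip(5) par by (cases "level v p") auto
  then show thesis using that[OF VG.inv_closed[OF d(1)] pp] ip by blast
qed

lemma \<sigma>_props:
  "p \<in> states v \<Longrightarrow> \<sigma> v p \<in> Paths x v \<and> \<delta> (\<sigma> v p) = p"
proof (induction "level v p" arbitrary: v p)
  case 0
  then obtain c where c: "v = x" "c \<in> carrier (VG x)" "p = \<delta> (vt x c)" using level_0 by metis
  with 0 \<sigma>_level_0 base_vertex show ?case by auto
next
  case (Suc k)
  then obtain e p' where par: "parent v p = (e, p')" by fastforce
  have "level v p \<noteq> 0" using Suc by simp
  from \<sigma>_step[OF Suc(3) this par] obtain c where c: "c \<in> carrier (VG v)"
    "p = p' \<diamond> \<delta> (ed e) \<diamond> \<delta> (vt v c)"
    "\<sigma> v p = \<sigma> (src e) p' \<star> ed e \<star> vt v c"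
    "e \<in> E" "tgt e = v" "p' \<in> states (src e)" "Suc (level (src e) p') = level v p" .
  have v: "v \<in> V" using Suc states_verts by blast
  have IH: "\<sigma> (src e) p' \<in> Paths x (src e)" "\<delta> (\<sigma> (src e) p') = p'"
    using Suc.hyps(1)[of "src e" p'] Suc.hyps(2) c by auto
  have "\<sigma> (src e) p' \<star> ed e \<star> vt v c \<in> Paths x v"
    using c v by (intro path_mult[OF path_mult[OF IH(1) path_ed]]) auto
  moreover have "\<delta> (\<sigma> (src e) p' \<star> ed e \<star> vt v c) = p"
    using path_classes_closed[OF IH(1)] IH(2) v c(1,4) by (subst c(2)) simp
  ultimately show ?case using c(3) by simp
qed

lemma \<sigma>_path: "p \<in> states v \<Longrightarrow> \<sigma> v p \<in> Paths x v"
  and \<delta>_\<sigma>: "p \<in> states v \<Longrightarrow> \<delta> (\<sigma> v p) = p"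
  and \<sigma>_closed: "p \<in> states v \<Longrightarrow> \<sigma> v p \<in> carrier F"
  using \<sigma>_props path_classes_closed by blast+

text \<open>Both states have the same parent, so the two recursive values differ at most in the
  final vertex factor. The images of these factors under \<open>\<delta>\<close> are forced by the
  states, and \<open>vlift_vt\<close> lifts the resulting equality to the path group.\<close>

lemma \<sigma>_vt:
  assumes p: "p \<in> states v" and c: "c \<in> carrier (VG v)"
  shows "\<sigma> v (p \<diamond> \<delta> (vt v c)) = \<sigma> v p \<star> vt v c"
proof -
  have v: "v \<in> V" "p \<in> carrier P" using p states_closed states_verts by auto
  have pc: "p \<diamond> \<delta> (vt v c) \<in> states v" using states_vt p c by blast
  interpret VG: group "VG v" using group_VG v by blast
  show ?thesis
  proof (cases "level v p = 0")
    case True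
    then obtain d where d: "v = x" "d \<in> carrier (VG x)" "p = \<delta> (vt x d)" using p level_0 by metis
    have dc: "d \<otimes>\<^bsub>VG v\<^esub> c \<in> carrier (VG v)" using d(1,2) c by (intro VG.m_closed) auto
    have m: "p \<diamond> \<delta> (vt v c) = \<delta> (vt v (d \<otimes>\<^bsub>VG v\<^esub> c))" using d c v by (simp add: vt_mult)
    have "level v (p \<diamond> \<delta> (vt v c)) = 0" using True level_vt v c by simp
    then have "\<sigma> v (p \<diamond> \<delta> (vt v c)) = vt v (d \<otimes>\<^bsub>VG v\<^esub> c)"
      unfolding m using \<sigma>_level_0[of "d \<otimes>\<^bsub>VG v\<^esub> c"] dc d(1) by simp
    moreover have "\<sigma> v p = vt v d" using True \<sigma>_level_0[of d] d by simp
    ultimately show ?thesis using d(1,2) c v by (simp add: vt_mult)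
  next
    case False
    obtain e p' where par: "parent v p = (e, p')" by fastforce
    have F2: "level v (p \<diamond> \<delta> (vt v c)) \<noteq> 0" using False level_vt v c by simp
    have par2: "parent v (p \<diamond> \<delta> (vt v c)) = (e, p')" using par parent_vt v c by simp
    from \<sigma>_step[OF p False par] obtain d where d: "d \<in> carrier (VG v)"
      "p = p' \<diamond> \<delta> (ed e) \<diamond> \<delta> (vt v d)"
      "\<sigma> v p = \<sigma> (src e) p' \<star> ed e \<star> vt v d"
      "e \<in> E" "tgt e = v" "p' \<in> states (src e)" .
    from \<sigma>_step[OF pc F2 par2] obtain d' where d': "d' \<in> carrier (VG v)"
      "p \<diamond> \<delta> (vt v c) = p' \<diamond> \<delta> (ed e) \<diamond> \<delta> (vt v d')"
      "\<sigma> v (p \<diamond> \<delta> (vt v c)) = \<sigma> (src e) p' \<star> ed e \<star> vt v d'" .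
    have p': "p' \<in> carrier P" using d states_closed by blast
    have "p' \<diamond> \<delta> (ed e) \<diamond> \<delta> (vt v d') = p' \<diamond> \<delta> (ed e) \<diamond> \<delta> (vt v (d \<otimes>\<^bsub>VG v\<^esub> c))"
      using d' d(1,4,5) c v p' by (simp add: d(2) vt_mult P.m_assoc)
    then have "\<delta> (vt v d') = \<delta> (vt v (d \<otimes>\<^bsub>VG v\<^esub> c))"
      using d(1,4,5) d'(1) c v p' by simp
    then have "vlift v (\<delta> (vt v d')) = vlift v (\<delta> (vt v (d \<otimes>\<^bsub>VG v\<^esub> c)))" by (rule arg_cong)
    then have "vt v d' = vt v (d \<otimes>\<^bsub>VG v\<^esub> c)"
      by (simp only: vlift_vt[OF v(1) d'(1)] vlift_vt[OF v(1) VG.m_closed[OF d(1) c]])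
    then show ?thesis using d(1,3,4,5) d'(3) c v \<sigma>_closed[OF d(6)] by (simp add: vt_mult F.m_assoc)
  qed
qed

lemma \<sigma>_one: "\<sigma> x \<one>\<^bsub>P\<^esub> = \<one>\<^bsub>F\<^esub>"
proof -
  interpret VG: group "VG x" using group_VG base_vertex by blast
  have "level x \<one>\<^bsub>P\<^esub> = 0" using level_le[OF reach.base] by simp
  moreover have "\<delta> (vt x \<one>\<^bsub>VG x\<^esub>) = \<one>\<^bsub>P\<^esub>" using base_vertex by (simp add: vt_one)
  ultimately show ?thesis using \<sigma>_level_0[of "\<one>\<^bsub>VG x\<^esub>"] base_vertex by (simp add: vt_one)
qed

section \<open>Loops through the arcs and the free generators\<close>

definition tree :: "('e \<times> 'p set) set" where
  "tree = {carc e p' | e p' v p. p \<in> states v \<and> level v p \<noteq> 0 \<and> parent v p = (e, p')}"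

text \<open>The Schreier generators of the kernel for the section \<open>\<sigma>\<close>: go to
  \<open>p\<close> along the tree, cross the arc, and return along the tree.\<close>

definition \<kappa> :: "'e \<Rightarrow> 'p \<Rightarrow> ('v, 'e, 'a) letter list set" where
  "\<kappa> e p = \<sigma> (src e) p \<star> ed e \<star> inv\<^bsub>F\<^esub> \<sigma> (tgt e) (p \<diamond> \<delta> (ed e))"

definition K :: "('v, 'e, 'a) letter list set set" where
  "K = {y \<in> Paths x x. \<delta> y = \<one>\<^bsub>P\<^esub>}"

lemma subgroup_K: "subgroup K F"
proof (rule F.subgroupI)
  show "K \<noteq> {}" using path_one[OF base_vertex] by (auto simp: K_def intro!: exI[of _ "\<one>\<^bsub>F\<^esub>"])
qed (auto simp: K_def path_inv path_mult path_classes_closed)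

lemma \<kappa>_in_K: 
  assumes "e \<in> E" "p \<in> states (src e)" shows "\<kappa> e p \<in> K"
proof -
  have q: "p \<diamond> \<delta> (ed e) \<in> states (tgt e)" using assms states_ed by blast
  have "\<kappa> e p \<in> Paths x x" unfolding \<kappa>_def
    using assms q by (intro path_mult[OF path_mult[OF \<sigma>_path path_ed] path_inv[OF \<sigma>_path]])
  moreover have "\<delta> (\<kappa> e p) = \<one>\<^bsub>P\<^esub>"
    using assms q states_closed[OF assms(2)] by (simp add: \<kappa>_def \<sigma>_closed \<delta>_\<sigma>)
  ultimately show ?thesis by (simp add: K_def)
qed

text \<open>Changing the state by an edge element multiplies both sections by the images of that
  element at the two ends; the edge relation moves one image across the arc, where it cancels the
  other.\<close>

lemma \<kappa>_arc:
  assumes e: "e \<in> E" and p: "p \<in> states (src e)" and p': "p' \<in> states (src e)" and eq: "carc e p = carc e p'"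
  shows "\<kappa> e p = \<kappa> e p'"
proof -
  have cl: "p \<in> carrier P" "p' \<in> carrier P" using p p' states_closed by auto
  obtain i where i: "i \<in> carrier (EG e)" "p' = p \<diamond> \<delta> (tail_elt e i)"
    using carc_eqD[OF eq e cl(2)] by metis
  note ic = inc_closed[OF e i(1)] inc_rev_closed[OF e i(1)]
  have q: "p \<diamond> \<delta> (ed e) \<in> states (tgt e)" using states_ed p e by blast
  have "\<delta> (tail_elt e i) \<diamond> \<delta> (ed e) = \<delta> (ed e) \<diamond> \<delta> (head_elt e i)"
    using ed_vt[OF e i(1)] ic e by (simp flip: \<delta>.hom_mult)
  then have "p' \<diamond> \<delta> (ed e) = p \<diamond> \<delta> (ed e) \<diamond> \<delta> (head_elt e i)"
    using i(2) cl ic e by (simp add: P.m_assoc)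
  then have s2: "\<sigma> (tgt e) (p' \<diamond> \<delta> (ed e)) = \<sigma> (tgt e) (p \<diamond> \<delta> (ed e)) \<star> head_elt e i"
    using \<sigma>_vt[OF q ic(1)] by simp
  have s1: "\<sigma> (src e) p' = \<sigma> (src e) p \<star> tail_elt e i"
    using \<sigma>_vt[OF p ic(2)] i(2) by simp
  let ?w = "head_elt e i" and ?s = "\<sigma> (tgt e) (p \<diamond> \<delta> (ed e))"
  have cs: "?w \<in> carrier F" "?s \<in> carrier F" "\<sigma> (src e) p \<in> carrier F" using ic e q p \<sigma>_closed
    by auto
  have "\<kappa> e p' = \<sigma> (src e) p \<star> (tail_elt e i \<star> ed e) \<star> inv\<^bsub>F\<^esub> (?s \<star> ?w)"
    using cs ic e by (simp add: \<kappa>_def s1 s2 F.m_assoc)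
  also have "\<dots> = \<sigma> (src e) p \<star> (ed e \<star> ?w) \<star> (inv\<^bsub>F\<^esub> ?w \<star> inv\<^bsub>F\<^esub> ?s)"
    using cs ed_vt[OF e i(1)] by (simp add: F.inv_mult_group)
  also have "\<dots> = \<sigma> (src e) p \<star> ed e \<star> (?w \<star> (inv\<^bsub>F\<^esub> ?w \<star> inv\<^bsub>F\<^esub> ?s))"
    using cs e by (simp add: F.m_assoc)
  also have "?w \<star> (inv\<^bsub>F\<^esub> ?w \<star> inv\<^bsub>F\<^esub> ?s) = inv\<^bsub>F\<^esub> ?s"
    using cs by (simp flip: F.m_assoc)
  finally show ?thesis by (simp add: \<kappa>_def)
qed

lemma \<kappa>_rev:
  assumes "e \<in> E" "p \<in> states (src e)"
  shows "\<kappa> (rev_arc e) (p \<diamond> \<delta> (ed e)) = inv\<^bsub>F\<^esub> \<kappa> e p"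
proof -
  have q: "p \<diamond> \<delta> (ed e) \<in> states (tgt e)" using assms states_ed by blast
  have "p \<diamond> \<delta> (ed e) \<diamond> \<delta> (ed (rev_arc e)) = p"
    using assms states_closed by (simp add: ed_rev P.m_assoc)
  then show ?thesis using assms \<sigma>_closed[OF q] \<sigma>_closed[OF assms(2)]
    by (simp add: \<kappa>_def F.inv_mult_group ed_rev F.m_assoc)
qed

text \<open>Along a parent arc the section at the target is the section at the source followed by
  the arc, up to a vertex element. Equivariance of \<open>\<sigma>\<close> removes that element, and
  the loop retraces itself.\<close>

lemma \<kappa>_tree:
  assumes e: "e \<in> E" and p: "p \<in> states (src e)" and t: "carc e p \<in> tree"
  shows "\<kappa> e p = \<one>\<^bsub>F\<^esub>"
proof -
  obtain e' p' v q where *: "carc e p = carc e' p'" "q \<in> states v" "level v q \<noteq> 0" "parent v q = (e', p')"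
    using t by (auto simp: tree_def)
  have e': "e' = e" using * by (simp add: carc_def)
  from \<sigma>_step[OF *(2-4)] obtain c where c: "c \<in> carrier (VG v)"
    "q = p' \<diamond> \<delta> (ed e) \<diamond> \<delta> (vt v c)"
    "\<sigma> v q = \<sigma> (src e) p' \<star> ed e \<star> vt v c"
    "tgt e = v" "p' \<in> states (src e)" using e' by auto
  have q': "p' \<diamond> \<delta> (ed e) \<in> states v" using states_ed[OF c(5) e] c(4) by simp
  have v: "v \<in> V" using q' states_verts by blast
  have "\<sigma> v (p' \<diamond> \<delta> (ed e)) \<star> vt v c = \<sigma> (src e) p' \<star> ed e \<star> vt v c"
    using \<sigma>_vt[OF q' c(1)] c by simp
  then have "\<sigma> v (p' \<diamond> \<delta> (ed e)) = \<sigma> (src e) p' \<star> ed e"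
    using \<sigma>_closed[OF q'] \<sigma>_closed[OF c(5)] e v c(1) by simp
  then have "\<kappa> e p' = \<one>\<^bsub>F\<^esub>" using c(4,5) e by (simp add: \<kappa>_def \<sigma>_closed)
  then show ?thesis using \<kappa>_arc[OF e p c(5)] * e' by simp
qed


text \<open>The choice is made from the unordered pair \<open>{e, rev_arc e}\<close>, so both arcs
  of the pair see the same choice and exactly one of them is selected.\<close>

definition orientation :: "'e set" where
  "orientation = {e \<in> E. e = (SOME a. a \<in> {e, rev_arc e})}"

lemma orientation_iff:
  assumes "e \<in> E" shows "rev_arc e \<in> orientation \<longleftrightarrow> e \<notin> orientation"
proof -
  define s where "s = (SOME a. a \<in> {e, rev_arc e})"
  have "{rev_arc e, rev_arc (rev_arc e)} = {e, rev_arc e}" by auto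
  then have "rev_arc e \<in> orientation \<longleftrightarrow> rev_arc e = s" "e \<in> orientation \<longleftrightarrow> e = s"
    using assms unfolding orientation_def s_def
      by (simp_all only: mem_Collect_eq arev_in_arcs simp_thms)
  moreover have "s \<in> {e, rev_arc e}" unfolding s_def by (rule someI[of _ e]) simp
  ultimately show ?thesis using arev_neq[OF assms] by auto
qed

text \<open>One direction of each geometric arc outside the spanning tree. The set
  \<open>tree\<close> holds only arcs pointing away from the base vertex, so both directions have to
  be excluded. An orientation of the underlying graph suffices, because \<open>crev\<close> covers
  the reversal of arcs there.\<close>

definition gens :: "('e \<times> 'p set) set" where
  "gens = {carc e p | e p. e \<in> orientation \<and> p \<in> states (src e) \<and> carc e p \<notin> tree \<and> crev (carc e p) \<notin> tree}"

lemma gens_antisym: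
  assumes "e \<in> E" "p \<in> carrier P" "carc e p \<in> gens"
  shows "crev (carc e p) \<notin> gens"
proof
  assume "crev (carc e p) \<in> gens"
  then have "rev_arc e \<in> orientation" by (auto simp: gens_def carc_def crev_def)
  moreover have "e \<in> orientation" using assms by (auto simp: gens_def carc_def)
  ultimately show False using orientation_iff assms by blast
qed

text \<open>The homomorphism \<open>\<theta>\<close> sends a generator to the loop \<open>\<kappa>\<close> through its arc, and \<open>\<Psi>\<close> lists the arcs
  outside the tree that a path crosses. The identity \<open>\<theta> (\<Psi> y p) = \<sigma> u p \<otimes> y \<otimes> inv (\<sigma> w (p \<otimes> \<delta> y))\<close> shows that
  they are inverse to each other on the kernel.\<close>

lemma kernel_free:
  assumes fin: "finite {carc e p | e p. e \<in> E \<and> p \<in> states (src e)}"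
  shows "\<exists>r \<theta>. \<theta> \<in> iso (free_group r) (F\<lparr>carrier := K\<rparr>)"
proof -
  have "gens \<subseteq> {carc e p | e p. e \<in> E \<and> p \<in> states (src e)}"
    by (auto simp: gens_def orientation_def)
  then have "finite gens" using fin finite_subset by blast
  then obtain num where "bij_betw num gens {0..<card gens}" using ex_bij_betw_finite_nat by blast
  then obtain r where num: "bij_betw num gens {..<r}" using atLeast0LessThan by metis
  then have num_less: "num a < r" if "a \<in> gens" for a using that by (auto dest: bij_betwE)
  interpret Q: group "free_group r" by (rule group_free_group)
  interpret K: group "F\<lparr>carrier := K\<rparr>" using F.subgroup_imp_group[OF subgroup_K] .
  \<comment> \<open>The label of an arc: a generator, the inverse of one if the reversed arc is in
    \<open>gens\<close>, and trivial otherwise. It depends only on \<open>carc e p\<close>, and by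
    \<open>gens_antisym\<close> the first two cases never overlap.\<close>
  define gen where "gen e p = (if carc e p \<in> gens then free_gen r (num (carc e p), True)
    else if crev (carc e p) \<in> gens then free_gen r (num (crev (carc e p)), False) else \<one>\<^bsub>free_group r\<^esub>)" for e p
  have gen_closed: "gen e p \<in> carrier (free_group r)" for e p
    by (simp add: gen_def num_less)
  have gen_rev: "gen (rev_arc e) (p \<diamond> \<delta> (ed e)) = inv\<^bsub>free_group r\<^esub> gen e p"
    if "e \<in> E" "p \<in> carrier P" for e p
    using gens_antisym[OF that]
      by (simp add: gen_def carc_rev_eq crev_crev that num_less free_gen_inv)
  have gen_vt: "gen e (p \<diamond> \<delta> (tail_elt e i)) = gen e p"
    if "e \<in> E" "p \<in> carrier P" "i \<in> carrier (EG e)" for e p i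
    using that by (simp add: gen_def carc_vt)
  have gen_tree: "gen e p = \<one>\<^bsub>free_group r\<^esub>" if "e \<in> E" "p \<in> carrier P" "carc e p \<in> tree" for e p
  proof -
    have "carc e p \<notin> gens" using that by (auto simp: gens_def)
    moreover have "crev (carc e p) \<notin> gens"
      using that crev_crev[OF that(1,2)] by (auto simp: gens_def)
    ultimately show ?thesis by (simp add: gen_def)
  qed

  let ?d = "\<lambda>s. \<delta> (word_class \<G> [s])"
  let ?f = "\<lambda>s p. case s of Vtx v c \<Rightarrow> \<one>\<^bsub>free_group r\<^esub> | Edg e \<Rightarrow> gen e p"
  have d: "?d \<in> letters \<G> \<rightarrow> carrier P" by auto
  have f: "?f s p \<in> carrier (free_group r)" for s p by (cases s) (simp_all add: gen_closed)
  \<comment> \<open>The state reached by a word is its image under \<open>\<delta>\<close>;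
    relations therefore lead to equal states because \<open>\<delta>\<close> is defined on
    classes.\<close>
  have wp: "word_prod P ?d w = \<delta> (word_class \<G> w)" if "w \<in> lists (letters \<G>)" for w
    using that
  proof (induction w)
    case (Cons s w)
    then show ?case using word_class_append[of "[s]" w] by simp
  qed (simp add: word_class_Nil)
  have R: "word_prod P ?d l = word_prod P ?d r"
    if "(l, r) \<in> relations \<G>" "l \<in> lists (letters \<G>)" "r \<in> lists (letters \<G>)" for l r
    using word_class_relation[OF that] by (simp add: wp that)
  \<comment> \<open>Only relations with arcs matter. In the edge relation the arc is crossed back
    from a state changed by an edge element; this does not alter the arc of the quotient, so the two
    labels still cancel.\<close>
  have Rf: "cocycle P (free_group r) ?d ?f l p = cocycle P (free_group r) ?d ?f k p"
    if lk: "(l, k) \<in> relations \<G>" and p: "p \<in> carrier P" for l k p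
    using lk
  proof (cases rule: relations_cases)
    case (3 e)
    then show ?thesis using p gen_rev by (simp add: gen_closed flip: ed_def)
  next
    case (4 e i)
    have ic: "inc e i \<in> carrier (VG (tgt e))" "inc (rev_arc e) i \<in> carrier (VG (src e))"
      using 4 inc_closed inc_rev_closed by auto
    have "\<delta> (tail_elt e i) \<diamond> \<delta> (ed e) = \<delta> (ed e) \<diamond> \<delta> (head_elt e i)"
      using ed_vt[OF 4(1,2)] ic 4 by (simp flip: \<delta>.hom_mult)
    then have "p \<diamond> \<delta> (ed e) \<diamond> \<delta> (head_elt e i) =
        p \<diamond> \<delta> (tail_elt e i) \<diamond> \<delta> (ed e)"
      using p ic 4 by (simp add: P.m_assoc)
    then have "gen (rev_arc e) (p \<diamond> \<delta> (ed e) \<diamond> \<delta> (head_elt e i)) = inv\<^bsub>free_group r\<^esub> gen e p"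
      using gen_rev[OF 4(1), of "p \<diamond> \<delta> (tail_elt e i)"] gen_vt[OF 4(1) p 4(2)] p ic 4
      by simp
    then show ?thesis using 4(3,4) by (simp add: gen_closed flip: ed_def vt_def)
  qed simp_all
  obtain \<Psi> where \<Psi>_word: "\<And>w p. w \<in> lists (letters \<G>) \<Longrightarrow> p \<in> carrier P \<Longrightarrow>
      \<Psi> (cls (letters \<G>) (relations \<G>) w) p = cocycle P (free_group r) ?d ?f w p"
    using presented_cocycle_exists[OF P.monoid_axioms d Q.monoid_axioms f R Rf] by blast
  have \<Psi>_mult: "\<Psi> (y \<star> z) p = \<Psi> y p \<otimes>\<^bsub>free_group r\<^esub> \<Psi> z (p \<diamond> \<delta> y)"
    and \<Psi>_closed: "\<Psi> y p \<in> carrier (free_group r)"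
    if yz: "y \<in> carrier F" "z \<in> carrier F" and p: "p \<in> carrier P" for y z p
  proof -
    obtain u w where uw: "y = word_class \<G> u" "z = word_class \<G> w" "u \<in> lists (letters \<G>)" "w \<in> lists (letters \<G>)"
      using yz by (auto simp: path_group_def carrier_presented word_class_eq_cls)
    have "u @ w \<in> lists (letters \<G>)" using uw by simp
    from \<Psi>_word[OF this p] have "\<Psi> (word_class \<G> (u @ w)) p = cocycle P (free_group r) ?d ?f (u @ w) p"
      by (simp only: word_class_eq_cls)
    also have "\<dots> = cocycle P (free_group r) ?d ?f u p \<otimes>\<^bsub>free_group r\<^esub> cocycle P (free_group r) ?d ?f w (p \<diamond> \<delta> y)"
      using cocycle_append[OF P.monoid_axioms d Q.monoid_axioms f uw(3,4) p] uw wp by simp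
    also have "\<dots> = \<Psi> y p \<otimes>\<^bsub>free_group r\<^esub> \<Psi> z (p \<diamond> \<delta> y)"
      using uw yz p by (simp add: word_class_eq_cls \<Psi>_word)
    finally show "\<Psi> (y \<star> z) p = \<Psi> y p \<otimes>\<^bsub>free_group r\<^esub> \<Psi> z (p \<diamond> \<delta> y)" using uw
      by (simp add: word_class_append)
    show "\<Psi> y p \<in> carrier (free_group r)"
      using cocycle_closed[OF P.monoid_axioms d Q.monoid_axioms f uw(3) p] uw p
      by (simp add: word_class_eq_cls \<Psi>_word)
  qed
  have \<Psi>_one: "\<Psi> \<one>\<^bsub>F\<^esub> p = \<one>\<^bsub>free_group r\<^esub>" if "p \<in> carrier P" for p
    using \<Psi>_word[of "[]" p] that by (simp add: word_class_eq_cls flip: word_class_Nil)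
  have \<Psi>_vt: "\<Psi> (vt v c) p = \<one>\<^bsub>free_group r\<^esub>"
    if "v \<in> V" "c \<in> carrier (VG v)" "p \<in> carrier P" for v c p
    using \<Psi>_word[of "[Vtx v c]" p] that by (simp add: word_class_eq_cls vt_def)
  have \<Psi>_ed: "\<Psi> (ed e) p = gen e p" if "e \<in> E" "p \<in> carrier P" for e p
    using \<Psi>_word[of "[Edg e]" p] that by (simp add: word_class_eq_cls ed_def gen_closed)
  \<comment> \<open>The section runs through parent arcs only, and these have trivial
    labels.\<close>
  have \<Psi>_\<sigma>: "p \<in> states v \<Longrightarrow> \<Psi> (\<sigma> v p) \<one>\<^bsub>P\<^esub> = \<one>\<^bsub>free_group r\<^esub>" for v p
  proof (induction "level v p" arbitrary: v p)
    case 0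
    then obtain c where c: "v = x" "c \<in> carrier (VG x)" "p = \<delta> (vt x c)" using level_0 by metis
    with 0 \<sigma>_level_0 base_vertex \<Psi>_vt show ?case by simp
  next
    case (Suc k)
    then obtain e p' where par: "parent v p = (e, p')" by fastforce
    have l: "level v p \<noteq> 0" using Suc by simp
    from \<sigma>_step[OF Suc(3) this par] obtain c where c: "c \<in> carrier (VG v)"
      "p = p' \<diamond> \<delta> (ed e) \<diamond> \<delta> (vt v c)"
      "\<sigma> v p = \<sigma> (src e) p' \<star> ed e \<star> vt v c"
      "e \<in> E" "tgt e = v" "p' \<in> states (src e)" "Suc (level (src e) p') = level v p" .
    have v: "v \<in> V" using Suc states_verts by blast
    have IH: "\<Psi> (\<sigma> (src e) p') \<one>\<^bsub>P\<^esub> = \<one>\<^bsub>free_group r\<^esub>"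
      using Suc.hyps(1)[of "src e" p'] Suc.hyps(2) c by auto
    have p': "p' \<in> carrier P" using c states_closed by blast
    have "carc e p' \<in> tree" using Suc(3) l par unfolding tree_def by blast
    then have "gen e p' = \<one>\<^bsub>free_group r\<^esub>" using gen_tree c p' by blast
    then show ?case
      using c(1,4,5) v p' IH \<sigma>_closed[OF c(6)] \<delta>_\<sigma>[OF c(6)]
      by (subst c(3)) (simp add: \<Psi>_mult \<Psi>_vt \<Psi>_ed)
  qed

  have "\<exists>e p. e \<in> E \<and> p \<in> states (src e) \<and> carc e p \<in> gens \<and> num (carc e p) = i" if "i < r" for i
  proof -
    have "i \<in> num ` gens" using num that by (simp add: bij_betw_imp_surj_on)
    then obtain a where a: "a \<in> gens" "num a = i" by blast
    then obtain e p where "a = carc e p" "e \<in> orientation" "p \<in> states (src e)" unfolding gens_def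
      by blast
    with a show ?thesis by (intro exI[of _ e] exI[of _ p]) (simp add: orientation_def)
  qed
  then obtain ge gp where g: "ge i \<in> E" "gp i \<in> states (src (ge i))" "carc (ge i) (gp i) \<in> gens"
    "num (carc (ge i) (gp i)) = i" if "i < r" for i by metis
  obtain \<theta> where \<theta>: "\<theta> \<in> hom (free_group r) (F\<lparr>carrier := K\<rparr>)"
    and \<theta>_gen: "\<And>i. i < r \<Longrightarrow> \<theta> (free_gen r (i, True)) = \<kappa> (ge i) (gp i)"
    using free_group_hom_exists[OF K.is_group, of r "\<lambda>i. \<kappa> (ge i) (gp i)"] g \<kappa>_in_K by auto
  have \<theta>': "\<theta> \<in> hom (free_group r) F"
    using \<theta> subgroup.subset[OF subgroup_K] by (auto simp: hom_def Pi_def)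
  interpret \<theta>: group_hom "free_group r" F \<theta>
    using \<theta>' by (simp add: group_hom_def group_hom_axioms_def Q.is_group F.is_group)
  have \<theta>_K: "\<theta> z \<in> K" if "z \<in> carrier (free_group r)" for z
    using \<theta> that by (auto simp: hom_def)
  have gen_g: "gen (ge i) (gp i) = free_gen r (i, True)" if "i < r" for i
    using g[OF that] by (simp add: gen_def)
  have \<theta>_gens: "\<theta> (free_gen r (num (carc e p), True)) = \<kappa> e p"
    if e: "e \<in> E" and p: "p \<in> states (src e)" and a: "carc e p \<in> gens" for e p
  proof -
    define i where "i = num (carc e p)"
    have i: "i < r" using num_less a i_def by simp
    have "carc (ge i) (gp i) = carc e p"
      using g[OF i] a num unfolding i_def by (auto simp: bij_betw_def inj_on_def)
    moreover from this have "ge i = e" by (simp add: carc_def)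
    ultimately have "\<kappa> (ge i) (gp i) = \<kappa> e p" using \<kappa>_arc[OF e, of "gp i" p] g(2)[OF i] p by simp
    then show ?thesis using \<theta>_gen[OF i] by (simp add: i_def)
  qed
  have \<theta>_gen_\<kappa>: "\<theta> (gen e p) = \<kappa> e p" if e: "e \<in> E" and p: "p \<in> states (src e)" for e p
  proof -
    have pc: "p \<in> carrier P" using p states_closed by blast
    have q: "p \<diamond> \<delta> (ed e) \<in> states (src (rev_arc e))" using states_ed[OF p e] e by simp
    have kc: "\<kappa> e p \<in> carrier F" using \<kappa>_in_K[OF e p] subgroup.subset[OF subgroup_K] by auto
    have rev: "carc (rev_arc e) (p \<diamond> \<delta> (ed e)) = crev (carc e p)" using carc_rev_eq e pc by blast
    consider "carc e p \<in> gens" | "carc e p \<notin> gens" "crev (carc e p) \<in> gens"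
      | "carc e p \<notin> gens" "crev (carc e p) \<notin> gens" by blast
    then show ?thesis
    proof cases
      case 1
      then show ?thesis using \<theta>_gens e p by (simp add: gen_def)
    next
      case 2
      have "\<theta> (free_gen r (num (crev (carc e p)), True)) = inv\<^bsub>F\<^esub> \<kappa> e p"
        using \<theta>_gens[of "rev_arc e" "p \<diamond> \<delta> (ed e)"] e q rev 2 \<kappa>_rev[OF e p] by simp
      then have "\<theta> (inv\<^bsub>free_group r\<^esub> free_gen r (num (crev (carc e p)), True)) = \<kappa> e p"
        using num_less 2 kc by simp
      then show ?thesis using 2 num_less by (simp add: gen_def free_gen_inv)
    next
      case 3
      \<comment> \<open>One of the two directions lies over \<open>orientation\<close>; if neither
        direction were in the tree, that one would belong to \<open>gens\<close>.\<close>
      have "carc e p \<in> tree \<or> crev (carc e p) \<in> tree"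
      proof (rule ccontr)
        assume nt: "\<not> (carc e p \<in> tree \<or> crev (carc e p) \<in> tree)"
        show False
        proof (cases "e \<in> orientation")
          case True
          then show False using nt 3 p unfolding gens_def by blast
        next
          case False
          then have "rev_arc e \<in> orientation" using orientation_iff e by blast
          moreover have "crev (carc (rev_arc e) (p \<diamond> \<delta> (ed e))) = carc e p"
            using rev crev_crev e pc by simp
          ultimately have "carc (rev_arc e) (p \<diamond> \<delta> (ed e)) \<in> gens"
            using nt q unfolding gens_def rev[symmetric]
            by (intro CollectI exI[of _ "rev_arc e"] exI[of _ "p \<diamond> \<delta> (ed e)"] conjI) auto
          then show False using 3 rev by simp
        qed
      qed
      then have "\<kappa> e p = \<one>\<^bsub>F\<^esub>"
      proof
        assume "crev (carc e p) \<in> tree"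
        then have "\<kappa> (rev_arc e) (p \<diamond> \<delta> (ed e)) = \<one>\<^bsub>F\<^esub>" using \<kappa>_tree[of "rev_arc e"] e q rev by simp
        then show ?thesis using \<kappa>_rev[OF e p] kc by (metis F.inv_inv F.inv_one)
      qed (use \<kappa>_tree e p in blast)
      with 3 show ?thesis by (simp add: gen_def)
    qed
  qed
  have \<theta>_\<Psi>: "p \<in> states u \<Longrightarrow> \<theta> (\<Psi> y p) = \<sigma> u p \<star> y \<star> inv\<^bsub>F\<^esub> \<sigma> w (p \<diamond> \<delta> y)"
    if "y \<in> Paths u w" for y u w p
    using that
  proof (induction arbitrary: p rule: path_induct)
    case one
    then have "p \<in> carrier P" using states_closed by blast
    with one show ?case by (simp add: \<Psi>_one \<sigma>_closed)
  next
    case (vt v c y)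
    have cl: "p \<in> carrier P" "y \<in> carrier F" using vt states_closed path_classes_closed by auto
    have q: "p \<diamond> \<delta> (vt v c) \<in> states v" using states_vt vt by blast
    have q': "p \<diamond> \<delta> (vt v c) \<diamond> \<delta> y \<in> states w" using states_mult[OF q vt(3)] .
    have "\<Psi> (vt v c \<star> y) p = \<Psi> y (p \<diamond> \<delta> (vt v c))"
      using vt cl by (simp add: \<Psi>_mult \<Psi>_vt \<Psi>_closed)
    then have "\<theta> (\<Psi> (vt v c \<star> y) p) = \<sigma> v p \<star> vt v c \<star> y \<star> inv\<^bsub>F\<^esub> \<sigma> w (p \<diamond> \<delta> (vt v c) \<diamond> \<delta> y)"
      using vt q by (simp add: \<sigma>_vt)
    then show ?case using cl vt \<sigma>_closed[OF vt(5)] \<sigma>_closed[OF q']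
      by (simp add: F.m_assoc P.m_assoc)
  next
    case (ed e y)
    have cl: "p \<in> carrier P" "y \<in> carrier F" using ed states_closed path_classes_closed by auto
    have q: "p \<diamond> \<delta> (ed e) \<in> states (tgt e)" using states_ed ed by blast
    have q': "p \<diamond> \<delta> (ed e) \<diamond> \<delta> y \<in> states w" using states_mult[OF q ed(2)] .
    note s = \<sigma>_closed[OF ed(4)] \<sigma>_closed[OF q'] \<sigma>_closed[OF q]
    have "\<Psi> (ed e \<star> y) p = gen e p \<otimes>\<^bsub>free_group r\<^esub> \<Psi> y (p \<diamond> \<delta> (ed e))"
      using ed cl by (simp add: \<Psi>_mult \<Psi>_ed)
    then have "\<theta> (\<Psi> (ed e \<star> y) p) = \<theta> (gen e p) \<star> \<theta> (\<Psi> y (p \<diamond> \<delta> (ed e)))"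
      using gen_closed cl ed \<Psi>_closed[OF cl(2,2)] by simp
    also have "\<dots> = \<kappa> e p \<star> (\<sigma> (tgt e) (p \<diamond> \<delta> (ed e)) \<star> y \<star> inv\<^bsub>F\<^esub> \<sigma> w (p \<diamond> \<delta> (ed e) \<diamond> \<delta> y))"
      using \<theta>_gen_\<kappa> ed q by simp
    \<comment> \<open>The section at the state between \<open>ed e\<close> and \<open>y\<close>
      occurs once inverted in \<open>\<kappa> e p\<close> and once in the induction hypothesis; the
      two cancel, so the whole product telescopes.\<close>
    also have "\<dots> = \<sigma> (src e) p \<star> ed e \<star> (inv\<^bsub>F\<^esub> \<sigma> (tgt e) (p \<diamond> \<delta> (ed e)) \<star>
        (\<sigma> (tgt e) (p \<diamond> \<delta> (ed e)) \<star> (y \<star> inv\<^bsub>F\<^esub> \<sigma> w (p \<diamond> \<delta> (ed e) \<diamond> \<delta> y))))"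
      using s cl ed by (simp add: \<kappa>_def F.m_assoc)
    also have "\<dots> = \<sigma> (src e) p \<star> ed e \<star> (y \<star> inv\<^bsub>F\<^esub> \<sigma> w (p \<diamond> \<delta> (ed e) \<diamond> \<delta> y))"
    proof -
      have "inv\<^bsub>F\<^esub> b \<star> (b \<star> z) = z" if "b \<in> carrier F" "z \<in> carrier F" for b z
        using that by (simp flip: F.m_assoc)
      then show ?thesis using s cl by simp
    qed
    finally show ?case using cl ed s by (simp add: F.m_assoc P.m_assoc)
  qed
  have \<Psi>_K: "\<Psi> (y \<star> z) \<one>\<^bsub>P\<^esub> = \<Psi> y \<one>\<^bsub>P\<^esub> \<otimes>\<^bsub>free_group r\<^esub> \<Psi> z \<one>\<^bsub>P\<^esub>" if "y \<in> K" "z \<in> K" for y z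
    using that \<Psi>_mult[of y z "\<one>\<^bsub>P\<^esub>"] path_classes_closed by (auto simp: K_def)
  have K_closed: "y \<in> carrier F" if "y \<in> K" for y using that subgroup.subset[OF subgroup_K] by auto
  have \<theta>_\<Psi>_K: "\<theta> (\<Psi> y \<one>\<^bsub>P\<^esub>) = y" if "y \<in> K" for y
  proof -
    have "y \<in> Paths x x" "\<delta> y = \<one>\<^bsub>P\<^esub>" using that by (auto simp: K_def)
    then show ?thesis using \<theta>_\<Psi>[of y x x "\<one>\<^bsub>P\<^esub>"] states_one K_closed[OF that] by (simp add: \<sigma>_one)
  qed
  have \<Psi>_\<kappa>: "\<Psi> (\<kappa> e p) \<one>\<^bsub>P\<^esub> = gen e p" if e: "e \<in> E" and p: "p \<in> states (src e)" for e p
  proof -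
    let ?s = "\<sigma> (tgt e) (p \<diamond> \<delta> (ed e))"
    have pc: "p \<in> carrier P" using p states_closed by blast
    have q: "p \<diamond> \<delta> (ed e) \<in> states (tgt e)" using states_ed p e by blast
    note s = \<sigma>_closed[OF p] \<sigma>_closed[OF q]
    \<comment> \<open>The final inverse in \<open>\<kappa>\<close> is cleared first: multiplying by
      the section \<open>?s\<close>, whose value under \<open>\<Psi>\<close> is trivial, avoids
      evaluating the cocycle on an inverse.\<close>
    have "\<kappa> e p \<star> ?s = \<sigma> (src e) p \<star> ed e" using s e by (simp add: \<kappa>_def F.m_assoc)
    moreover have "\<Psi> (\<kappa> e p \<star> ?s) \<one>\<^bsub>P\<^esub> = \<Psi> (\<kappa> e p) \<one>\<^bsub>P\<^esub>"
      using \<kappa>_in_K[OF e p] s \<Psi>_\<sigma>[OF q] \<Psi>_closed[of "\<kappa> e p" "\<kappa> e p" "\<one>\<^bsub>P\<^esub>"] K_closed[OF \<kappa>_in_K[OF e p]]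
      by (simp add: \<Psi>_mult K_def)
    moreover have "\<Psi> (\<sigma> (src e) p \<star> ed e) \<one>\<^bsub>P\<^esub> = gen e p"
      using s e p pc by (simp add: \<Psi>_mult \<Psi>_\<sigma> \<delta>_\<sigma> \<Psi>_ed gen_closed)
    ultimately show ?thesis by simp
  qed
  have \<Psi>_\<theta>: "\<Psi> (\<theta> z) \<one>\<^bsub>P\<^esub> = z" if "z \<in> carrier (free_group r)" for z
    using that
  proof (induction rule: free_group_induct)
    case one
    then show ?case by (simp add: \<Psi>_one)
  next
    case (gen i b z)
    let ?g = "free_gen r (i, True)" and ?h = "free_gen r (i, False)"
    have cl: "?g \<in> carrier (free_group r)" "?h \<in> carrier (free_group r)" using gen by auto
    have t: "\<Psi> (\<theta> ?g) \<one>\<^bsub>P\<^esub> = ?g" using gen(1) \<theta>_gen gen_g \<Psi>_\<kappa> g by simp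
    \<comment> \<open>The map \<open>\<theta>\<close> is prescribed on positive generators only. Its
      value on an inverse letter is reached by cancellation, since \<open>\<Psi>\<close> is
      multiplicative on the kernel.\<close>
    have inv: "?g \<otimes>\<^bsub>free_group r\<^esub> ?h = \<one>\<^bsub>free_group r\<^esub>" using free_gen_inv[OF gen(1), of True] cl
      by (metis Q.r_inv)
    have "\<Psi> (\<theta> ?g \<star> \<theta> ?h) \<one>\<^bsub>P\<^esub> = ?g \<otimes>\<^bsub>free_group r\<^esub> \<Psi> (\<theta> ?h) \<one>\<^bsub>P\<^esub>"
      using \<Psi>_K[OF \<theta>_K[OF cl(1)] \<theta>_K[OF cl(2)]] t by simp
    moreover have "\<theta> ?g \<star> \<theta> ?h = \<one>\<^bsub>F\<^esub>" using inv cl by (simp flip: \<theta>.hom_mult)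
    ultimately have "?g \<otimes>\<^bsub>free_group r\<^esub> \<Psi> (\<theta> ?h) \<one>\<^bsub>P\<^esub> = ?g \<otimes>\<^bsub>free_group r\<^esub> ?h" using inv
      by (simp add: \<Psi>_one)
    then have "\<Psi> (\<theta> ?h) \<one>\<^bsub>P\<^esub> = ?h"
      using cl \<Psi>_closed[of "\<theta> ?h" "\<theta> ?h" "\<one>\<^bsub>P\<^esub>"] by simp
    with t have "\<Psi> (\<theta> (free_gen r (i, b))) \<one>\<^bsub>P\<^esub> = free_gen r (i, b)" by (cases b) auto
    then show ?case using gen \<Psi>_K \<theta>_K by simp
  qed
  have \<Psi>_K_closed: "\<Psi> y \<one>\<^bsub>P\<^esub> \<in> carrier (free_group r)" if "y \<in> K" for y
    using \<Psi>_closed[of y y "\<one>\<^bsub>P\<^esub>"] K_closed[OF that] by simp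
  have "bij_betw \<theta> (carrier (free_group r)) K"
    by (rule bij_betw_byWitness[where f' = "\<lambda>y. \<Psi> y \<one>\<^bsub>P\<^esub>"])
      (use \<Psi>_\<theta> \<theta>_\<Psi>_K \<theta>_K \<Psi>_K_closed in auto)
  then have "\<theta> \<in> iso (free_group r) (F\<lparr>carrier := K\<rparr>)" using \<theta> by (simp add: iso_def)
  then show ?thesis by blast
qed

end

section \<open>Homomorphisms between lattices\<close>

lemma common_denominator:
  assumes "finite (S :: rat set)"
  obtains m :: nat where "0 < m" "\<And>r. r \<in> S \<Longrightarrow> of_nat m * r \<in> \<int>"
proof -
  have "\<exists>m::nat. 0 < m \<and> (\<forall>r\<in>S. of_nat m * r \<in> \<int>)"
    using assms
  proof (induction S)
    case empty
    then show ?case by (intro exI[of _ 1]) simp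
  next
    case (insert r S)
    then obtain m :: nat where m: "0 < m" "\<forall>r\<in>S. of_nat m * r \<in> \<int>" by blast
    obtain a b where ab: "quotient_of r = (a, b)" by fastforce
    then have b: "b > 0" "r = of_int a / of_int b" using quotient_of_denom_pos quotient_of_div
      by blast+
    have "of_nat (nat b) * r = of_int a" using b by simp
    then have eq: "of_nat (nat b * m) * r = of_nat m * of_int a"
      by (simp add: mult.commute mult.left_commute)
    have "of_nat (nat b * m) * r \<in> \<int>" unfolding eq by simp
    moreover have "of_nat (nat b * m) * s \<in> \<int>" if "s \<in> S" for s
    proof -
      have "of_nat (nat b * m) * s = of_nat (nat b) * (of_nat m * s)" by simp
      then show ?thesis using m that by (metis Ints_mult Ints_of_nat)
    qed
    ultimately show ?case using m b by (intro exI[of _ "nat b * m"]) auto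
  qed
  then show thesis using that by blast
qed

text \<open>The predicate passes to multiples, so the product of the individual bounds works. All
  uniform exponents and scales that range over finite index sets arise in this way.\<close>

lemma common_multiple:
  assumes "finite I" "\<And>i. i \<in> I \<Longrightarrow> \<exists>m::nat. 0 < m \<and> Pr i m"
    and "\<And>i m k. i \<in> I \<Longrightarrow> 0 < k \<Longrightarrow> Pr i m \<Longrightarrow> Pr i (k * m)"
  obtains m :: nat where "0 < m" "\<And>i. i \<in> I \<Longrightarrow> Pr i m"
proof -
  have "\<exists>m::nat. 0 < m \<and> (\<forall>i\<in>I. Pr i m)"
    using assms
  proof (induction I)
    case empty
    then show ?case by (intro exI[of _ 1]) simp
  next
    case (insert j I)
    have "\<exists>m::nat. 0 < m \<and> (\<forall>i\<in>I. Pr i m)" by (rule insert.IH) (use insert.prems in blast)+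
    then obtain m where m: "0 < m" "\<forall>i\<in>I. Pr i m" by blast
    obtain k where k: "0 < k" "Pr j k" using insert.prems by blast
    have "Pr j (m * k)" using insert.prems(2)[of j m k] m k by simp
    moreover have "Pr i (k * m)" if "i \<in> I" for i using insert.prems(2)[of i k m] m k that by simp
    ultimately show ?case using m k by (intro exI[of _ "m * k"]) (auto simp: mult.commute)
  qed
  then show thesis using that by blast
qed

section \<open>The groups Q^n and Z^n\<close>

definition vec_group :: "nat \<Rightarrow> rat vec monoid" where
  "vec_group n = \<lparr>carrier = carrier_vec n, monoid.mult = (+), one = 0\<^sub>v n\<rparr>"

lemma vec_group_simps [simp]:
  "carrier (vec_group n) = carrier_vec n"
  "(\<otimes>\<^bsub>vec_group n\<^esub>) = (+)"
  "\<one>\<^bsub>vec_group n\<^esub> = 0\<^sub>v n"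
  by (simp_all add: vec_group_def)

lemma comm_group_vec_group: "comm_group (vec_group n)"
proof (rule comm_groupI)
  fix x assume "x \<in> carrier (vec_group n)"
  then show "\<exists>y\<in>carrier (vec_group n). y \<otimes>\<^bsub>vec_group n\<^esub> x = \<one>\<^bsub>vec_group n\<^esub>"
    by (intro bexI[of _ "- x"]) auto
qed (auto simp: assoc_add_vec[of _ n] comm_add_vec[of _ n])

lemma vec_group_pow: "x \<in> carrier_vec n \<Longrightarrow> x [^]\<^bsub>vec_group n\<^esub> (m :: nat) = of_nat m \<cdot>\<^sub>v x"
proof (induction m)
  case (Suc m)
  then have "x [^]\<^bsub>vec_group n\<^esub> Suc m = of_nat m \<cdot>\<^sub>v x + x" by simp
  also have "\<dots> = of_nat (Suc m) \<cdot>\<^sub>v x" using Suc.prems by (intro eq_vecI) (auto simp: algebra_simps)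
  finally show ?case .
qed auto

abbreviation Zn :: "nat \<Rightarrow> (nat \<Rightarrow> int) set" where
  "Zn n \<equiv> carrier (Zn_group n)"

lemma Zn_group_simps:
  "Zn n = (\<Pi>\<^sub>E i\<in>{..<n}. UNIV)"
  "z \<otimes>\<^bsub>Zn_group n\<^esub> w = (\<lambda>i\<in>{..<n}. z i + w i)"
  "\<one>\<^bsub>Zn_group n\<^esub> = (\<lambda>i\<in>{..<n}. 0)"
  by (auto simp: Zn_group_def integer_group_def)

lemma comm_group_Zn: "comm_group (Zn_group n)"
proof (rule comm_groupI)
  fix x assume "x \<in> Zn n"
  then show "\<exists>y\<in>Zn n. y \<otimes>\<^bsub>Zn_group n\<^esub> x = \<one>\<^bsub>Zn_group n\<^esub>"
    by (intro bexI[of _ "\<lambda>i\<in>{..<n}. - x i"]) (auto simp: Zn_group_simps fun_eq_iff)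
qed (auto simp: Zn_group_simps fun_eq_iff PiE_iff extensional_def)

lemma Zn_pow: "z \<in> Zn n \<Longrightarrow> z [^]\<^bsub>Zn_group n\<^esub> (m :: nat) = (\<lambda>i\<in>{..<n}. int m * z i)"
proof (induction m)
  case (Suc m)
  interpret comm_group "Zn_group n" by (rule comm_group_Zn)
  show ?case using Suc by (auto simp: Zn_group_simps fun_eq_iff algebra_simps)
qed (auto simp: Zn_group_simps fun_eq_iff)

definition rvec :: "nat \<Rightarrow> (nat \<Rightarrow> int) \<Rightarrow> rat vec" where
  "rvec n z = vec n (\<lambda>i. of_int (z i))"

lemma rvec_carrier [simp]: "rvec n z \<in> carrier_vec n" "dim_vec (rvec n z) = n"
  by (simp_all add: rvec_def)

lemma rvec_index [simp]: "i < n \<Longrightarrow> rvec n z $ i = of_int (z i)"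
  by (simp add: rvec_def)

lemma rvec_hom: "rvec n \<in> hom (Zn_group n) (vec_group n)"
proof (rule homI)
  fix z w
  show "rvec n (z \<otimes>\<^bsub>Zn_group n\<^esub> w) = rvec n z \<otimes>\<^bsub>vec_group n\<^esub> rvec n w"
    by (intro eq_vecI) (simp_all add: Zn_group_simps)
qed simp

lemma rvec_inj:
  assumes z: "z \<in> Zn n" and w: "w \<in> Zn n" and eq: "rvec n z = rvec n w"
  shows "z = w"
proof (rule PiE_ext)
  show "z \<in> (\<Pi>\<^sub>E i\<in>{..<n}. UNIV)" "w \<in> (\<Pi>\<^sub>E i\<in>{..<n}. UNIV)"
    using z w by (simp_all add: Zn_group_simps)
  fix i assume "i \<in> {..<n}"
  moreover from eq have "rvec n z $ i = rvec n w $ i" by simp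
  ultimately show "z i = w i" by simp
qed

lemma rvec_surj:
  assumes "v \<in> carrier_vec n" "\<And>i. i < n \<Longrightarrow> v $ i \<in> \<int>"
  obtains z where "z \<in> Zn n" "rvec n z = v"
proof
  let ?z = "\<lambda>i\<in>{..<n}. \<lfloor>v $ i\<rfloor>"
  show "?z \<in> Zn n" by (simp add: Zn_group_simps)
  show "rvec n ?z = v" using assms by (intro eq_vecI) (auto simp: Ints_def)
qed

lemma rvec_clear_denominators:
  assumes "v \<in> carrier_vec n"
  obtains m z where "0 < m" "z \<in> Zn n" "rvec n z = of_nat m \<cdot>\<^sub>v v"
proof -
  obtain m :: nat where m: "0 < m" "\<And>r. r \<in> (\<lambda>i. v $ i) ` {..<n} \<Longrightarrow> of_nat m * r \<in> \<int>"
    using common_denominator[of "(\<lambda>i. v $ i) ` {..<n}"] by blast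
  obtain z where "z \<in> Zn n" "rvec n z = of_nat m \<cdot>\<^sub>v v"
    by (rule rvec_surj[of "of_nat m \<cdot>\<^sub>v v" n]) (use assms m in auto)
  with that m show thesis by blast
qed

definition std :: "nat \<Rightarrow> nat \<Rightarrow> nat \<Rightarrow> int" where
  "std n j = (\<lambda>i\<in>{..<n}. if i = j then 1 else 0)"

lemma std_carrier [simp]: "std n j \<in> Zn n"
  by (simp add: std_def Zn_group_simps)

lemma rvec_std: "j < n \<Longrightarrow> rvec n (std n j) = unit_vec n j"
  by (intro eq_vecI) (auto simp: std_def)

lemma additive_expand:
  fixes f :: "(nat \<Rightarrow> int) \<Rightarrow> rat"
  assumes add: "\<And>z w. z \<in> Zn n \<Longrightarrow> w \<in> Zn n \<Longrightarrow>
      f (z \<otimes>\<^bsub>Zn_group n\<^esub> w) = f z + f w"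
    and z: "z \<in> Zn n"
  shows "f z = (\<Sum>j<n. of_int (z j) * f (std n j))"
proof -
  interpret comm_group "Zn_group n" by (rule comm_group_Zn)
  have zero: "f \<one>\<^bsub>Zn_group n\<^esub> = 0" using add[of "\<one>\<^bsub>Zn_group n\<^esub>" "\<one>\<^bsub>Zn_group n\<^esub>"] by simp
  define u where "u j k = (\<lambda>i\<in>{..<n}. if i = j then k else 0)" for j :: nat and k :: int
  have u: "u j k \<in> Zn n" for j k by (simp add: u_def Zn_group_simps)
  have u_add: "u j (k + l) = u j k \<otimes>\<^bsub>Zn_group n\<^esub> u j l" for j k l
    by (auto simp: u_def Zn_group_simps fun_eq_iff)
  have u0: "u j 0 = \<one>\<^bsub>Zn_group n\<^esub>" for j by (auto simp: u_def Zn_group_simps fun_eq_iff)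
  have u1: "u j 1 = std n j" for j by (simp add: u_def std_def)
  have fu_nat: "f (u j (int k)) = of_nat k * f (std n j)" for j k
    by (induction k) (simp_all add: u0 zero u_add add u u1 algebra_simps)
  have fu: "f (u j k) = of_int k * f (std n j)" for j k
  proof (cases "k \<ge> 0")
    case True
    then show ?thesis using fu_nat[of j "nat k"] by simp
  next
    case False
    have "f (u j (k + - k)) = f (u j k) + f (u j (- k))" unfolding u_add by (simp add: add u)
    then have "f (u j k) + f (u j (- k)) = 0" by (simp add: u0 zero)
    moreover have "f (u j (- k)) = of_int (- k) * f (std n j)" using fu_nat[of j "nat (- k)"] False
      by simp
    ultimately show ?thesis by simp
  qed
  \<comment> \<open>Induction over the leading coordinates: the vector is built up by restoring one
    entry of \<open>z\<close> at a time.\<close>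
  have "m \<le> n \<Longrightarrow> f (\<lambda>i\<in>{..<n}. if i < m then z i else 0) = (\<Sum>j<m. of_int (z j) * f (std n j))" for m
  proof (induction m)
    case 0
    have "(\<lambda>i\<in>{..<n}. if i < (0::nat) then z i else 0) = \<one>\<^bsub>Zn_group n\<^esub>"
      by (auto simp: Zn_group_simps fun_eq_iff)
    then show ?case by (simp add: zero)
  next
    case (Suc m)
    let ?t = "\<lambda>m. \<lambda>i\<in>{..<n}. if i < m then z i else 0"
    have "?t (Suc m) = ?t m \<otimes>\<^bsub>Zn_group n\<^esub> u m (z m)"
      by (auto simp: Zn_group_simps u_def fun_eq_iff less_Suc_eq)
    moreover have "?t m \<in> Zn n" by (simp add: Zn_group_simps)
    ultimately have "f (?t (Suc m)) = f (?t m) + f (u m (z m))" by (simp only: add u)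
    also have "f (?t m) = (\<Sum>j<m. of_int (z j) * f (std n j))"
      by (rule Suc.IH) (use Suc.prems in simp)
    finally show ?case by (simp only: fu sum.lessThan_Suc)
  qed
  from this[of n] have "f (\<lambda>i\<in>{..<n}. if i < n then z i else 0) = (\<Sum>j<n. of_int (z j) * f (std n j))" by simp
  moreover have "(\<lambda>i\<in>{..<n}. if i < n then z i else 0) = z"
    using z by (auto simp: Zn_group_simps fun_eq_iff PiE_iff extensional_def)
  ultimately show ?thesis by simp
qed

section \<open>Matrices of homomorphisms from Z^n to Q^n\<close>

definition hom_mat :: "nat \<Rightarrow> ((nat \<Rightarrow> int) \<Rightarrow> rat vec) \<Rightarrow> rat mat" where
  "hom_mat n J = mat n n (\<lambda>(i, j). J (std n j) $ i)"

lemma hom_mat_carrier [simp]: "hom_mat n J \<in> carrier_mat n n" "dim_row (hom_mat n J) = n" "dim_col (hom_mat n J) = n"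
  by (simp_all add: hom_mat_def)

lemma hom_mat_mult:
  assumes J: "J \<in> hom (Zn_group n) (vec_group n)" and z: "z \<in> Zn n"
  shows "hom_mat n J *\<^sub>v rvec n z = J z"
proof (rule eq_vecI)
  have Jc: "J w \<in> carrier_vec n" if "w \<in> Zn n" for w using J that by (auto simp: hom_def)
  show "dim_vec (hom_mat n J *\<^sub>v rvec n z) = dim_vec (J z)" using Jc[OF z]
    by (simp add: hom_mat_def)
  fix i assume "i < dim_vec (J z)"
  then have i: "i < n" using Jc[OF z] by simp
  have "J z $ i = (\<Sum>j<n. of_int (z j) * J (std n j) $ i)"
  proof (rule additive_expand[where f = "\<lambda>z. J z $ i", OF _ z])
    fix a b assume ab: "a \<in> Zn n" "b \<in> Zn n"
    then have "J (a \<otimes>\<^bsub>Zn_group n\<^esub> b) = J a + J b" using J by (simp add: hom_def)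
    then show "J (a \<otimes>\<^bsub>Zn_group n\<^esub> b) $ i = J a $ i + J b $ i" using Jc[OF ab(1)] Jc[OF ab(2)] i
      by simp
  qed
  then show "(hom_mat n J *\<^sub>v rvec n z) $ i = J z $ i"
    using i by (simp add: hom_mat_def scalar_prod_def atLeast0LessThan mult.commute)
qed

text \<open>An image spanning Q^n gives the square matrix of \<open>J\<close> a right inverse, which
  is then also a left inverse. This rank argument is what makes the vertex coordinates
  injective.\<close>

lemma Zn_hom_inj:
  assumes J: "J \<in> hom (Zn_group n) (vec_group n)"
    and surj: "\<And>j. j < n \<Longrightarrow> \<exists>m::nat. \<exists>z\<in>Zn n. 0 < m \<and> J z = of_nat m \<cdot>\<^sub>v unit_vec n j"
  shows "inj_on J (Zn n)"
proof -
  let ?B = "hom_mat n J"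
  obtain m z where mz: "\<And>j. j < n \<Longrightarrow> 0 < m j \<and> z j \<in> Zn n \<and> J (z j) = of_nat (m j) \<cdot>\<^sub>v unit_vec n j"
    using surj by metis
  \<comment> \<open>Column \<open>j\<close> is the rational preimage of the unit vector: the
    integral vector \<open>z j\<close> divided by its multiple \<open>m j\<close>.\<close>
  define C where "C = mat n n (\<lambda>(i, j). of_int (z j i) / of_nat (m j) :: rat)"
  have C: "C \<in> carrier_mat n n" by (simp add: C_def)
  have col: "col (?B * C) j = unit_vec n j" if "j < n" for j
  proof -
    have "col C j = (1 / of_nat (m j)) \<cdot>\<^sub>v rvec n (z j)"
      using that C by (intro eq_vecI) (auto simp: C_def)
    then have "col (?B * C) j = ?B *\<^sub>v ((1 / of_nat (m j)) \<cdot>\<^sub>v rvec n (z j))"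
      using that C by (subst col_mult2[of _ n n _ n]) auto
    also have "\<dots> = (1 / of_nat (m j)) \<cdot>\<^sub>v (?B *\<^sub>v rvec n (z j))"
      by (rule mult_mat_vec[of _ n n]) auto
    also have "\<dots> = unit_vec n j"
      using mz[OF that] hom_mat_mult[OF J] by (intro eq_vecI) auto
    finally show ?thesis .
  qed
  have "?B * C = 1\<^sub>m n"
    using col C by (intro mat_col_eqI) auto
  then have CB: "C * ?B = 1\<^sub>m n" using mat_mult_left_right_inverse[OF hom_mat_carrier(1) C] by blast
  show ?thesis
  proof (rule inj_onI)
    fix a b assume ab: "a \<in> Zn n" "b \<in> Zn n" "J a = J b"
    have "rvec n c = C *\<^sub>v J c" if "c \<in> Zn n" for c
    proof -
      have "C *\<^sub>v (?B *\<^sub>v rvec n c) = (C * ?B) *\<^sub>v rvec n c"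
        by (rule assoc_mult_mat_vec[symmetric, OF C hom_mat_carrier(1)]) simp
      then show ?thesis using CB hom_mat_mult[OF J that] by simp
    qed
    then show "a = b" using ab rvec_inj by metis
  qed
qed

text \<open>A rational vector in the kernel of the matrix can be scaled to an integral one, so
  injectivity on the lattice already forces a nonzero determinant; the inverse is then the scaled
  adjugate.\<close>

lemma Zn_hom_right_inverse:
  assumes J: "J \<in> hom (Zn_group n) (vec_group n)" and inj: "inj_on J (Zn n)"
  obtains C where "C \<in> carrier_mat n n" "hom_mat n J * C = 1\<^sub>m n"
proof -
  let ?B = "hom_mat n J"
  interpret Z: comm_group "Zn_group n" by (rule comm_group_Zn)
  interpret R: comm_group "vec_group n" by (rule comm_group_vec_group)
  interpret J: group_hom "Zn_group n" "vec_group n" J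
    using J by (simp add: group_hom_def group_hom_axioms_def Z.is_group R.is_group)
  have scale: "?B *\<^sub>v (c \<cdot>\<^sub>v v) = c \<cdot>\<^sub>v (?B *\<^sub>v v)" if "v \<in> carrier_vec n" for c v
    by (rule mult_mat_vec[OF hom_mat_carrier(1) that])
  have det: "det ?B \<noteq> 0"
  proof
    assume "det ?B = 0"
    then obtain v where v: "v \<in> carrier_vec n" "v \<noteq> 0\<^sub>v n" "?B *\<^sub>v v = 0\<^sub>v n"
      using det_0_iff_vec_prod_zero[OF hom_mat_carrier(1)] by blast
    obtain m z where mz: "0 < m" "z \<in> Zn n" "rvec n z = of_nat m \<cdot>\<^sub>v v"
      using rvec_clear_denominators[OF v(1)] .
    have "J z = of_nat m \<cdot>\<^sub>v 0\<^sub>v n" using hom_mat_mult[OF J mz(2)] mz(3) scale v by simp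
    also have "\<dots> = 0\<^sub>v n" by (intro eq_vecI) auto
    finally have "J z = J \<one>\<^bsub>Zn_group n\<^esub>" using J.hom_one by (simp only: vec_group_simps)
    then have "z = \<one>\<^bsub>Zn_group n\<^esub>" by (rule inj_onD[OF inj _ mz(2) Z.one_closed])
    then have "rvec n z = 0\<^sub>v n" by (intro eq_vecI) (auto simp: Zn_group_simps)
    then have "of_nat m \<cdot>\<^sub>v v = 0\<^sub>v n" using mz(3) by (simp only:)
    then have "of_nat m * v $ i = 0" if "i < n" for i
      using that v(1) by (metis carrier_vecD index_smult_vec(1) index_zero_vec(1))
    then have "v = 0\<^sub>v n" using v(1) mz(1) by (intro eq_vecI) auto
    with v show False by simp
  qed
  have A: "adj_mat ?B \<in> carrier_mat n n" "?B * adj_mat ?B = det ?B \<cdot>\<^sub>m 1\<^sub>m n"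
    using adj_mat[OF hom_mat_carrier(1)[of n J]] by auto
  have "?B * ((1 / det ?B) \<cdot>\<^sub>m adj_mat ?B) = (1 / det ?B) \<cdot>\<^sub>m (?B * adj_mat ?B)"
    by (rule mult_smult_distrib[OF hom_mat_carrier(1) A(1)])
  also have "\<dots> = 1\<^sub>m n" unfolding A(2) using det by (intro eq_matI) auto
  finally show thesis using A(1) by (intro that[of "(1 / det ?B) \<cdot>\<^sub>m adj_mat ?B"]) auto
qed

text \<open>The number \<open>m\<close> is a common denominator of the entries of the inverse
  matrix, so one value serves all \<open>z\<close>: the image of \<open>J\<close> contains m
  Z^n.\<close>

lemma Zn_hom_uniformly_surj:
  assumes J: "J \<in> hom (Zn_group n) (vec_group n)" and inj: "inj_on J (Zn n)"
  obtains m :: nat where "0 < m"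
    "\<And>z. z \<in> Zn n \<Longrightarrow> \<exists>w\<in>Zn n. J w = of_nat m \<cdot>\<^sub>v rvec n z"
proof -
  let ?B = "hom_mat n J"
  obtain C where C: "C \<in> carrier_mat n n" "?B * C = 1\<^sub>m n" using Zn_hom_right_inverse[OF J inj] .
  let ?S = "(\<lambda>(i, j). C $$ (i, j)) ` ({..<n} \<times> {..<n})"
  have "finite ?S" by simp
  then obtain m :: nat where m: "0 < m" "\<And>r. r \<in> ?S \<Longrightarrow> of_nat m * r \<in> \<int>" using common_denominator
    by blast
  have "\<exists>w\<in>Zn n. J w = of_nat m \<cdot>\<^sub>v rvec n z" if z: "z \<in> Zn n" for z
  proof -
    let ?v = "of_nat m \<cdot>\<^sub>v rvec n z"
    have int: "(C *\<^sub>v ?v) $ i \<in> \<int>" if i: "i < n" for i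
    proof -
      have "(C *\<^sub>v ?v) $ i = (\<Sum>j<n. C $$ (i, j) * (of_nat m * of_int (z j)))"
        using i C by (simp add: scalar_prod_def atLeast0LessThan)
      also have "\<dots> = (\<Sum>j<n. of_nat m * C $$ (i, j) * of_int (z j))"
        by (intro sum.cong) simp_all
      also have "\<dots> \<in> \<int>"
      proof (rule Ints_sum)
        fix j assume "j \<in> {..<n}"
        then have "C $$ (i, j) \<in> ?S" using i by (intro image_eqI[of _ _ "(i, j)"]) auto
        from Ints_mult[OF m(2)[OF this] Ints_of_int]
        show "of_nat m * C $$ (i, j) * of_int (z j) \<in> \<int>" .
      qed
      finally show ?thesis .
    qed
    have Cv: "C *\<^sub>v ?v \<in> carrier_vec n" using C by simp
    obtain w where w: "w \<in> Zn n" "rvec n w = C *\<^sub>v ?v"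
      using rvec_surj[OF Cv int] by blast
    have "J w = ?B *\<^sub>v (C *\<^sub>v ?v)" using hom_mat_mult[OF J w(1)] w(2) by simp
    also have "\<dots> = (?B * C) *\<^sub>v ?v"
      by (rule assoc_mult_mat_vec[symmetric, OF hom_mat_carrier(1) C(1)]) simp
    also have "\<dots> = ?v" using C(2) by simp
    finally show ?thesis using w(1) by blast
  qed
  with m(1) that show thesis by blast
qed

text \<open>The number \<open>N\<close> is a common denominator of the entries of the finitely many
  products of \<open>q\<close> with the matrix of \<open>J\<close>, and integral vectors cannot
  introduce new denominators.\<close>

lemma Zn_hom_denominators:
  assumes J: "J \<in> hom (Zn_group n) (vec_group n)" and Q: "finite Q" "Q \<subseteq> carrier_mat n n"
  obtains N :: nat where "0 < N"
    "\<And>q z i. q \<in> Q \<Longrightarrow> z \<in> Zn n \<Longrightarrow> i < n \<Longrightarrow> of_nat N * (q *\<^sub>v J z) $ i \<in> \<int>"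
proof -
  let ?S = "(\<lambda>(q, i, j). (q * hom_mat n J) $$ (i, j)) ` (Q \<times> {..<n} \<times> {..<n})"
  have "finite ?S" using Q by simp
  then obtain N :: nat where N: "0 < N" "\<And>r. r \<in> ?S \<Longrightarrow> of_nat N * r \<in> \<int>" using common_denominator
    by blast
  have "of_nat N * (q *\<^sub>v J z) $ i \<in> \<int>" if q: "q \<in> Q" and z: "z \<in> Zn n" and i: "i < n" for q z i
  proof -
    have qc: "q \<in> carrier_mat n n" using q Q by blast
    have "q *\<^sub>v J z = q *\<^sub>v (hom_mat n J *\<^sub>v rvec n z)" using hom_mat_mult[OF J z] by simp
    also have "\<dots> = (q * hom_mat n J) *\<^sub>v rvec n z"
      by (rule assoc_mult_mat_vec[symmetric, OF qc hom_mat_carrier(1)]) simp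
    finally have "of_nat N * (q *\<^sub>v J z) $ i = of_nat N * (\<Sum>j<n. (q * hom_mat n J) $$ (i, j) * of_int (z j))"
      using i qc by (simp add: scalar_prod_def atLeast0LessThan del: index_mult_mat(1))
    also have "\<dots> = (\<Sum>j<n. (of_nat N * (q * hom_mat n J) $$ (i, j)) * of_int (z j))"
      by (simp add: sum_distrib_left mult.assoc)
    also have "\<dots> \<in> \<int>"
    proof (rule Ints_sum)
      fix j assume "j \<in> {..<n}"
      then have "(q * hom_mat n J) $$ (i, j) \<in> ?S" using q i
        by (intro image_eqI[of _ _ "(q, i, j)"]) auto
      from Ints_mult[OF N(2)[OF this] Ints_of_int]
      show "of_nat N * (q * hom_mat n J) $$ (i, j) * of_int (z j) \<in> \<int>" .
    qed
    finally show ?thesis .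
  qed
  with N that show thesis by blast
qed

text \<open>After identifying both groups with Z^n, \<open>f\<close> is an injective map between
  lattices of the same rank, so its image contains a multiple of every vector, in particular of the
  one representing \<open>b\<close>.\<close>

lemma inj_hom_virtually_surj:
  assumes AZ: "A \<cong> Zn_group n" and BZ: "B \<cong> Zn_group n" and A: "group A" and B: "group B"
    and f: "f \<in> hom A B" and inj: "inj_on f (carrier A)" and b: "b \<in> carrier B"
  obtains m :: nat and a where "0 < m" "a \<in> carrier A" "f a = b [^]\<^bsub>B\<^esub> m"
proof -
  interpret Z: comm_group "Zn_group n" by (rule comm_group_Zn)
  interpret R: comm_group "vec_group n" by (rule comm_group_vec_group)
  interpret A: group A by fact
  interpret B: group B by fact
  obtain g where g: "g \<in> iso (Zn_group n) A" using A.iso_sym[OF AZ] by (auto simp: is_iso_def)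
  obtain h where h: "h \<in> iso B (Zn_group n)" using BZ by (auto simp: is_iso_def)
  interpret h: group_hom B "Zn_group n" h
    using h by (simp add: group_hom_def group_hom_axioms_def Z.is_group B.is_group iso_def)
  interpret rv: group_hom "Zn_group n" "vec_group n" "rvec n"
    using rvec_hom by (simp add: group_hom_def group_hom_axioms_def Z.is_group R.is_group)
  let ?J = "rvec n \<circ> (h \<circ> (f \<circ> g))"
  have gh: "g \<in> hom (Zn_group n) A" using g by (simp add: iso_def)
  have Jh: "?J \<in> hom (Zn_group n) (vec_group n)"
    by (rule hom_compose[OF hom_compose[OF hom_compose[OF gh f] h.homh] rvec_hom])
  have gc: "g z \<in> carrier A" if "z \<in> Zn n" for z using gh that by (auto simp: hom_def)
  have fc: "f a \<in> carrier B" if "a \<in> carrier A" for a using f that by (auto simp: hom_def)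
  have gi: "inj_on g (Zn n)" using g by (auto simp: iso_def bij_betw_def)
  have hi: "inj_on h (carrier B)" using h by (auto simp: iso_def bij_betw_def)
  have "inj_on ?J (Zn n)"
  proof (rule inj_onI)
    fix z w assume z: "z \<in> Zn n" and w: "w \<in> Zn n" and "?J z = ?J w"
    then have "rvec n (h (f (g z))) = rvec n (h (f (g w)))" by (simp only: o_apply)
    then have "h (f (g z)) = h (f (g w))"
      by (rule rvec_inj[OF h.hom_closed[OF fc[OF gc[OF z]]] h.hom_closed[OF fc[OF gc[OF w]]]])
    then have "f (g z) = f (g w)" by (rule inj_onD[OF hi _ fc[OF gc[OF z]] fc[OF gc[OF w]]])
    then have "g z = g w" by (rule inj_onD[OF inj _ gc[OF z] gc[OF w]])
    then show "z = w" by (rule inj_onD[OF gi _ z w])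
  qed
  then obtain m z where mz: "0 < m" "z \<in> Zn n" "?J z = of_nat m \<cdot>\<^sub>v rvec n (h b)"
    using Zn_hom_uniformly_surj[OF Jh] h.hom_closed[OF b] by metis
  have "rvec n (h (b [^]\<^bsub>B\<^esub> m)) = of_nat m \<cdot>\<^sub>v rvec n (h b)"
  proof -
    have "h (b [^]\<^bsub>B\<^esub> m) = h b [^]\<^bsub>Zn_group n\<^esub> m" using b by (rule h.hom_nat_pow)
    moreover have "rvec n (h b [^]\<^bsub>Zn_group n\<^esub> m) = rvec n (h b) [^]\<^bsub>vec_group n\<^esub> m"
      by (rule rv.hom_nat_pow[OF h.hom_closed[OF b]])
    ultimately show ?thesis using vec_group_pow[OF rvec_carrier(1)] by (simp only:)
  qed
  then have "rvec n (h (f (g z))) = rvec n (h (b [^]\<^bsub>B\<^esub> m))" using mz(3) by (simp only: o_apply)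
  then have "h (f (g z)) = h (b [^]\<^bsub>B\<^esub> m)"
    by (rule rvec_inj[OF h.hom_closed[OF fc[OF gc[OF mz(2)]]] h.hom_closed[OF B.nat_pow_closed[OF b]]])
  then have "f (g z) = b [^]\<^bsub>B\<^esub> m"
    by (rule inj_onD[OF hi _ fc[OF gc[OF mz(2)]] B.nat_pow_closed[OF b]])
  then show thesis by (rule that[OF mz(1) gc[OF mz(2)]])
qed

section \<open>Coordinates and the modular homomorphism\<close>

lemma finite_image_of_invariant:
  assumes "finite (f ` S)" and eq: "\<And>a b. a \<in> S \<Longrightarrow> b \<in> S \<Longrightarrow> f a = f b \<Longrightarrow> g a = g b"
  shows "finite (g ` S)"
proof -
  have "g ` S \<subseteq> (\<lambda>v. g (SOME a. a \<in> S \<and> f a = v)) ` f ` S"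
  proof
    fix y assume "y \<in> g ` S"
    then obtain a where a: "a \<in> S" "y = g a" by blast
    have "(SOME b. b \<in> S \<and> f b = f a) \<in> S \<and> f (SOME b. b \<in> S \<and> f b = f a) = f a"
      by (rule someI[of _ a]) (use a in simp)
    then have "y = g (SOME b. b \<in> S \<and> f b = f a)" using eq a by metis
    with a show "y \<in> (\<lambda>v. g (SOME a. a \<in> S \<and> f a = v)) ` f ` S" by blast
  qed
  with assms(1) show ?thesis using finite_surj by blast
qed

text \<open>A criterion for finite index: an invariant with finitely many values that separates
  right cosets, which need not be constant on them.\<close>

lemma finite_rcosets_of_invariant:
  assumes G: "group G" and H: "subgroup H G" and fin: "finite (f ` carrier G)"
    and eq: "\<And>y z. y \<in> carrier G \<Longrightarrow> z \<in> carrier G \<Longrightarrow> f y = f z \<Longrightarrow> \<exists>h\<in>H. y = h \<otimes>\<^bsub>G\<^esub> z"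
  shows "finite (rcosets\<^bsub>G\<^esub> H)"
proof -
  interpret group G by fact
  have cong: "H #>\<^bsub>G\<^esub> y = H #>\<^bsub>G\<^esub> z" if yz: "y \<in> carrier G" "z \<in> carrier G" "f y = f z" for y z
  proof -
    obtain h where "h \<in> H" "y = h \<otimes>\<^bsub>G\<^esub> z" using eq[OF yz] by blast
    then have "y \<in> H #>\<^bsub>G\<^esub> z" by (auto simp: r_coset_def)
    then show ?thesis using repr_independence[OF _ yz(2) H] by simp
  qed
  have "rcosets\<^bsub>G\<^esub> H = (\<lambda>y. H #>\<^bsub>G\<^esub> y) ` carrier G" by (auto simp: RCOSETS_def)
  moreover have "finite ((\<lambda>y. H #>\<^bsub>G\<^esub> y) ` carrier G)"
    by (rule finite_image_of_invariant[OF fin]) (rule cong)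
  ultimately show ?thesis by simp
qed

text \<open>Pigeonhole: two different powers of \<open>y\<close> lie in the same coset, and their
  difference in exponent is the required \<open>m\<close>.\<close>

lemma finite_index_power:
  assumes G: "group G" and H: "finite_index_subgroup H G" and y: "y \<in> carrier G"
  obtains m :: nat where "0 < m" "y [^]\<^bsub>G\<^esub> m \<in> H"
proof -
  interpret group G by fact
  have sH: "subgroup H G" and fin: "finite (rcosets\<^bsub>G\<^esub> H)" using H
    by (auto simp: finite_index_subgroup_def)
  let ?f = "\<lambda>k::nat. H #>\<^bsub>G\<^esub> (y [^]\<^bsub>G\<^esub> k)"
  have "range ?f \<subseteq> rcosets\<^bsub>G\<^esub> H" using y by (auto simp: RCOSETS_def)
  then have "finite (range ?f)" using fin finite_subset by blast
  then have "\<not> inj ?f" using finite_imageD infinite_UNIV_nat by blast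
  then obtain i j where "i \<noteq> j" "?f i = ?f j" by (auto simp: inj_def)
  then obtain i j where ij: "i < j" "?f i = ?f j" by (metis nat_neq_iff)
  have "y [^]\<^bsub>G\<^esub> j \<in> ?f j" using rcos_self[OF _ sH] y by simp
  then obtain h where h: "h \<in> H" "y [^]\<^bsub>G\<^esub> j = h \<otimes>\<^bsub>G\<^esub> y [^]\<^bsub>G\<^esub> i" using ij
    by (auto simp: r_coset_def)
  have "y [^]\<^bsub>G\<^esub> (j - i) \<otimes>\<^bsub>G\<^esub> y [^]\<^bsub>G\<^esub> i = y [^]\<^bsub>G\<^esub> j" using ij y by (simp add: nat_pow_mult)
  then have "y [^]\<^bsub>G\<^esub> (j - i) = h" using h y subgroup.mem_carrier[OF sH h(1)] by simp
  then show thesis using that[of "j - i"] ij h by simp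
qed

lemma pow_prod_cong: "(\<And>i. i < n \<Longrightarrow> k i = l i) \<Longrightarrow> pow_prod G n a k = pow_prod G n a l"
  unfolding pow_prod_def
    by (intro arg_cong2[where f = "\<lambda>xs. foldr (\<otimes>\<^bsub>G\<^esub>) xs"] HOL.refl map_cong) simp

lemma (in group) intertwine_pow:
  assumes "g \<in> carrier G" "h \<in> carrier G" "p \<in> carrier G" "g \<otimes> p = p \<otimes> h"
  shows "g [^] (m::nat) \<otimes> p = p \<otimes> h [^] m"
proof (induction m)
  case (Suc m)
  have "g [^] Suc m \<otimes> p = g [^] m \<otimes> (g \<otimes> p)" using assms by (simp add: m_assoc)
  also have "\<dots> = g [^] m \<otimes> p \<otimes> h" unfolding assms(4) using assms by (simp add: m_assoc)
  also have "\<dots> = p \<otimes> h [^] Suc m" unfolding Suc.IH using assms by (simp add: m_assoc)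
  finally show ?case .
qed (use assms in simp)

lemma (in group) conj_pow:
  assumes "g \<in> carrier G" "c \<in> carrier G"
  shows "(g \<otimes> c \<otimes> inv g) [^] (m::nat) = g \<otimes> c [^] m \<otimes> inv g"
proof (induction m)
  case (Suc m)
  have "g \<otimes> c [^] m \<otimes> inv g \<otimes> (g \<otimes> c \<otimes> inv g) = g \<otimes> c [^] m \<otimes> (inv g \<otimes> g) \<otimes> c \<otimes> inv g"
    using assms by (simp only: m_assoc nat_pow_closed inv_closed m_closed)
  then show ?case using Suc assms by (simp add: m_assoc)
qed (use assms in simp)

locale commensurated_basis = group G
  for G :: "'g monoid" (structure) +
  fixes A :: "'g set" and n :: nat and a :: "nat \<Rightarrow> 'g"
  assumes A: "subgroup A G" and a_in_A: "\<And>i. i < n \<Longrightarrow> a i \<in> A"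
    and pow_prod_iso: "pow_prod G n a \<in> iso (Zn_group n) (G\<lparr>carrier := A\<rparr>)"
    and commensurated: "\<And>g c. g \<in> carrier G \<Longrightarrow> c \<in> A \<Longrightarrow> \<exists>m::nat. 0 < m \<and> g \<otimes> c [^] m \<otimes> inv g \<in> A"
begin

sublocale Z: comm_group "Zn_group n" by (rule comm_group_Zn)
sublocale R: comm_group "vec_group n" by (rule comm_group_vec_group)
sublocale A: group "G\<lparr>carrier := A\<rparr>" by (rule subgroup_imp_group[OF A])

section \<open>Integral coordinates on the base subgroup\<close>

abbreviation "expo \<equiv> pow_prod G n a"

lemma A_carrier: "c \<in> A \<Longrightarrow> c \<in> carrier G"
  using subgroup.mem_carrier[OF A] .

lemma expo_in_A: "z \<in> Zn n \<Longrightarrow> expo z \<in> A"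
  using pow_prod_iso by (auto simp: iso_def hom_def)

lemma expo_mult: "z \<in> Zn n \<Longrightarrow> w \<in> Zn n \<Longrightarrow> expo (z \<otimes>\<^bsub>Zn_group n\<^esub> w) = expo z \<otimes> expo w"
  using pow_prod_iso by (auto simp: iso_def hom_def)

lemma expo_surj: "c \<in> A \<Longrightarrow> \<exists>z\<in>Zn n. c = expo z"
  using pow_prod_iso by (auto simp: iso_def bij_betw_def)

lemma expo_inj: "inj_on expo (Zn n)"
  using pow_prod_iso by (auto simp: iso_def bij_betw_def)

lemma A_commute: "c \<in> A \<Longrightarrow> d \<in> A \<Longrightarrow> c \<otimes> d = d \<otimes> c"
  using expo_surj[of c] expo_surj[of d] expo_mult Z.m_comm by metis

definition coord :: "'g \<Rightarrow> rat vec" where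
  "coord c = rvec n (inv_into (Zn n) expo c)"

lemma coord_ex: "z \<in> Zn n \<Longrightarrow> coord (expo z) = rvec n z"
  by (simp add: coord_def inv_into_f_f[OF expo_inj])

lemma coord_carrier [simp]: "coord c \<in> carrier_vec n"
  by (simp add: coord_def)

lemma coord_mult: "c \<in> A \<Longrightarrow> d \<in> A \<Longrightarrow> coord (c \<otimes> d) = coord c + coord d"
  using expo_surj[of c] expo_surj[of d] hom_mult[OF rvec_hom[of n]]
  by (auto simp: coord_ex simp flip: expo_mult)

lemma coord_hom: "coord \<in> hom (G\<lparr>carrier := A\<rparr>) (vec_group n)"
  by (rule homI) (auto simp: coord_mult)

lemma A_pow: "c \<in> A \<Longrightarrow> c [^] (m::nat) \<in> A"
  by (induction m) (auto intro: subgroup.m_closed[OF A] subgroup.one_closed[OF A])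

lemma coord_pow: "c \<in> A \<Longrightarrow> coord (c [^] (m::nat)) = of_nat m \<cdot>\<^sub>v coord c"
proof (induction m)
  case 0
  have "coord \<one> = 0\<^sub>v n" using hom_one[OF coord_hom A.is_group R.is_group] by simp
  then show ?case by (simp add: coord_carrier) (auto intro!: eq_vecI simp: coord_def)
next
  case (Suc m)
  then have "coord (c [^] Suc m) = of_nat m \<cdot>\<^sub>v coord c + coord c" by (simp add: coord_mult A_pow)
  also have "\<dots> = of_nat (Suc m) \<cdot>\<^sub>v coord c" by (intro eq_vecI) (auto simp: algebra_simps coord_def)
  finally show ?case .
qed

text \<open>The elements of \<open>D\<close> can fix different vertices of the tree and need not
  commute. Hence \<open>D\<close> is used as a mere set, and additivity of rational coordinates is
  stated for commuting pairs.\<close>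

definition D :: "'g set" where
  "D = {g \<in> carrier G. \<exists>m::nat. 0 < m \<and> g [^] m \<in> A}"

text \<open>Rational coordinates of the elements that have a power in \<open>A\<close>; outside \<open>D\<close> the value of \<open>crd\<close>
  is meaningless.\<close>

definition crd :: "'g \<Rightarrow> rat vec" where
  "crd g = (let m = SOME m::nat. 0 < m \<and> g [^] m \<in> A in (1 / of_nat m) \<cdot>\<^sub>v coord (g [^] m))"

lemma D_carrier: "g \<in> D \<Longrightarrow> g \<in> carrier G"
  by (simp add: D_def)

lemma crd_carrier [simp]: "crd g \<in> carrier_vec n" "dim_vec (crd g) = n"
  by (simp_all add: crd_def Let_def coord_def)

text \<open>Independence of the chosen exponent: two exponents are compared through the power by
  their product.\<close>

lemma crd_eq:
  assumes g: "g \<in> carrier G" and m: "0 < (m::nat)" "g [^] m \<in> A"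
  shows "crd g = (1 / of_nat m) \<cdot>\<^sub>v coord (g [^] m)"
proof -
  define k where "k = (SOME m::nat. 0 < m \<and> g [^] m \<in> A)"
  have k: "0 < k \<and> g [^] k \<in> A" unfolding k_def by (rule someI[of _ m]) (use m in simp)
  have "of_nat m \<cdot>\<^sub>v coord (g [^] k) = coord (g [^] (k * m))"
    using k coord_pow[of "g [^] k" m] g by (simp add: nat_pow_pow)
  also have "\<dots> = of_nat k \<cdot>\<^sub>v coord (g [^] m)"
    using m coord_pow[of "g [^] m" k] g by (simp add: nat_pow_pow mult.commute)
  finally have *: "of_nat m \<cdot>\<^sub>v coord (g [^] k) = of_nat k \<cdot>\<^sub>v coord (g [^] m)" .
  have "crd g = (1 / of_nat k) \<cdot>\<^sub>v coord (g [^] k)" by (simp add: crd_def Let_def k_def)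
  also have "\<dots> = (1 / (of_nat k * of_nat m)) \<cdot>\<^sub>v (of_nat m \<cdot>\<^sub>v coord (g [^] k))"
    using m by (simp add: smult_smult_assoc)
  also have "\<dots> = (1 / of_nat m) \<cdot>\<^sub>v coord (g [^] m)"
    using k by (simp add: * smult_smult_assoc)
  finally show ?thesis .
qed

lemma A_subset_D: "c \<in> A \<Longrightarrow> c \<in> D"
  unfolding D_def using A_carrier by (auto intro!: exI[of _ 1])

lemma crd_A: "c \<in> A \<Longrightarrow> crd c = coord c"
  using crd_eq[of c 1] A_carrier by simp

lemma common_power:
  assumes "c \<in> D" "d \<in> D"
  obtains m :: nat where "0 < m" "c [^] m \<in> A" "d [^] m \<in> A"
proof -
  obtain k l :: nat where kl: "0 < k" "c [^] k \<in> A" "0 < l" "d [^] l \<in> A"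
    using assms by (auto simp: D_def)
  have "c [^] (k * l) \<in> A" using A_pow[OF kl(2), of l] assms D_carrier by (simp add: nat_pow_pow)
  moreover have "d [^] (k * l) \<in> A"
    using A_pow[OF kl(4), of k] assms D_carrier by (simp add: nat_pow_pow mult.commute)
  ultimately show thesis using that[of "k * l"] kl by simp
qed

lemma crd_mult:
  assumes c: "c \<in> D" and d: "d \<in> D" and comm: "c \<otimes> d = d \<otimes> c"
  shows "c \<otimes> d \<in> D" and "crd (c \<otimes> d) = crd c + crd d"
proof -
  obtain m :: nat where m: "0 < m" "c [^] m \<in> A" "d [^] m \<in> A" using common_power[OF c d] .
  have cd: "c \<in> carrier G" "d \<in> carrier G" using c d D_carrier by auto
  have p: "(c \<otimes> d) [^] m = c [^] m \<otimes> d [^] m" using pow_mult_distrib[OF comm cd] .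
  have pA: "(c \<otimes> d) [^] m \<in> A" unfolding p using m subgroup.m_closed[OF A] by simp
  then show "c \<otimes> d \<in> D" using cd m by (auto simp: D_def)
  have "crd (c \<otimes> d) = (1 / of_nat m) \<cdot>\<^sub>v (coord (c [^] m) + coord (d [^] m))"
    using crd_eq[OF _ m(1) pA] cd m by (simp add: p coord_mult)
  also have "\<dots> = crd c + crd d"
    using crd_eq[OF cd(1) m(1,2)] crd_eq[OF cd(2) m(1,3)]
    by (simp add: smult_add_distrib_vec[OF coord_carrier coord_carrier])
  finally show "crd (c \<otimes> d) = crd c + crd d" .
qed

lemma crd_pow:
  assumes "c \<in> D" shows "c [^] (k::nat) \<in> D" and "crd (c [^] k) = of_nat k \<cdot>\<^sub>v crd c"
proof -
  obtain m :: nat where m: "0 < m" "c [^] m \<in> A" using assms by (auto simp: D_def)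
  have c: "c \<in> carrier G" using assms D_carrier by blast
  have e: "(c [^] k) [^] m = (c [^] m) [^] k" using c by (simp add: nat_pow_pow mult.commute)
  have eA: "(c [^] k) [^] m \<in> A" unfolding e using A_pow m by blast
  then show "c [^] k \<in> D" using c m by (auto simp: D_def)
  show "crd (c [^] k) = of_nat k \<cdot>\<^sub>v crd c"
    using crd_eq[OF _ m(1) eA] crd_eq[OF c m] c coord_pow[OF m(2)]
    by (simp add: e smult_smult_assoc)
qed

section \<open>Conjugation in rational coordinates\<close>

lemma conj_D:
  assumes g: "g \<in> carrier G" and c: "c \<in> D"
  shows "g \<otimes> c \<otimes> inv g \<in> D"
proof -
  obtain m :: nat where m: "0 < m" "c [^] m \<in> A" using c by (auto simp: D_def)
  obtain k :: nat where k: "0 < k" "g \<otimes> (c [^] m) [^] k \<otimes> inv g \<in> A"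
    using commensurated[OF g m(2)] by blast
  have "(g \<otimes> c \<otimes> inv g) [^] (m * k) \<in> A"
    using k g D_carrier[OF c] by (simp add: conj_pow nat_pow_pow)
  then show ?thesis using m k g D_carrier[OF c] unfolding D_def
    by (intro CollectI conjI exI[of _ "m * k"]) auto
qed

text \<open>Column \<open>j\<close> consists of the rational coordinates of the conjugate of
  \<open>a j\<close>. Rational coordinates absorb the exponent \<open>m\<close> of the modular
  homomorphism, so products need no matching of exponents; \<open>modular_hom_eq\<close> shows that
  both definitions agree.\<close>

definition mod_mat :: "'g \<Rightarrow> rat mat" where
  "mod_mat g = hom_mat n (\<lambda>z. crd (g \<otimes> expo z \<otimes> inv g))"

lemma mod_mat_carrier [simp]: "mod_mat g \<in> carrier_mat n n"
  by (simp add: mod_mat_def)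

lemma conj_hom:
  assumes g: "g \<in> carrier G"
  shows "(\<lambda>z. crd (g \<otimes> expo z \<otimes> inv g)) \<in> hom (Zn_group n) (vec_group n)"
proof (rule homI)
  fix z w assume zw: "z \<in> Zn n" "w \<in> Zn n"
  let ?c = "\<lambda>z. g \<otimes> expo z \<otimes> inv g"
  have c: "expo z \<in> carrier G" "expo w \<in> carrier G" using zw expo_in_A A_carrier by auto
  have m: "?c u \<otimes> ?c v = g \<otimes> (expo u \<otimes> expo v) \<otimes> inv g" if "u \<in> Zn n" "v \<in> Zn n" for u v
  proof -
    have cc: "expo u \<in> carrier G" "expo v \<in> carrier G" using that expo_in_A A_carrier by auto
    have "?c u \<otimes> ?c v = g \<otimes> expo u \<otimes> (inv g \<otimes> g) \<otimes> expo v \<otimes> inv g"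
      using cc g by (simp only: m_assoc inv_closed m_closed)
    then show ?thesis using cc g by (simp add: m_assoc)
  qed
  have "?c z \<otimes> ?c w = ?c w \<otimes> ?c z" unfolding m[OF zw] m[OF zw(2,1)] using A_commute expo_in_A zw
    by simp
  moreover have "?c z \<in> D" "?c w \<in> D" 
    using conj_D[OF g A_subset_D[OF expo_in_A]] zw by blast+
  ultimately have "crd (?c z \<otimes> ?c w) = crd (?c z) + crd (?c w)" by (intro crd_mult(2))
  then show "crd (?c (z \<otimes>\<^bsub>Zn_group n\<^esub> w)) = crd (?c z) \<otimes>\<^bsub>vec_group n\<^esub> crd (?c w)"
    using m[OF zw] expo_mult[OF zw] by simp
qed simp

text \<open>On \<open>A\<close> this is the defining property of the matrix. A general
  \<open>c\<close> is reduced to a power lying in \<open>A\<close>, and the exponent is divided out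
  on both sides.\<close>

lemma crd_conj:
  assumes g: "g \<in> carrier G" and c: "c \<in> D"
  shows "crd (g \<otimes> c \<otimes> inv g) = mod_mat g *\<^sub>v crd c"
proof -
  have cc: "c \<in> carrier G" using c D_carrier by blast
  obtain m :: nat where m: "0 < m" "c [^] m \<in> A" using c by (auto simp: D_def)
  obtain z where z: "z \<in> Zn n" "c [^] m = expo z" using expo_surj[OF m(2)] by blast
  have "of_nat m \<cdot>\<^sub>v crd (g \<otimes> c \<otimes> inv g) = crd ((g \<otimes> c \<otimes> inv g) [^] m)"
    using crd_pow(2)[OF conj_D[OF g c]] by simp
  also have "\<dots> = crd (g \<otimes> expo z \<otimes> inv g)" using conj_pow[OF g cc] z by simp
  also have "\<dots> = mod_mat g *\<^sub>v rvec n z" unfolding mod_mat_def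
    using hom_mat_mult[OF conj_hom[OF g] z(1)] by simp
  also have "rvec n z = of_nat m \<cdot>\<^sub>v crd c"
    using crd_pow(2)[OF c, of m] z crd_A[OF m(2)] coord_ex by simp
  also have "mod_mat g *\<^sub>v (of_nat m \<cdot>\<^sub>v crd c) = of_nat m \<cdot>\<^sub>v (mod_mat g *\<^sub>v crd c)"
    by (rule mult_mat_vec[OF mod_mat_carrier crd_carrier(1)])
  finally have *: "of_nat m \<cdot>\<^sub>v crd (g \<otimes> c \<otimes> inv g) = of_nat m \<cdot>\<^sub>v (mod_mat g *\<^sub>v crd c)" .
  have "(1 / of_nat m) \<cdot>\<^sub>v (of_nat m \<cdot>\<^sub>v v) = v" for v :: "rat vec" using m
    by (simp add: smult_smult_assoc)
  then show ?thesis using arg_cong[OF *, of "\<lambda>v. (1 / of_nat m) \<cdot>\<^sub>v v"] by simp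
qed

lemma a_carrier: "i < n \<Longrightarrow> a i \<in> carrier G"
  using a_in_A A_carrier by blast

lemma expo_std:
  assumes "j < n" shows "expo (std n j) = a j"
proof -
  have "foldr (\<otimes>) (map (\<lambda>i. a i [^] std n j i) xs) \<one> = (if j \<in> set xs then a j else \<one>)"
    if "distinct xs" "set xs \<subseteq> {..<n}" for xs
    using that
  proof (induction xs)
    case (Cons i xs)
    then have "a i [^] std n j i = (if i = j then a j else \<one>)"
      using a_carrier[of i] by (auto simp: std_def int_pow_1)
    with Cons assms show ?case using a_carrier[of j] by auto
  qed simp
  from this[of "[0..<n]"] show ?thesis using assms by (simp add: pow_prod_def atLeast0LessThan)
qed

lemma crd_a: "j < n \<Longrightarrow> crd (a j) = unit_vec n j"
  using crd_A[OF a_in_A] coord_ex[OF std_carrier, of j] by (simp add: expo_std rvec_std)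

lemma col_mm:
  assumes "g \<in> carrier G" "j < n"
  shows "col (mod_mat g) j = crd (g \<otimes> a j \<otimes> inv g)"
  using assms by (intro eq_vecI) (auto simp: mod_mat_def hom_mat_def expo_std)

lemma mod_mat_mult:
  assumes g: "g \<in> carrier G" and h: "h \<in> carrier G"
  shows "mod_mat (g \<otimes> h) = mod_mat g * mod_mat h"
proof (rule mat_col_eqI)
  fix j assume "j < dim_col (mod_mat g * mod_mat h)"
  then have j: "j < n" using carrier_matD[OF mod_mat_carrier] by simp
  have aj: "a j \<in> D" "a j \<in> carrier G" using j a_in_A A_subset_D a_carrier by auto
  have "col (mod_mat (g \<otimes> h)) j = crd (g \<otimes> (h \<otimes> a j \<otimes> inv h) \<otimes> inv g)"
    using g h j aj by (simp add: col_mm m_assoc inv_mult_group)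
  also have "\<dots> = mod_mat g *\<^sub>v crd (h \<otimes> a j \<otimes> inv h)" by (rule crd_conj[OF g conj_D[OF h aj(1)]])
  also have "\<dots> = col (mod_mat g * mod_mat h) j"
    using h j col_mult2[OF mod_mat_carrier mod_mat_carrier j] by (simp add: col_mm)
  finally show "col (mod_mat (g \<otimes> h)) j = col (mod_mat g * mod_mat h) j" .
qed (use carrier_matD[OF mod_mat_carrier] in auto)

lemma mod_mat_one: "mod_mat \<one> = 1\<^sub>m n"
  by (rule mat_col_eqI) (use carrier_matD[OF mod_mat_carrier] in \<open>auto simp: col_mm a_carrier crd_a\<close>)

section \<open>Agreement with the modular homomorphism\<close>

lemma pow_prod_in_subgroup:
  assumes H: "subgroup H G" and "\<And>i. i < n \<Longrightarrow> a i [^] (k i :: int) \<in> H"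
  shows "expo k \<in> H"
proof -
  have "foldr (\<otimes>) (map (\<lambda>i. a i [^] k i) xs) \<one> \<in> H" if "set xs \<subseteq> {..<n}" for xs
    using that assms by (induction xs) (auto intro: subgroup.one_closed subgroup.m_closed)
  from this[of "[0..<n]"] show ?thesis by (simp add: pow_prod_def atLeast0LessThan)
qed

text \<open>Any exponent that moves all conjugated basis elements into \<open>A\<close> works. The
  subgroup generated by the powers contains every element whose exponents are divisible by
  \<open>m\<close>, so only finitely many residue vectors remain.\<close>

lemma modular_exponent_exists:
  assumes g: "g \<in> carrier G"
  obtains m where "modular_exponent G A n a g m" "\<And>j. j < n \<Longrightarrow> g \<otimes> a j [^] m \<otimes> inv g \<in> A"
proof -
  have expo: "\<exists>m::nat. 0 < m \<and> g \<otimes> a j [^] m \<otimes> inv g \<in> A" if "j \<in> {..<n}" for j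
    using commensurated[OF g a_in_A] that by simp
  have mul: "g \<otimes> a j [^] (k * m) \<otimes> inv g \<in> A"
    if "j \<in> {..<n}" "0 < k" "g \<otimes> a j [^] m \<otimes> inv g \<in> A" for j and k m :: nat
  proof -
    have "(g \<otimes> a j [^] m \<otimes> inv g) [^] k = g \<otimes> a j [^] (k * m) \<otimes> inv g"
      using that g a_carrier[of j] by (simp add: conj_pow nat_pow_pow mult.commute)
    then show ?thesis using A_pow[OF that(3), of k] by simp
  qed
  obtain m :: nat where m: "0 < m" "\<And>j. j \<in> {..<n} \<Longrightarrow> g \<otimes> a j [^] m \<otimes> inv g \<in> A"
    by (rule common_multiple[of "{..<n}" "\<lambda>j m. g \<otimes> a j [^] m \<otimes> inv g \<in> A"])
      ((rule finite_lessThan expo mul | assumption)+, blast)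
  let ?B = "A \<inter> {inv g \<otimes> y \<otimes> g | y. y \<in> A}"
  let ?L = "generate G {a i [^] m | i. i < n}"
  have B: "subgroup ?B G"
  proof (rule subgroups_Inter_pair[OF A])
    show "subgroup {inv g \<otimes> y \<otimes> g | y. y \<in> A} G"
    proof (rule subgroupI)
      show "{inv g \<otimes> y \<otimes> g | y. y \<in> A} \<noteq> {}" using subgroup.one_closed[OF A] by blast
      show "{inv g \<otimes> y \<otimes> g | y. y \<in> A} \<subseteq> carrier G" using g A_carrier by auto
    next
      fix u assume "u \<in> {inv g \<otimes> y \<otimes> g | y. y \<in> A}"
      then obtain y where y: "y \<in> A" "u = inv g \<otimes> y \<otimes> g" by blast
      then have "inv u = inv g \<otimes> inv y \<otimes> g" using g A_carrier by (simp add: inv_mult_group m_assoc)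
      then show "inv u \<in> {inv g \<otimes> y \<otimes> g | y. y \<in> A}" using subgroup.m_inv_closed[OF A y(1)] by blast
    next
      fix u v assume "u \<in> {inv g \<otimes> y \<otimes> g | y. y \<in> A}" "v \<in> {inv g \<otimes> y \<otimes> g | y. y \<in> A}"
      then obtain y z where y: "y \<in> A" "u = inv g \<otimes> y \<otimes> g" "z \<in> A" "v = inv g \<otimes> z \<otimes> g" by blast
      have yz: "y \<in> carrier G" "z \<in> carrier G" using y A_carrier by auto
      have "u \<otimes> v = inv g \<otimes> y \<otimes> (g \<otimes> inv g) \<otimes> z \<otimes> g"
        using g yz unfolding y by (simp only: m_assoc inv_closed m_closed)
      then have "u \<otimes> v = inv g \<otimes> (y \<otimes> z) \<otimes> g" using g yz by (simp add: m_assoc)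
      then show "u \<otimes> v \<in> {inv g \<otimes> y \<otimes> g | y. y \<in> A}" using subgroup.m_closed[OF A y(1,3)] by blast
    qed
  qed
  have gens: "a i [^] m \<in> ?B" if "i < n" for i
  proof -
    have "a i [^] m = inv g \<otimes> (g \<otimes> a i [^] m \<otimes> inv g) \<otimes> g"
    proof -
      have "inv g \<otimes> (g \<otimes> y \<otimes> inv g) \<otimes> g = (inv g \<otimes> g) \<otimes> y \<otimes> (inv g \<otimes> g)" if "y \<in> carrier G" for y
        using g that by (simp only: m_assoc inv_closed m_closed)
      then show ?thesis using g a_carrier[OF that] by simp
    qed
    then show ?thesis using m(2)[of i] that A_pow[OF a_in_A[OF that]] by blast
  qed
  have LB: "?L \<subseteq> ?B" by (rule generate_subgroup_incl[OF _ B]) (use gens in blast)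
  have L: "subgroup ?L G" by (rule generate_is_subgroup) (use a_carrier in auto)
  have sub: "subgroup ?L (G\<lparr>carrier := ?B\<rparr>)" by (rule subgroup_incl[OF L B LB])
  have Bg: "group (G\<lparr>carrier := ?B\<rparr>)" by (rule subgroup_imp_group[OF B])
  \<comment> \<open>The invariant for the finite index criterion: the exponent vector modulo
    \<open>m\<close>.\<close>
  let ?f = "\<lambda>b. \<lambda>i\<in>{..<n}. inv_into (Zn n) expo b i mod int m"
  have "finite (rcosets\<^bsub>G\<lparr>carrier := ?B\<rparr>\<^esub> ?L)"
  proof (rule finite_rcosets_of_invariant[OF Bg sub, of ?f])
    have "?f ` carrier (G\<lparr>carrier := ?B\<rparr>) \<subseteq> (\<Pi>\<^sub>E i\<in>{..<n}. {0..<int m})" using m by auto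
    then show "finite (?f ` carrier (G\<lparr>carrier := ?B\<rparr>))"
      by (rule finite_subset) (auto intro: finite_PiE)
  next
    fix y z assume "y \<in> carrier (G\<lparr>carrier := ?B\<rparr>)" "z \<in> carrier (G\<lparr>carrier := ?B\<rparr>)" and eq: "?f y = ?f z"
    then have yz: "y \<in> A" "z \<in> A" by auto
    obtain u v where u: "u \<in> Zn n" "y = expo u" and v: "v \<in> Zn n" "z = expo v"
      using expo_surj yz by blast
    have md: "u i mod int m = v i mod int m" if "i < n" for i
      using fun_cong[OF eq, of i] that u v by (simp add: inv_into_f_f[OF expo_inj])
    define w where "w = (\<lambda>i\<in>{..<n}. u i - v i)"
    have w: "w \<in> Zn n" by (simp add: w_def Zn_group_simps)
    have "w \<otimes>\<^bsub>Zn_group n\<^esub> v = u"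
      using u v by (auto simp: w_def Zn_group_simps fun_eq_iff PiE_iff extensional_def)
    then have y: "y = expo w \<otimes> z" using expo_mult[OF w v(1)] u v by simp
    have "expo w \<in> ?L"
    proof (rule pow_prod_in_subgroup[OF L])
      fix i assume i: "i < n"
      have "int m dvd w i" using md[OF i] i by (simp add: w_def mod_eq_dvd_iff)
      then obtain q where q: "w i = int m * q" by (elim dvdE)
      have "a i [^] w i = (a i [^] m) [^] q"
        using a_carrier[OF i] by (simp add: q int_pow_pow flip: int_pow_int)
      moreover have "(a i [^] m) [^] q \<in> ?L"
        by (rule subgroup_int_pow_closed[OF L]) (use i in \<open>auto intro: generate.incl\<close>)
      ultimately show "a i [^] w i \<in> ?L" by simp
    qed
    with y show "\<exists>h\<in>?L. y = h \<otimes>\<^bsub>G\<lparr>carrier := ?B\<rparr>\<^esub> z" by auto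
  qed
  then have "modular_exponent G A n a g m"
    using m sub unfolding modular_exponent_def finite_index_subgroup_def by blast
  then show thesis by (rule that) (use m in simp)
qed

text \<open>Every admissible pair of \<open>m\<close> and \<open>k\<close> describes the coordinates
  of the m-th power of a conjugated basis element; dividing by \<open>m\<close> gives the same
  rational column each time. This settles uniqueness of the description, and
  \<open>modular_exponent_exists\<close> settles existence.\<close>

lemma modular_hom_eq:
  assumes g: "g \<in> carrier G"
  shows "modular_hom G A n a g = mod_mat g"
proof -
  have unique: "N = mod_mat g" if "0 < m" and k: "\<forall>j<n. g \<otimes> (a j [^] m) \<otimes> inv g = expo (\<lambda>i. k i j)"
    and N: "N = mat n n (\<lambda>(i, j). of_int (k i j) / of_nat m)" for N m and k :: "nat \<Rightarrow> nat \<Rightarrow> int"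
  proof (rule mat_col_eqI)
    fix j assume "j < dim_col (mod_mat g)"
    then have j: "j < n" using carrier_matD[OF mod_mat_carrier] by simp
    have aj: "a j \<in> D" "a j \<in> carrier G" using j a_in_A A_subset_D a_carrier by auto
    \<comment> \<open>Elements of \<open>Zn n\<close> are functions restricted to
      \<open>{..<n}\<close>; the restriction changes no factor of \<open>expo\<close>.\<close>
    let ?z = "\<lambda>i\<in>{..<n}. k i j"
    have z: "?z \<in> Zn n" by (simp add: Zn_group_simps)
    have "expo (\<lambda>i. k i j) = expo ?z" by (rule pow_prod_cong) simp
    then have p: "(g \<otimes> a j \<otimes> inv g) [^] m = expo ?z" using k j g aj by (simp add: conj_pow)
    have "col (mod_mat g) j = (1 / of_nat m) \<cdot>\<^sub>v coord (expo ?z)"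
      using crd_eq[of "g \<otimes> a j \<otimes> inv g" m] p g aj j \<open>0 < m\<close> expo_in_A[OF z] by (simp add: col_mm)
    also have "\<dots> = col N j" using coord_ex[OF z] j N by (intro eq_vecI) auto
    finally show "col N j = col (mod_mat g) j" by simp
  qed (use N carrier_matD[OF mod_mat_carrier] in auto)
  obtain m where m: "modular_exponent G A n a g m" "\<And>j. j < n \<Longrightarrow> g \<otimes> a j [^] m \<otimes> inv g \<in> A"
    using modular_exponent_exists[OF g] by blast
  have "\<forall>j. \<exists>z. j < n \<longrightarrow> g \<otimes> a j [^] m \<otimes> inv g = expo z" using expo_surj[OF m(2)] by blast
  from choice[OF this] obtain z where z: "\<And>j. j < n \<Longrightarrow> g \<otimes> a j [^] m \<otimes> inv g = expo (z j)" by blast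
  show ?thesis unfolding modular_hom_def
  proof (rule the_equality)
    let ?N = "mat n n (\<lambda>(i, j). of_int (z j i) / of_nat m) :: rat mat"
    have "?N = mod_mat g"
      by (rule unique[of m "\<lambda>i j. z j i"]) (use m z in \<open>auto simp: modular_exponent_def\<close>)
    then show "\<exists>m k. modular_exponent G A n a g m &
        (\<forall>j<n. g \<otimes> (a j [^] m) \<otimes> inv g = expo (\<lambda>i. k i j)) &
        mod_mat g = mat n n (\<lambda>(i, j). of_int (k i j) / of_nat m)"
      using m z by (intro exI[of _ m] exI[of _ "\<lambda>i j. z j i"]) simp
  next
    fix N :: "rat mat" assume "\<exists>m k. modular_exponent G A n a g m &
        (\<forall>j<n. g \<otimes> (a j [^] m) \<otimes> inv g = expo (\<lambda>i. k i j)) &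
        N = mat n n (\<lambda>(i, j). of_int (k i j) / of_nat m)"
    then obtain m and k :: "nat \<Rightarrow> nat \<Rightarrow> int" where "modular_exponent G A n a g m" "\<forall>j<n. g \<otimes> (a j [^] m) \<otimes> inv g = expo (\<lambda>i. k i j)"
      "N = mat n n (\<lambda>(i, j). of_int (k i j) / of_nat m)" by blast
    then show "N = mod_mat g" by (intro unique) (auto simp: modular_exponent_def)
  qed
qed

lemma monodromy_eq: "monodromy G A n a = mod_mat ` carrier G"
  by (simp add: monodromy_def modular_hom_eq)

end

section \<open>Commensurability of vertex groups\<close>

locale gbs = graph_groups \<G> + G: group G
  for \<G> :: "('v, 'e, 'a, 'b) graph_of_groups" and G :: "'g monoid" (structure) +
  fixes n :: nat and x :: 'v and phi :: "'g \<Rightarrow> ('v, 'e, 'a) letter list set"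
  assumes VG_iso: "v \<in> V \<Longrightarrow> VG v \<cong> Zn_group n"
    and EG_iso: "e \<in> E \<Longrightarrow> EG e \<cong> Zn_group n"
    and fin_V: "finite V" and fin_E: "finite E"
    and x: "x \<in> V"
    and phi_iso: "phi \<in> iso G (fundamental_group \<G> x)"
begin

section \<open>Transport between the group and loops at the base vertex\<close>

definition psi :: "('v, 'e, 'a) letter list set \<Rightarrow> 'g" where
  "psi = inv_into (carrier G) phi"

lemma phi_psi: "y \<in> Paths x x \<Longrightarrow> phi (psi y) = y"
  and psi_phi: "g \<in> carrier G \<Longrightarrow> psi (phi g) = g"
  using phi_iso by (auto simp: psi_def iso_def bij_betw_inv_into_left bij_betw_inv_into_right)

lemma phi_closed: "g \<in> carrier G \<Longrightarrow> phi g \<in> Paths x x"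
  and phi_mult: "g \<in> carrier G \<Longrightarrow> h \<in> carrier G \<Longrightarrow> phi (g \<otimes> h) = phi g \<star> phi h"
  using phi_iso by (auto simp: iso_def hom_def)

lemma phi_inj: "g \<in> carrier G \<Longrightarrow> h \<in> carrier G \<Longrightarrow> phi g = phi h \<Longrightarrow> g = h"
  using psi_phi by metis

lemma psi_closed: "y \<in> Paths x x \<Longrightarrow> psi y \<in> carrier G"
  using phi_iso by (auto simp: psi_def iso_def bij_betw_def intro: inv_into_into)

lemma psi_mult:
  assumes "y \<in> Paths x x" "z \<in> Paths x x"
  shows "psi (y \<star> z) = psi y \<otimes> psi z"
  using assms by (intro phi_inj) (auto simp: psi_closed path_mult phi_psi phi_mult)

lemma phi_carrier: "g \<in> carrier G \<Longrightarrow> phi g \<in> carrier F"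
  using phi_closed path_classes_closed by blast

lemma phi_one: "phi \<one> = \<one>\<^bsub>F\<^esub>"
proof -
  have "phi \<one> \<star> phi \<one> = phi \<one>" using phi_mult[of "\<one>" "\<one>"] by simp
  then show ?thesis using phi_carrier[OF G.one_closed] by (simp add: F.l_cancel_one)
qed

lemma phi_inv: "g \<in> carrier G \<Longrightarrow> phi (inv g) = inv\<^bsub>F\<^esub> phi g"
  by (rule F.inv_equality[symmetric]) (auto simp: phi_carrier phi_one simp flip: phi_mult)

lemma psi_inv: "y \<in> Paths x x \<Longrightarrow> psi (inv\<^bsub>F\<^esub> y) = inv psi y"
  by (intro phi_inj) (auto simp: psi_closed path_inv phi_psi phi_inv)

lemma phi_pow: "g \<in> carrier G \<Longrightarrow> phi (g [^] (m::nat)) = phi g [^]\<^bsub>F\<^esub> m"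
  by (induction m) (simp_all add: phi_one phi_mult)

section \<open>Commutation and commensurability of vertex elements\<close>

lemma comm_VG: "v \<in> V \<Longrightarrow> comm_group (VG v)"
proof -
  assume v: "v \<in> V"
  interpret group "VG v" using group_VG[OF v] .
  interpret Z: comm_group "Zn_group n" by (rule comm_group_Zn)
  have "Zn_group n \<cong> VG v" using iso_sym[OF VG_iso[OF v]] .
  then show ?thesis using Z.iso_imp_comm_group monoid_axioms by blast
qed

lemma vt_commute:
  assumes "v \<in> V" "c \<in> carrier (VG v)" "d \<in> carrier (VG v)"
  shows "vt v c \<star> vt v d = vt v d \<star> vt v c"
proof -
  interpret comm_group "VG v" using comm_VG[OF assms(1)] .
  show ?thesis using assms by (simp add: m_comm flip: vt_mult)
qed

lemma vt_pow:
  assumes v: "v \<in> V" and c: "c \<in> carrier (VG v)"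
  shows "vt v (c [^]\<^bsub>VG v\<^esub> (m::nat)) = vt v c [^]\<^bsub>F\<^esub> m"
proof -
  interpret group "VG v" using group_VG[OF v] .
  show ?thesis by (induction m) (simp_all add: vt_one vt_mult v c)
qed

text \<open>Edge and vertex groups have the same rank, so some positive power of each vertex element
  lies in the edge group.\<close>

lemma edge_commensurable:
  assumes e: "e \<in> E" and c: "c \<in> carrier (VG (src e))"
  obtains m :: nat and i where "0 < m" "i \<in> carrier (EG e)" "inc (rev_arc e) i = c [^]\<^bsub>VG (src e)\<^esub> m"
  using inj_hom_virtually_surj[OF EG_iso[OF e] VG_iso[OF tail_in_verts[OF e]] group_EG[OF e]
      group_VG[OF tail_in_verts[OF e]] inc_rev_hom[OF e] inc_rev_inj[OF e] c] .

text \<open>A vertex letter commutes with elements of its own vertex group, and a suitable power of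
  an element passes across an arc. The exponents needed for successive arcs multiply.\<close>

lemma path_commensurable:
  assumes "y \<in> Paths u w" "c \<in> carrier (VG u)"
  shows "\<exists>m::nat. \<exists>d\<in>carrier (VG w). 0 < m \<and> vt u c [^]\<^bsub>F\<^esub> m \<star> y = y \<star> vt w d"
  using assms
proof (induction arbitrary: c rule: path_induct)
  case one
  then have "w \<in> V" using assms path_classes_verts by blast
  then show ?case using one by (intro exI[of _ "1::nat"] bexI[of _ c]) auto
next
  case (vt v b y)
  then obtain m :: nat and d where md: "0 < m" "d \<in> carrier (VG w)" "vt v c [^]\<^bsub>F\<^esub> m \<star> y = y \<star> vt w d" by blast
  interpret group "VG v" using group_VG[OF vt(1)] .
  have w: "w \<in> V" and yc: "y \<in> carrier F" using vt path_classes_verts path_classes_closed by blast+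
  have "vt v c [^]\<^bsub>F\<^esub> m \<star> vt v b = vt v b \<star> vt v c [^]\<^bsub>F\<^esub> m"
    using vt_commute[of v "c [^]\<^bsub>VG v\<^esub> m" b] vt by (simp add: vt_pow)
  then have "vt v c [^]\<^bsub>F\<^esub> m \<star> (vt v b \<star> y) = vt v b \<star> (vt v c [^]\<^bsub>F\<^esub> m \<star> y)"
    using vt yc by (simp flip: F.m_assoc)
  also have "\<dots> = vt v b \<star> y \<star> vt w d" using md vt yc w by (simp add: F.m_assoc)
  finally show ?case using md by blast
next
  case (ed e y)
  have w: "w \<in> V" and yc: "y \<in> carrier F" using ed path_classes_verts path_classes_closed by blast+
  obtain k :: nat and i where ki: "0 < k" "i \<in> carrier (EG e)" "inc (rev_arc e) i = c [^]\<^bsub>VG (src e)\<^esub> k"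
    using edge_commensurable[OF ed(1,4)] .
  have ic: "inc e i \<in> carrier (VG (tgt e))" using inc_closed ed ki by blast
  obtain m :: nat and d where md: "0 < m" "d \<in> carrier (VG w)"
    "head_elt e i [^]\<^bsub>F\<^esub> m \<star> y = y \<star> vt w d" using ed(3)[OF ic] by blast
  let ?b = "vt (src e) c [^]\<^bsub>F\<^esub> k" and ?g = "head_elt e i"
  have bc: "?b \<in> carrier F" "?g \<in> carrier F" "ed e \<in> carrier F" using ed ic by auto
  have step: "?b \<star> ed e = ed e \<star> ?g"
    using ed_vt[OF ed(1) ki(2)] ed ki(3) by (simp add: vt_pow)
  have "vt (src e) c [^]\<^bsub>F\<^esub> (k * m) \<star> (ed e \<star> y) = ?b [^]\<^bsub>F\<^esub> m \<star> ed e \<star> y"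
    using ed yc by (simp add: F.nat_pow_pow F.m_assoc)
  also have "\<dots> = ed e \<star> (?g [^]\<^bsub>F\<^esub> m \<star> y)" unfolding F.intertwine_pow[OF bc step] using bc yc
    by (simp add: F.m_assoc)
  also have "\<dots> = ed e \<star> y \<star> vt w d" unfolding md(3) using bc yc w md by (simp add: F.m_assoc)
  finally show ?case using md ki by (intro exI[of _ "k * m"] bexI[of _ d]) auto
qed

section \<open>Stabilizers of vertices of the Bass-Serre tree\<close>

definition stab :: "'v \<Rightarrow> ('v, 'e, 'a) letter list set \<Rightarrow> 'g set" where
  "stab v p = {g \<in> carrier G. \<exists>c\<in>carrier (VG v). phi g \<star> p = p \<star> vt v c}"

lemma subgroup_vertex_subgroup: "v \<in> V \<Longrightarrow> subgroup (vertex_subgroup \<G> v) F"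
proof -
  assume v: "v \<in> V"
  interpret h: group_hom "VG v" F "vt v"
    using group_VG[OF v] vt_hom[OF v] F.is_group by (simp add: group_hom_def group_hom_axioms_def)
  have "vertex_subgroup \<G> v = vt v ` carrier (VG v)" by (auto simp: vertex_subgroup_def vt_def)
  then show ?thesis using h.img_is_subgroup by simp
qed

text \<open>A coset is fixed exactly when its representative is moved into the same coset. This
  replaces the action on sets by an equation in the path group.\<close>

lemma stabilizer_eq_stab:
  assumes p: "p \<in> Paths x v"
  shows "stabilizer G (\<lambda>g. tree_act \<G> (phi g)) (v, p <#\<^bsub>F\<^esub> vertex_subgroup \<G> v) = stab v p"
proof -
  have v: "v \<in> V" and pc: "p \<in> carrier F" using p path_classes_verts path_classes_closed by blast+
  let ?S = "vertex_subgroup \<G> v"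
  note S = subgroup_vertex_subgroup[OF v]
  have Seq: "?S = vt v ` carrier (VG v)" by (auto simp: vertex_subgroup_def vt_def)
  have "phi g <#\<^bsub>F\<^esub> (p <#\<^bsub>F\<^esub> ?S) = p <#\<^bsub>F\<^esub> ?S \<longleftrightarrow> (\<exists>c\<in>carrier (VG v). phi g \<star> p = p \<star> vt v c)"
    if g: "g \<in> carrier G" for g
  proof -
    have gp: "phi g \<star> p \<in> carrier F" using phi_carrier[OF g] pc by simp
    have assoc: "phi g <#\<^bsub>F\<^esub> (p <#\<^bsub>F\<^esub> ?S) = (phi g \<star> p) <#\<^bsub>F\<^esub> ?S"
      using F.lcos_m_assoc[OF subgroup.subset[OF S] phi_carrier[OF g] pc] .
    show ?thesis
    proof
      assume "phi g <#\<^bsub>F\<^esub> (p <#\<^bsub>F\<^esub> ?S) = p <#\<^bsub>F\<^esub> ?S"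
      moreover have "phi g \<star> p \<in> (phi g \<star> p) <#\<^bsub>F\<^esub> ?S" 
        using subgroup.one_closed[OF S] gp unfolding l_coset_def by force
      ultimately show "\<exists>c\<in>carrier (VG v). phi g \<star> p = p \<star> vt v c"
        unfolding assoc by (auto simp: l_coset_def Seq)
    next
      assume "\<exists>c\<in>carrier (VG v). phi g \<star> p = p \<star> vt v c"
      then obtain c where c: "c \<in> carrier (VG v)" "phi g \<star> p = p \<star> vt v c" by blast
      have vc: "vt v c \<in> carrier F" using c v by simp
      have "(p \<star> vt v c) <#\<^bsub>F\<^esub> ?S = p <#\<^bsub>F\<^esub> (vt v c <#\<^bsub>F\<^esub> ?S)"
        using F.lcos_m_assoc[OF subgroup.subset[OF S] pc vc] by simp
      also have "vt v c <#\<^bsub>F\<^esub> ?S = ?S" by (rule F.coset_join3[OF vc S]) (use c in \<open>auto simp: Seq\<close>)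
      finally show "phi g <#\<^bsub>F\<^esub> (p <#\<^bsub>F\<^esub> ?S) = p <#\<^bsub>F\<^esub> ?S" unfolding assoc c(2) .
    qed
  qed
  then show ?thesis by (auto simp: stabilizer_def stab_def tree_act_def)
qed

lemma subgroup_stab:
  assumes p: "p \<in> Paths x v"
  shows "subgroup (stab v p) G"
proof (rule G.subgroupI)
  have v: "v \<in> V" and pc: "p \<in> carrier F" using p path_classes_verts path_classes_closed by blast+
  interpret VG: group "VG v" using group_VG[OF v] .
  show "stab v p \<subseteq> carrier G" by (auto simp: stab_def)
  have "\<one> \<in> stab v p"
    unfolding stab_def using pc v by (auto intro!: bexI[of _ "\<one>\<^bsub>VG v\<^esub>"] simp: phi_one vt_one)
  then show "stab v p \<noteq> {}" by blast
  fix g assume g: "g \<in> stab v p"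
  then obtain c where c: "c \<in> carrier (VG v)" "phi g \<star> p = p \<star> vt v c" and gc: "g \<in> carrier G"
    by (auto simp: stab_def)
  note cl = phi_carrier[OF gc] pc vt_closed[OF v c(1)]
  have "p = inv\<^bsub>F\<^esub> phi g \<star> (phi g \<star> p)" using cl by (simp flip: F.m_assoc)
  then have "p \<star> inv\<^bsub>F\<^esub> vt v c = inv\<^bsub>F\<^esub> phi g \<star> (p \<star> vt v c) \<star> inv\<^bsub>F\<^esub> vt v c" using c(2) by simp
  also have "\<dots> = inv\<^bsub>F\<^esub> phi g \<star> p" using cl by (simp add: F.m_assoc)
  finally have "phi (inv g) \<star> p = p \<star> vt v (inv\<^bsub>VG v\<^esub> c)" using c v gc by (simp add: phi_inv vt_inv)
  then show "inv g \<in> stab v p" unfolding stab_def using gc c by auto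
  fix h assume h: "h \<in> stab v p"
  then obtain d where d: "d \<in> carrier (VG v)" "phi h \<star> p = p \<star> vt v d" and hc: "h \<in> carrier G"
    by (auto simp: stab_def)
  note cl' = phi_carrier[OF hc] vt_closed[OF v d(1)]
  have "phi (g \<otimes> h) \<star> p = phi g \<star> (phi h \<star> p)" using cl cl' gc hc by (simp add: phi_mult F.m_assoc)
  also have "\<dots> = phi g \<star> p \<star> vt v d" unfolding d(2) using cl cl' by (simp add: F.m_assoc)
  also have "\<dots> = p \<star> vt v (c \<otimes>\<^bsub>VG v\<^esub> d)" unfolding c(2) using cl cl' c d v
    by (simp add: vt_mult F.m_assoc)
  finally show "g \<otimes> h \<in> stab v p" unfolding stab_def using gc hc c d by auto
qed

text \<open>Some power of \<open>c\<close> is conjugated by \<open>g\<close> into the stabilizer,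
  and a further power of the result lies in \<open>A\<close> by finite index.\<close>

lemma commensurated_stab:
  assumes p: "p \<in> Paths x v" and A: "finite_index_subgroup A (G\<lparr>carrier := stab v p\<rparr>)"
    and g: "g \<in> carrier G" and c: "c \<in> A"
  shows "\<exists>m::nat. 0 < m \<and> g \<otimes> c [^] m \<otimes> inv g \<in> A"
proof -
  have v: "v \<in> V" and pc: "p \<in> carrier F" using p path_classes_verts path_classes_closed by blast+
  have S: "group (G\<lparr>carrier := stab v p\<rparr>)" using G.subgroup_imp_group[OF subgroup_stab[OF p]] .
  have "c \<in> stab v p" using A c subgroup.mem_carrier by (fastforce simp: finite_index_subgroup_def)
  then obtain b where b: "b \<in> carrier (VG v)" "phi c \<star> p = p \<star> vt v b" and cc: "c \<in> carrier G"
    by (auto simp: stab_def)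
  \<comment> \<open>The inverse of \<open>g\<close> seen as a closed path at \<open>v\<close>;
    moving a power of \<open>b\<close> along it amounts to conjugating a power of \<open>c\<close>
    by \<open>g\<close>.\<close>
  let ?y = "inv\<^bsub>F\<^esub> p \<star> inv\<^bsub>F\<^esub> phi g \<star> p"
  have y: "?y \<in> Paths v v"
    by (intro path_mult[OF path_mult[OF path_inv[OF p] path_inv[OF phi_closed[OF g]]] p])
  obtain m :: nat and d where md: "0 < m" "d \<in> carrier (VG v)" "vt v b [^]\<^bsub>F\<^esub> m \<star> ?y = ?y \<star> vt v d"
    using path_commensurable[OF y b(1)] by blast
  note cl = phi_carrier[OF g] phi_carrier[OF cc] pc vt_closed[OF v b(1)] vt_closed[OF v md(2)]
  have py: "p \<star> ?y = inv\<^bsub>F\<^esub> phi g \<star> p" using cl by (simp flip: F.m_assoc)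
  let ?h = "g \<otimes> c [^] m \<otimes> inv g"
  have hc: "?h \<in> carrier G" using g cc by simp
  have "phi ?h \<star> p = phi g \<star> phi c [^]\<^bsub>F\<^esub> m \<star> (inv\<^bsub>F\<^esub> phi g \<star> p)"
    using g cc cl by (simp add: phi_mult phi_pow phi_inv F.m_assoc)
  also have "\<dots> = phi g \<star> (phi c [^]\<^bsub>F\<^esub> m \<star> p) \<star> ?y"
    unfolding py[symmetric] using cl by (simp add: F.m_assoc)
  also have "\<dots> = phi g \<star> p \<star> (vt v b [^]\<^bsub>F\<^esub> m \<star> ?y)" unfolding F.intertwine_pow[OF cl(2,4,3) b(2)]
    using cl by (simp add: F.m_assoc)
  also have "\<dots> = phi g \<star> (p \<star> ?y) \<star> vt v d" unfolding md(3) using cl by (simp add: F.m_assoc)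
  also have "\<dots> = p \<star> vt v d" unfolding py using cl by (simp flip: F.m_assoc)
  finally have "?h \<in> stab v p" unfolding stab_def using hc md by blast
  then obtain k :: nat where k: "0 < k" "?h [^]\<^bsub>G\<lparr>carrier := stab v p\<rparr>\<^esub> k \<in> A"
    using finite_index_power[OF S A] by auto
  have "?h [^]\<^bsub>G\<lparr>carrier := stab v p\<rparr>\<^esub> k = ?h [^] k" by (simp add: G.nat_pow_consistent[symmetric])
  also have "\<dots> = g \<otimes> c [^] (m * k) \<otimes> inv g" using g cc by (simp add: G.conj_pow G.nat_pow_pow)
  finally show ?thesis using k md by (intro exI[of _ "m * k"]) simp
qed

end

section \<open>The affine representation\<close>

text \<open>The pair \<open>(t, q)\<close> stands for the affine map sending \<open>u\<close> to
  \<open>t + q u\<close>, and the product is composition of maps. No closure of \<open>Q\<close> is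
  built in; \<open>group_affine_group\<close> lists what is required.\<close>

definition affine_group :: "nat \<Rightarrow> rat mat set \<Rightarrow> (rat vec \<times> rat mat) monoid" where
  "affine_group n Q =
     \<lparr>carrier = carrier_vec n \<times> Q,
      monoid.mult = (\<lambda>(t, q) (s, r). (t + q *\<^sub>v s, q * r)),
      one = (0\<^sub>v n, 1\<^sub>m n)\<rparr>"

lemma affine_group_simps [simp]:
  "carrier (affine_group n Q) = carrier_vec n \<times> Q"
  "(t, q) \<otimes>\<^bsub>affine_group n Q\<^esub> (s, r) = (t + q *\<^sub>v s, q * r)"
  "\<one>\<^bsub>affine_group n Q\<^esub> = (0\<^sub>v n, 1\<^sub>m n)"
  by (simp_all add: affine_group_def)

lemma mult_zero_vec_right: "(q :: rat mat) \<in> carrier_mat n n \<Longrightarrow> q *\<^sub>v 0\<^sub>v n = 0\<^sub>v n"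
  by (intro eq_vecI) auto

lemma group_affine_group:
  assumes Q: "Q \<subseteq> carrier_mat n n" and one: "1\<^sub>m n \<in> Q"
    and mult: "\<And>q r. q \<in> Q \<Longrightarrow> r \<in> Q \<Longrightarrow> q * r \<in> Q"
    and inv: "\<And>q. q \<in> Q \<Longrightarrow> \<exists>r\<in>Q. r * q = 1\<^sub>m n"
  shows "group (affine_group n Q)"
proof (rule groupI)
  fix f g assume "f \<in> carrier (affine_group n Q)" "g \<in> carrier (affine_group n Q)"
  then show "f \<otimes>\<^bsub>affine_group n Q\<^esub> g \<in> carrier (affine_group n Q)"
    using Q mult by (cases f; cases g) auto
next
  show "\<one>\<^bsub>affine_group n Q\<^esub> \<in> carrier (affine_group n Q)" using one by simp
next
  fix f g h assume "f \<in> carrier (affine_group n Q)" "g \<in> carrier (affine_group n Q)" "h \<in> carrier (affine_group n Q)"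
  then obtain t q s r u w where *: "f = (t, q)" "g = (s, r)" "h = (u, w)"
    "t \<in> carrier_vec n" "s \<in> carrier_vec n" "u \<in> carrier_vec n" "q \<in> carrier_mat n n" "r \<in> carrier_mat n n" "w \<in> carrier_mat n n"
    using Q by (cases f; cases g; cases h) auto
  have "t + q *\<^sub>v s + q * r *\<^sub>v u = t + (q *\<^sub>v s + q *\<^sub>v (r *\<^sub>v u))"
    using * assoc_mult_mat_vec[OF *(7,8,6)] by (simp add: assoc_add_vec[of _ n])
  also have "q *\<^sub>v s + q *\<^sub>v (r *\<^sub>v u) = q *\<^sub>v (s + r *\<^sub>v u)"
    using * mult_add_distrib_mat_vec[OF *(7,5), of "r *\<^sub>v u"] by simp
  finally show "f \<otimes>\<^bsub>affine_group n Q\<^esub> g \<otimes>\<^bsub>affine_group n Q\<^esub> h = f \<otimes>\<^bsub>affine_group n Q\<^esub> (g \<otimes>\<^bsub>affine_group n Q\<^esub> h)"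
    using * assoc_mult_mat[OF *(7,8,9)] by simp
next
  fix f assume "f \<in> carrier (affine_group n Q)"
  then obtain t q where *: "f = (t, q)" "t \<in> carrier_vec n" "q \<in> Q" by (cases f) auto
  have "q \<in> carrier_mat n n" using * Q by blast
  then show "\<one>\<^bsub>affine_group n Q\<^esub> \<otimes>\<^bsub>affine_group n Q\<^esub> f = f" using * by simp
  obtain r where r: "r \<in> Q" "r * q = 1\<^sub>m n" using inv[OF *(3)] by blast
  have rc: "r *\<^sub>v t \<in> carrier_vec n" using r Q * by auto
  then have "(- (r *\<^sub>v t), r) \<otimes>\<^bsub>affine_group n Q\<^esub> f = \<one>\<^bsub>affine_group n Q\<^esub>" using * r by simp
  then show "\<exists>g\<in>carrier (affine_group n Q). g \<otimes>\<^bsub>affine_group n Q\<^esub> f = \<one>\<^bsub>affine_group n Q\<^esub>"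
    using rc r by (intro bexI[of _ "(- (r *\<^sub>v t), r)"]) auto
qed

locale gbs_basis = gbs \<G> G n x phi + commensurated_basis G A n a
  for \<G> :: "('v, 'e, 'a, 'b) graph_of_groups" and G :: "'g monoid" (structure) and n x phi A a +
  fixes v :: 'v and p :: "('v, 'e, 'a) letter list set"
  assumes p: "p \<in> Paths x v"
    and A_index: "finite_index_subgroup A (G\<lparr>carrier := stab v p\<rparr>)"
    and fin_Q: "finite (mod_mat ` carrier G)"
begin

definition Q :: "rat mat set" where
  "Q = mod_mat ` carrier G"

lemma Q_carrier: "q \<in> Q \<Longrightarrow> q \<in> carrier_mat n n"
  by (auto simp: Q_def)

lemma Q_one: "1\<^sub>m n \<in> Q"
  unfolding Q_def using mod_mat_one by (metis image_eqI G.one_closed)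

lemma Q_mult: "q \<in> Q \<Longrightarrow> r \<in> Q \<Longrightarrow> q * r \<in> Q"
  unfolding Q_def using mod_mat_mult by (auto simp: image_iff) (metis G.m_closed)

lemma Q_inv:
  assumes "q \<in> Q" obtains r where "r \<in> Q" "r * q = 1\<^sub>m n" "q * r = 1\<^sub>m n"
proof -
  obtain g where g: "g \<in> carrier G" "q = mod_mat g" using assms by (auto simp: Q_def)
  show thesis
  proof (rule that[of "mod_mat (inv g)"])
    show "mod_mat (inv g) \<in> Q" using g by (auto simp: Q_def)
    show "mod_mat (inv g) * q = 1\<^sub>m n" "q * mod_mat (inv g) = 1\<^sub>m n"
      using g by (simp_all add: mod_mat_one flip: mod_mat_mult)
  qed
qed

abbreviation "P \<equiv> affine_group n Q"

lemma group_P: "group P"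
proof (rule group_affine_group)
  show "Q \<subseteq> carrier_mat n n" using Q_carrier by blast
  show "\<exists>r\<in>Q. r * q = 1\<^sub>m n" if "q \<in> Q" for q using Q_inv[OF that] by blast
qed (fact Q_one, fact Q_mult)

section \<open>Elements with a power in the base subgroup\<close>

lemma D_root:
  assumes "g \<in> carrier G" "0 < (m::nat)" "g [^] m \<in> D"
  shows "g \<in> D"
proof -
  obtain k :: nat where k: "0 < k" "(g [^] m) [^] k \<in> A" using assms(3) by (auto simp: D_def)
  then have "g [^] (m * k) \<in> A" using assms(1) by (simp add: G.nat_pow_pow)
  then show ?thesis unfolding D_def using assms k by (intro CollectI conjI exI[of _ "m * k"]) auto
qed

lemma stab_D:
  assumes "g \<in> stab v p" shows "g \<in> D"
proof -
  have S: "group (G\<lparr>carrier := stab v p\<rparr>)" using G.subgroup_imp_group[OF subgroup_stab[OF p]] .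
  obtain k :: nat where "0 < k" "g [^]\<^bsub>G\<lparr>carrier := stab v p\<rparr>\<^esub> k \<in> A"
    using finite_index_power[OF S A_index] assms by auto
  moreover have "g [^]\<^bsub>G\<lparr>carrier := stab v p\<rparr>\<^esub> k = g [^] k"
    by (simp add: G.nat_pow_consistent[symmetric])
  ultimately show ?thesis using assms unfolding D_def stab_def by auto
qed

lemma A_stab: "c \<in> A \<Longrightarrow> c \<in> stab v p"
  using A_index subgroup.mem_carrier by (fastforce simp: finite_index_subgroup_def)

lemma v: "v \<in> V" and p_carrier: "p \<in> carrier F"
  using p path_classes_verts path_classes_closed by blast+

section \<open>Vertex groups as subgroups of G with rational coordinates\<close>

definition base_path :: "'v \<Rightarrow> ('v, 'e, 'a) letter list set" where
  "base_path w = (if w = x then \<one>\<^bsub>F\<^esub> else (SOME y. y \<in> Paths x w))"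

lemma base_path_path: "w \<in> V \<Longrightarrow> base_path w \<in> Paths x w"
  unfolding base_path_def using x path_exists[of x w] by (auto intro: someI)

lemma base_path_closed: "w \<in> V \<Longrightarrow> base_path w \<in> carrier F"
  using base_path_path path_classes_closed by blast

definition conj_path :: "'v \<Rightarrow> 'a \<Rightarrow> ('v, 'e, 'a) letter list set" where
  "conj_path w c = base_path w \<star> vt w c \<star> inv\<^bsub>F\<^esub> base_path w"

text \<open>This turns the vertex group at \<open>w\<close> into the stabilizer of the tree vertex
  given by the coset of \<open>base_path w\<close>.\<close>

definition lift :: "'v \<Rightarrow> 'a \<Rightarrow> 'g" where
  "lift w c = psi (conj_path w c)"

lemma conj_path_path: "w \<in> V \<Longrightarrow> c \<in> carrier (VG w) \<Longrightarrow> conj_path w c \<in> Paths x x"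
  unfolding conj_path_def
    by (intro path_mult[OF path_mult[OF base_path_path path_vt] path_inv[OF base_path_path]])

lemma conj_path_base_path: "w \<in> V \<Longrightarrow> c \<in> carrier (VG w) \<Longrightarrow> conj_path w c \<star> base_path w = base_path w \<star> vt w c"
  by (simp add: conj_path_def base_path_closed F.m_assoc)

lemma conj_path_unique:
  assumes "w \<in> V" "c \<in> carrier (VG w)" "y \<in> carrier F" "y \<star> base_path w = base_path w \<star> vt w c"
  shows "conj_path w c = y"
  using assms by (simp add: conj_path_def base_path_closed F.m_assoc flip: assms(4))

lemma conj_path_mult:
  assumes "w \<in> V" "c \<in> carrier (VG w)" "d \<in> carrier (VG w)"
  shows "conj_path w (c \<otimes>\<^bsub>VG w\<^esub> d) = conj_path w c \<star> conj_path w d"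
proof (rule conj_path_unique)
  interpret VG: group "VG w" using group_VG[OF assms(1)] .
  note cl = base_path_closed[OF assms(1)] path_classes_closed[OF conj_path_path[OF assms(1,2)]]
    path_classes_closed[OF conj_path_path[OF assms(1,3)]] vt_closed[OF assms(1,2)] vt_closed[OF assms(1,3)]
  show "conj_path w c \<star> conj_path w d \<star> base_path w = base_path w \<star> vt w (c \<otimes>\<^bsub>VG w\<^esub> d)"
  proof -
    have "conj_path w c \<star> conj_path w d \<star> base_path w = conj_path w c \<star> base_path w \<star> vt w d"
      using cl conj_path_base_path[OF assms(1,3)] by (simp add: F.m_assoc)
    then show ?thesis using cl conj_path_base_path[OF assms(1,2)] vt_mult[OF assms]
      by (simp add: F.m_assoc)
  qed
  show "c \<otimes>\<^bsub>VG w\<^esub> d \<in> carrier (VG w)" using assms by simp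
  show "conj_path w c \<star> conj_path w d \<in> carrier F" using cl by simp
qed (rule assms(1))

lemma lift_closed: "w \<in> V \<Longrightarrow> c \<in> carrier (VG w) \<Longrightarrow> lift w c \<in> carrier G"
  by (simp add: lift_def psi_closed conj_path_path)

lemma lift_mult:
  "w \<in> V \<Longrightarrow> c \<in> carrier (VG w) \<Longrightarrow> d \<in> carrier (VG w) \<Longrightarrow> lift w (c \<otimes>\<^bsub>VG w\<^esub> d) = lift w c \<otimes> lift w d"
  by (simp add: lift_def conj_path_mult psi_mult conj_path_path)

lemma phi_lift: "w \<in> V \<Longrightarrow> c \<in> carrier (VG w) \<Longrightarrow> phi (lift w c) = conj_path w c"
  by (simp add: lift_def phi_psi conj_path_path)

text \<open>Along a path from \<open>w\<close> to \<open>v\<close> a power of \<open>c\<close>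
  becomes an element of the vertex group at \<open>v\<close>. The same power of the lift then fixes
  the tree vertex of \<open>p\<close>, and \<open>A\<close> has finite index in that
  stabilizer.\<close>

lemma lift_D:
  assumes w: "w \<in> V" and c: "c \<in> carrier (VG w)"
  shows "lift w c \<in> D"
proof -
  let ?y = "inv\<^bsub>F\<^esub> base_path w \<star> p" and ?L = "conj_path w c"
  have y: "?y \<in> Paths w v" by (rule path_mult[OF path_inv[OF base_path_path[OF w]] p])
  obtain m :: nat and d where md: "0 < m" "d \<in> carrier (VG v)" "vt w c [^]\<^bsub>F\<^esub> m \<star> ?y = ?y \<star> vt v d"
    using path_commensurable[OF y c] by blast
  note cl = base_path_closed[OF w] p_carrier vt_closed[OF w c] vt_closed[OF v md(2)] path_classes_closed[OF conj_path_path[OF w c]]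
  have py: "base_path w \<star> ?y = p" using cl by (simp flip: F.m_assoc)
  have "?L [^]\<^bsub>F\<^esub> m \<star> p = ?L [^]\<^bsub>F\<^esub> m \<star> base_path w \<star> ?y" using cl by (simp add: F.m_assoc py)
  also have "\<dots> = base_path w \<star> (vt w c [^]\<^bsub>F\<^esub> m \<star> ?y)"
    unfolding F.intertwine_pow[OF cl(5,3,1) conj_path_base_path[OF w c]] using cl
      by (simp add: F.m_assoc)
  also have "\<dots> = base_path w \<star> ?y \<star> vt v d" unfolding md(3) using cl by (simp add: F.m_assoc)
  finally have "phi (lift w c [^] m) \<star> p = p \<star> vt v d"
    unfolding py using w c by (simp add: phi_pow lift_closed phi_lift)
  then have "lift w c [^] m \<in> stab v p" using md w c lift_closed unfolding stab_def by blast
  then show ?thesis using D_root[OF lift_closed[OF w c] md(1)] stab_D by blast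
qed

definition vt_coord :: "'v \<Rightarrow> 'a \<Rightarrow> rat vec" where
  "vt_coord w c = crd (lift w c)"

lemma vt_coord_carrier [simp]: "vt_coord w c \<in> carrier_vec n" "dim_vec (vt_coord w c) = n"
  by (simp_all add: vt_coord_def)

lemma vt_coord_mult:
  assumes "w \<in> V" "c \<in> carrier (VG w)" "d \<in> carrier (VG w)"
  shows "vt_coord w (c \<otimes>\<^bsub>VG w\<^esub> d) = vt_coord w c + vt_coord w d"
proof -
  interpret comm_group "VG w" using comm_VG[OF assms(1)] .
  have "lift w c \<otimes> lift w d = lift w d \<otimes> lift w c"
    using lift_mult[OF assms] lift_mult[OF assms(1,3,2)] m_comm[OF assms(2,3)] by simp
  then show ?thesis using crd_mult(2)[OF lift_D lift_D] assms by (simp add: vt_coord_def lift_mult)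
qed

lemma vt_coord_hom: "w \<in> V \<Longrightarrow> vt_coord w \<in> hom (VG w) (vec_group n)"
  by (rule homI) (auto simp: vt_coord_mult)

text \<open>The converse transport of \<open>lift_D\<close>: a power of the basis element
  \<open>a j\<close>, carried from \<open>v\<close> to \<open>w\<close>, is itself the lift of an
  element of the vertex group at \<open>w\<close>.\<close>

lemma vt_coord_virtually_surj:
  assumes w: "w \<in> V" and j: "j < n"
  shows "\<exists>m::nat. \<exists>c\<in>carrier (VG w). 0 < m \<and> vt_coord w c = of_nat m \<cdot>\<^sub>v unit_vec n j"
proof -
  have aA: "a j \<in> A" "a j \<in> carrier G" using a_in_A[OF j] a_carrier[OF j] by auto
  obtain b where b: "b \<in> carrier (VG v)" "phi (a j) \<star> p = p \<star> vt v b"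
    using A_stab[OF aA(1)] by (auto simp: stab_def)
  let ?y = "inv\<^bsub>F\<^esub> p \<star> base_path w"
  have y: "?y \<in> Paths v w" by (rule path_mult[OF path_inv[OF p] base_path_path[OF w]])
  obtain m :: nat and d where md: "0 < m" "d \<in> carrier (VG w)" "vt v b [^]\<^bsub>F\<^esub> m \<star> ?y = ?y \<star> vt w d"
    using path_commensurable[OF y b(1)] by blast
  note cl = base_path_closed[OF w] p_carrier vt_closed[OF v b(1)] vt_closed[OF w md(2)] phi_carrier[OF aA(2)]
  have py: "p \<star> ?y = base_path w" using cl by (simp flip: F.m_assoc)
  have "phi (a j) [^]\<^bsub>F\<^esub> m \<star> base_path w = phi (a j) [^]\<^bsub>F\<^esub> m \<star> p \<star> ?y" using cl
    by (simp add: F.m_assoc py)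
  also have "\<dots> = p \<star> (vt v b [^]\<^bsub>F\<^esub> m \<star> ?y)"
    unfolding F.intertwine_pow[OF cl(5,3,2) b(2)] using cl by (simp add: F.m_assoc)
  also have "\<dots> = p \<star> ?y \<star> vt w d" unfolding md(3) using cl by (simp add: F.m_assoc)
  finally have "phi (a j [^] m) \<star> base_path w = base_path w \<star> vt w d" unfolding py using aA
    by (simp add: phi_pow)
  then have "conj_path w d = phi (a j [^] m)"
    using conj_path_unique[OF w md(2) phi_carrier] aA by simp
  then have "lift w d = a j [^] m" using aA by (simp add: lift_def psi_phi)
  then have "vt_coord w d = of_nat m \<cdot>\<^sub>v unit_vec n j"
    using crd_pow(2)[OF A_subset_D[OF aA(1)]] crd_a[OF j] by (simp add: vt_coord_def)
  with md show ?thesis by blast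
qed

lemma Zn_iso_VG:
  assumes "w \<in> V" obtains g where "g \<in> iso (Zn_group n) (VG w)"
proof -
  interpret group "VG w" using group_VG[OF assms] .
  show thesis using iso_sym[OF VG_iso[OF assms]] that by (auto simp: is_iso_def)
qed

text \<open>The image spans Q^n and the source has rank \<open>n\<close>. Since the coordinates
  factor through the path group, injectivity here also yields that the vertex groups embed in
  it.\<close>

lemma vt_coord_inj:
  assumes w: "w \<in> V" shows "inj_on (vt_coord w) (carrier (VG w))"
proof -
  obtain g where g: "g \<in> iso (Zn_group n) (VG w)" using Zn_iso_VG[OF w] .
  then have gh: "g \<in> hom (Zn_group n) (VG w)" and im: "carrier (VG w) = g ` Zn n"
    by (auto simp: iso_def bij_betw_def)
  have "inj_on (vt_coord w \<circ> g) (Zn n)"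
  proof (rule Zn_hom_inj)
    show "vt_coord w \<circ> g \<in> hom (Zn_group n) (vec_group n)"
      by (rule hom_compose[OF gh vt_coord_hom[OF w]])
    fix j assume "j < n"
    from vt_coord_virtually_surj[OF w this] show "\<exists>m::nat. \<exists>z\<in>Zn n. 0 < m \<and> (vt_coord w \<circ> g) z = of_nat m \<cdot>\<^sub>v unit_vec n j"
      by (auto simp: im)
  qed
  then show ?thesis unfolding im by (rule inj_on_imageI)
qed

section \<open>Arcs as loops and the homomorphism to the affine group\<close>

definition arc_loop :: "'e \<Rightarrow> 'g" where
  "arc_loop e = psi (base_path (src e) \<star> ed e \<star> inv\<^bsub>F\<^esub> base_path (tgt e))"

definition arc_mat :: "'e \<Rightarrow> rat mat" where
  "arc_mat e = mod_mat (arc_loop e)"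

lemma arc_loop_path: "e \<in> E \<Longrightarrow> base_path (src e) \<star> ed e \<star> inv\<^bsub>F\<^esub> base_path (tgt e) \<in> Paths x x"
  by (intro path_mult[OF path_mult[OF base_path_path path_ed] path_inv[OF base_path_path]]) auto

lemma arc_loop_closed: "e \<in> E \<Longrightarrow> arc_loop e \<in> carrier G"
  by (simp add: arc_loop_def psi_closed arc_loop_path)

lemma arc_mat_Q: "e \<in> E \<Longrightarrow> arc_mat e \<in> Q"
  by (simp add: arc_mat_def Q_def arc_loop_closed)

lemma arc_mat_rev:
  assumes e: "e \<in> E" shows "arc_mat e * arc_mat (rev_arc e) = 1\<^sub>m n"
proof -
  have "inv\<^bsub>F\<^esub> (base_path (src e) \<star> ed e \<star> inv\<^bsub>F\<^esub> base_path (tgt e)) = base_path (tgt e) \<star> ed (rev_arc e) \<star> inv\<^bsub>F\<^esub> base_path (src e)"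
    using e base_path_closed by (simp add: F.inv_mult_group ed_rev F.m_assoc)
  then have "arc_loop (rev_arc e) = inv arc_loop e" using e psi_inv[OF arc_loop_path[OF e]]
    by (simp add: arc_loop_def)
  then show ?thesis using arc_loop_closed[OF e]
    by (simp add: arc_mat_def mod_mat_one flip: mod_mat_mult)
qed

text \<open>Closing the edge relation up to loops at \<open>x\<close>, the lift at the tail is the
  conjugate by \<open>arc_loop e\<close> of the lift at the head; conjugation acts on coordinates by
  the modular matrix.\<close>

lemma arc_mat_io:
  assumes e: "e \<in> E" and i: "i \<in> carrier (EG e)"
  shows "vt_coord (src e) (inc (rev_arc e) i) = arc_mat e *\<^sub>v vt_coord (tgt e) (inc e i)"
proof -
  have V: "src e \<in> V" "tgt e \<in> V" using e by auto
  note ic = inc_closed[OF e i] inc_rev_closed[OF e i]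
  let ?s = "base_path (src e)" and ?t = "base_path (tgt e)" and ?c = "head_elt e i"
  note cl = base_path_closed[OF V(1)] base_path_closed[OF V(2)] ed_closed[OF e] vt_closed[OF V(2) ic(1)] vt_closed[OF V(1) ic(2)]
  have "conj_path (src e) (inc (rev_arc e) i) = phi (arc_loop e \<otimes> lift (tgt e) (inc e i) \<otimes> inv arc_loop e)"
  proof (rule conj_path_unique[OF V(1) ic(2)])
    show "phi (arc_loop e \<otimes> lift (tgt e) (inc e i) \<otimes> inv arc_loop e) \<in> carrier F"
      using e V ic by (intro phi_carrier) (simp add: arc_loop_closed lift_closed)
    have "phi (arc_loop e \<otimes> lift (tgt e) (inc e i) \<otimes> inv arc_loop e) =
        ?s \<star> ed e \<star> inv\<^bsub>F\<^esub> ?t \<star> (?t \<star> ?c \<star> inv\<^bsub>F\<^esub> ?t) \<star> inv\<^bsub>F\<^esub> (?s \<star> ed e \<star> inv\<^bsub>F\<^esub> ?t)"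
      using e V ic by (simp add: arc_loop_closed lift_closed phi_mult phi_inv phi_lift)
        (simp add: arc_loop_def phi_psi arc_loop_path conj_path_def)
    also have "\<dots> = ?s \<star> ed e \<star> (inv\<^bsub>F\<^esub> ?t \<star> ?t) \<star> ?c \<star> (inv\<^bsub>F\<^esub> ?t \<star> ?t) \<star> inv\<^bsub>F\<^esub> ed e \<star> inv\<^bsub>F\<^esub> ?s"
      using cl by (simp only: F.inv_mult_group F.inv_inv F.m_assoc F.m_closed F.inv_closed)
    also have "\<dots> = ?s \<star> (ed e \<star> ?c) \<star> inv\<^bsub>F\<^esub> ed e \<star> inv\<^bsub>F\<^esub> ?s" using cl by (simp add: F.m_assoc)
    also have "\<dots> = ?s \<star> tail_elt e i \<star> inv\<^bsub>F\<^esub> ?s"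
      unfolding ed_vt[OF e i] using cl by (simp add: F.m_assoc)
    finally show "phi (arc_loop e \<otimes> lift (tgt e) (inc e i) \<otimes> inv arc_loop e) \<star> ?s = ?s \<star> tail_elt e i"
      using cl by (simp add: F.m_assoc)
  qed
  then have "lift (src e) (inc (rev_arc e) i) = arc_loop e \<otimes> lift (tgt e) (inc e i) \<otimes> inv arc_loop e"
    using e V ic by (simp add: lift_def[of "src e"] psi_phi arc_loop_closed lift_closed)
  then show ?thesis using crd_conj[OF arc_loop_closed[OF e] lift_D[OF V(2) ic(1)]]
    by (simp add: vt_coord_def arc_mat_def)
qed

text \<open>The vertex groups act on the rational span of \<open>A\<close> by translations, the arcs by the
  monodromy of the corresponding loops.\<close>

lemma \<delta>_exists:
  "\<exists>h. h \<in> hom F P \<and> (\<forall>w\<in>V. \<forall>c\<in>carrier (VG w). h (vt w c) = (vt_coord w c, 1\<^sub>m n)) \<and> (\<forall>e\<in>E. h (ed e) = (0\<^sub>v n, arc_mat e))"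
proof -
  interpret P: group P by (rule group_P)
  let ?d = "\<lambda>s. case s of Vtx w c \<Rightarrow> (vt_coord w c, 1\<^sub>m n) | Edg e \<Rightarrow> (0\<^sub>v n, arc_mat e)"
  have d: "?d \<in> letters \<G> \<rightarrow> carrier P" using arc_mat_Q Q_one by (auto simp: letters_def)
  have one_mult: "1\<^sub>m n * q = q" "q * 1\<^sub>m n = q" if "q \<in> Q" for q using Q_carrier[OF that] by auto
  have R: "word_prod P ?d l = word_prod P ?d r" if "(l, r) \<in> relations \<G>" for l r
    using that
  proof (cases rule: relations_cases)
    case (1 w c b)
    then show ?thesis using Q_one by (simp add: vt_coord_mult)
  next
    case (2 w)
    interpret VG: group "VG w" using group_VG[OF 2(1)] .
    have "vt_coord w \<one>\<^bsub>VG w\<^esub> = 0\<^sub>v n"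
      using hom_one[OF vt_coord_hom[OF 2(1)] VG.is_group R.is_group] by simp
    then show ?thesis using 2 by simp
  next
    case (3 e)
    have "arc_mat e \<in> carrier_mat n n" "arc_mat (rev_arc e) \<in> carrier_mat n n"
      using 3 arc_mat_Q Q_carrier by auto
    then show ?thesis using 3 arc_mat_rev by (simp add: mult_zero_vec_right)
  next
    \<comment> \<open>The translation parts agree by \<open>arc_mat_io\<close>, and the linear parts
      by \<open>arc_mat_rev\<close>.\<close>
    case (4 e i)
    have q: "arc_mat e \<in> carrier_mat n n" "arc_mat (rev_arc e) \<in> carrier_mat n n"
      using 4 arc_mat_Q Q_carrier by auto
    have "arc_mat e *\<^sub>v vt_coord (tgt e) (inc e i) \<in> carrier_vec n" using q by auto
    then show ?thesis using 4 arc_mat_rev[OF 4(1)] arc_mat_io[OF 4(1,2)] q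
      by (simp add: mult_zero_vec_right)
  qed
  obtain h where h: "h \<in> hom (presented (letters \<G>) (relations \<G>)) P"
    "\<And>w. w \<in> lists (letters \<G>) \<Longrightarrow> h (cls (letters \<G>) (relations \<G>) w) = word_prod P ?d w"
    using presented_hom_exists[OF P.monoid_axioms d R] by blast
  have "h (vt w c) = (vt_coord w c, 1\<^sub>m n)" if "w \<in> V" "c \<in> carrier (VG w)" for w c
    using h(2)[of "[Vtx w c]"] that by (simp add: vt_def word_class_eq_cls mult_zero_vec_right)
  moreover have "h (ed e) = (0\<^sub>v n, arc_mat e)" if "e \<in> E" for e
    using h(2)[of "[Edg e]"] that Q_carrier[OF arc_mat_Q[OF that]]
    by (simp add: ed_def word_class_eq_cls mult_zero_vec_right)
  ultimately show ?thesis using h(1) unfolding path_group_def by blast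
qed

definition \<delta> :: "('v, 'e, 'a) letter list set \<Rightarrow> rat vec \<times> rat mat" where
  "\<delta> = (SOME h. h \<in> hom F P \<and> (\<forall>w\<in>V. \<forall>c\<in>carrier (VG w). h (vt w c) = (vt_coord w c, 1\<^sub>m n)) \<and> (\<forall>e\<in>E. h (ed e) = (0\<^sub>v n, arc_mat e)))"

lemma \<delta>_hom: "\<delta> \<in> hom F P"
  and \<delta>_vt: "w \<in> V \<Longrightarrow> c \<in> carrier (VG w) \<Longrightarrow> \<delta> (vt w c) = (vt_coord w c, 1\<^sub>m n)"
  and \<delta>_ed: "e \<in> E \<Longrightarrow> \<delta> (ed e) = (0\<^sub>v n, arc_mat e)"
  using someI_ex[OF \<delta>_exists] unfolding \<delta>_def[symmetric] by blast+

lemma vt_coord_eq_iff: "w \<in> V \<Longrightarrow> c \<in> carrier (VG w) \<Longrightarrow> d \<in> carrier (VG w) \<Longrightarrow> vt_coord w c = vt_coord w d \<longleftrightarrow> c = d"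
  using vt_coord_inj by (auto dest: inj_onD)

lemma vt_coord_one: "w \<in> V \<Longrightarrow> vt_coord w \<one>\<^bsub>VG w\<^esub> = 0\<^sub>v n"
  using hom_one[OF vt_coord_hom group_VG R.is_group] by simp

sublocale C: kernel_cover \<G> P \<delta> x
proof (intro kernel_cover.intro kernel_cover_axioms.intro)
  show "graph_groups \<G>" by unfold_locales
  show "group P" by (rule group_P)
  show "\<delta> \<in> hom F P" by (rule \<delta>_hom)
  show "x \<in> V" by (rule x)
  fix w c assume w: "w \<in> V" and c: "c \<in> carrier (VG w)" and "\<delta> (vt w c) = \<one>\<^bsub>P\<^esub>"
  then have "vt_coord w c = vt_coord w \<one>\<^bsub>VG w\<^esub>" by (simp add: \<delta>_vt vt_coord_one)
  moreover have "\<one>\<^bsub>VG w\<^esub> \<in> carrier (VG w)" using group.is_monoid[OF group_VG[OF w]]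
    by (rule monoid.one_closed)
  ultimately have "c = \<one>\<^bsub>VG w\<^esub>" using vt_coord_eq_iff[OF w c] by blast
  then show "vt w c = \<one>\<^bsub>F\<^esub>" using vt_one[OF w] by simp
qed

end

section \<open>The finite index subgroup\<close>

lemma lattice_multiple:
  assumes "\<forall>z\<in>Zn n. \<exists>b\<in>B. f b = of_nat m \<cdot>\<^sub>v rvec n z"
  shows "\<forall>z\<in>Zn n. \<exists>b\<in>B. f b = of_nat (k * m) \<cdot>\<^sub>v rvec n z"
proof
  interpret Z: comm_group "Zn_group n" by (rule comm_group_Zn)
  fix z assume z: "z \<in> Zn n"
  have "rvec n (z [^]\<^bsub>Zn_group n\<^esub> k) = of_nat k \<cdot>\<^sub>v rvec n z"
    unfolding Zn_pow[OF z] by (intro eq_vecI) auto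
  then have "of_nat m \<cdot>\<^sub>v rvec n (z [^]\<^bsub>Zn_group n\<^esub> k) = of_nat (k * m) \<cdot>\<^sub>v rvec n z"
    by (simp add: smult_smult_assoc mult.commute)
  then show "\<exists>b\<in>B. f b = of_nat (k * m) \<cdot>\<^sub>v rvec n z"
    using assms Z.nat_pow_closed[OF z, of k] by metis
qed

text \<open>The uniform version of commensurability: one multiple of Z^n lies in the image, instead
  of a separate exponent for each element.\<close>

lemma inj_hom_contains_lattice:
  assumes BZ: "B \<cong> Zn_group n" and B: "group B" and f: "f \<in> hom B (vec_group n)" and inj: "inj_on f (carrier B)"
  shows "\<exists>m::nat. 0 < m \<and> (\<forall>z\<in>Zn n. \<exists>b\<in>carrier B. f b = of_nat m \<cdot>\<^sub>v rvec n z)"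
proof -
  obtain g where g: "g \<in> iso (Zn_group n) B" using group.iso_sym[OF B BZ] by (auto simp: is_iso_def)
  then have gh: "g \<in> hom (Zn_group n) B" and gb: "bij_betw g (Zn n) (carrier B)"
    by (auto simp: iso_def)
  have "f \<circ> g \<in> hom (Zn_group n) (vec_group n)" by (rule hom_compose[OF gh f])
  moreover have "inj_on (f \<circ> g) (Zn n)"
    using gb inj by (auto simp: bij_betw_def intro: comp_inj_on)
  ultimately obtain m :: nat where m: "0 < m"
    "\<And>z. z \<in> Zn n \<Longrightarrow> \<exists>w\<in>Zn n. (f \<circ> g) w = of_nat m \<cdot>\<^sub>v rvec n z"
    using Zn_hom_uniformly_surj by blast
  have "\<exists>b\<in>carrier B. f b = of_nat m \<cdot>\<^sub>v rvec n z" if z: "z \<in> Zn n" for z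
  proof -
    obtain w where w: "w \<in> Zn n" "(f \<circ> g) w = of_nat m \<cdot>\<^sub>v rvec n z" using m(2)[OF z] by blast
    then show ?thesis using gb by (intro bexI[of _ "g w"]) (auto simp: bij_betw_def)
  qed
  with m(1) show ?thesis by blast
qed

section \<open>Uniform denominators and a common lattice\<close>

context gbs_basis
begin

lemma \<delta>_mult: "y \<in> carrier F \<Longrightarrow> z \<in> carrier F \<Longrightarrow> \<delta> (y \<star> z) = \<delta> y \<otimes>\<^bsub>P\<^esub> \<delta> z"
  by (rule C.\<delta>.hom_mult)

lemma \<delta>_cases:
  assumes "y \<in> carrier F"
  obtains t q where "\<delta> y = (t, q)" "t \<in> carrier_vec n" "q \<in> Q" "q \<in> carrier_mat n n"
proof -
  have "\<delta> y \<in> carrier P" using assms by (rule C.\<delta>.hom_closed)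
  then show thesis using that[of "fst (\<delta> y)" "snd (\<delta> y)"] Q_carrier by (cases "\<delta> y") auto
qed

lemma \<delta>_one: "\<delta> \<one>\<^bsub>F\<^esub> = (0\<^sub>v n, 1\<^sub>m n)"
  using C.\<delta>.hom_one by simp

text \<open>Crossing an arc multiplies the translation part of the remaining path by a monodromy
  matrix, so the bound has to hold after applying every \<open>q\<close>. Finiteness of
  \<open>Q\<close> and of the vertex set gives a single \<open>N\<close>.\<close>

lemma vt_coord_denominators:
  "\<exists>N::nat. 0 < N \<and> (\<forall>w\<in>V. \<forall>q\<in>Q. \<forall>c\<in>carrier (VG w). \<forall>i<n. of_nat N * (q *\<^sub>v vt_coord w c) $ i \<in> \<int>)"
proof -
  let ?Pr = "\<lambda>w N. \<forall>q\<in>Q. \<forall>c\<in>carrier (VG w). \<forall>i<n. of_nat N * (q *\<^sub>v vt_coord w c) $ i \<in> \<int>"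
  have ex: "\<exists>N::nat. 0 < N \<and> ?Pr w N" if w: "w \<in> V" for w
  proof -
    obtain g where g: "g \<in> iso (Zn_group n) (VG w)" using Zn_iso_VG[OF w] .
    then have gh: "g \<in> hom (Zn_group n) (VG w)" and im: "carrier (VG w) = g ` Zn n"
      by (auto simp: iso_def bij_betw_def)
    have J: "vt_coord w \<circ> g \<in> hom (Zn_group n) (vec_group n)"
      by (rule hom_compose[OF gh vt_coord_hom[OF w]])
    have Qf: "finite Q" "Q \<subseteq> carrier_mat n n" using fin_Q Q_carrier by (auto simp: Q_def)
    obtain N :: nat where "0 < N" "\<And>q z i. q \<in> Q \<Longrightarrow> z \<in> Zn n \<Longrightarrow> i < n \<Longrightarrow>
        of_nat N * (q *\<^sub>v (vt_coord w \<circ> g) z) $ i \<in> \<int>"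
      using Zn_hom_denominators[OF J Qf] by blast
    then show ?thesis unfolding im by (intro exI[of _ N]) auto
  qed
  have mul: "?Pr w (k * N)" if "?Pr w N" for w and k N :: nat
  proof (intro ballI allI impI)
    fix q c i assume "q \<in> Q" "c \<in> carrier (VG w)" "i < n"
    then have "of_nat N * (q *\<^sub>v vt_coord w c) $ i \<in> \<int>" using that by blast
    from Ints_mult[OF Ints_of_nat this] have "of_nat k * (of_nat N * (q *\<^sub>v vt_coord w c) $ i) \<in> \<int>" .
    then show "of_nat (k * N) * (q *\<^sub>v vt_coord w c) $ i \<in> \<int>" by (simp only: of_nat_mult mult.assoc)
  qed
  obtain N :: nat where "0 < N" "\<And>w. w \<in> V \<Longrightarrow> ?Pr w N"
    by (rule common_multiple[of V ?Pr]) ((rule fin_V ex mul | assumption)+, blast)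
  then show ?thesis by blast
qed

lemma mult_inj:
  assumes "q \<in> Q" "t \<in> carrier_vec n" "s \<in> carrier_vec n" "q *\<^sub>v t = q *\<^sub>v s"
  shows "t = s"
proof -
  obtain r where r: "r \<in> Q" "r * q = 1\<^sub>m n" using Q_inv[OF assms(1)] by blast
  have "u = r *\<^sub>v (q *\<^sub>v u)" if "u \<in> carrier_vec n" for u
    using assoc_mult_mat_vec[OF Q_carrier[OF r(1)] Q_carrier[OF assms(1)] that] r that by simp
  then show ?thesis using assms by metis
qed

text \<open>Multiplying a state with linear part \<open>q\<close> on the right by an edge element
  with coordinates \<open>u\<close> adds \<open>q u\<close> to its translation part. The lattice
  must therefore lie in every \<open>q\<close> image of every edge group. The product of the bound
  for the pairs \<open>(q, e)\<close> and the bound for the base vertex serves both clauses.\<close>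

lemma edge_lattice:
  "\<exists>d::nat. 0 < d \<and> (\<forall>q\<in>Q. \<forall>e\<in>E. \<forall>z\<in>Zn n. \<exists>i\<in>carrier (EG e).
      q *\<^sub>v vt_coord (src e) (inc (rev_arc e) i) = of_nat d \<cdot>\<^sub>v rvec n z) &
    (\<forall>z\<in>Zn n. \<exists>c\<in>carrier (VG x). vt_coord x c = of_nat d \<cdot>\<^sub>v rvec n z)"
proof -
  let ?f = "\<lambda>k i. fst k *\<^sub>v vt_coord (src (snd k)) (inc (rev_arc (snd k)) i)"
  let ?Pr = "\<lambda>k d. \<forall>z\<in>Zn n. \<exists>i\<in>carrier (EG (snd k)). ?f k i = of_nat d \<cdot>\<^sub>v rvec n z"
  have ex: "\<exists>d::nat. 0 < d \<and> ?Pr k d" if kQ: "k \<in> Q \<times> E" for k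
  proof -
    obtain q e where k: "k = (q, e)" "q \<in> Q" "e \<in> E" using kQ by auto
    have qc: "q \<in> carrier_mat n n" using Q_carrier k by blast
    have w: "src e \<in> V" using k by simp
    have cl: "inc (rev_arc e) i \<in> carrier (VG (src e))" if "i \<in> carrier (EG e)" for i
      using inc_rev_closed[OF k(3) that] .
    have "?f k \<in> hom (EG e) (vec_group n)"
    proof (rule homI)
      fix i j assume ij: "i \<in> carrier (EG e)" "j \<in> carrier (EG e)"
      have "vt_coord (src e) (inc (rev_arc e) (i \<otimes>\<^bsub>EG e\<^esub> j)) =
          vt_coord (src e) (inc (rev_arc e) i) + vt_coord (src e) (inc (rev_arc e) j)"
        using hom_mult[OF inc_rev_hom[OF k(3)] ij] vt_coord_mult[OF w cl[OF ij(1)] cl[OF ij(2)]]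
          by simp
      then show "?f k (i \<otimes>\<^bsub>EG e\<^esub> j) = ?f k i \<otimes>\<^bsub>vec_group n\<^esub> ?f k j"
        using mult_add_distrib_mat_vec[OF qc vt_coord_carrier(1) vt_coord_carrier(1)]
        by (simp add: k(1) del: index_mult_mat_vec)
    next
      fix i
      show "?f k i \<in> carrier (vec_group n)" using qc by (simp add: k(1))
    qed
    moreover have "inj_on (?f k) (carrier (EG e))"
    proof (rule inj_onI)
      fix i j assume ij: "i \<in> carrier (EG e)" "j \<in> carrier (EG e)" "?f k i = ?f k j"
      then have "q *\<^sub>v vt_coord (src e) (inc (rev_arc e) i) = q *\<^sub>v vt_coord (src e) (inc (rev_arc e) j)"
        by (simp only: k(1) fst_conv snd_conv)
      then have "vt_coord (src e) (inc (rev_arc e) i) = vt_coord (src e) (inc (rev_arc e) j)"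
        by (rule mult_inj[OF k(2) vt_coord_carrier(1) vt_coord_carrier(1)])
      then have "inc (rev_arc e) i = inc (rev_arc e) j" using vt_coord_eq_iff[OF w cl cl] ij
        by blast
      then show "i = j" using inj_onD[OF inc_rev_inj[OF k(3)]] ij by blast
    qed
    ultimately show ?thesis using inj_hom_contains_lattice[OF EG_iso group_EG] k(1,3) by simp
  qed
  have fin: "finite (Q \<times> E)" using fin_Q fin_E by (simp add: Q_def)
  have mul: "?Pr k (l * m)" if "?Pr k m" for k and l m :: nat
    by (rule lattice_multiple[OF that])
  obtain d :: nat where d: "0 < d" "\<And>k. k \<in> Q \<times> E \<Longrightarrow> ?Pr k d"
    by (rule common_multiple[of "Q \<times> E" ?Pr]) ((rule fin ex mul | assumption)+, blast)
  obtain b :: nat where b: "0 < b" "\<forall>z\<in>Zn n. \<exists>c\<in>carrier (VG x). vt_coord x c = of_nat b \<cdot>\<^sub>v rvec n z"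
    using inj_hom_contains_lattice[OF VG_iso[OF x] group_VG[OF x] vt_coord_hom[OF x] vt_coord_inj[OF x]] by blast
  have "?Pr k (b * d)" if "k \<in> Q \<times> E" for k by (rule lattice_multiple[OF d(2)[OF that]])
  then have "\<forall>q\<in>Q. \<forall>e\<in>E. \<forall>z\<in>Zn n. \<exists>i\<in>carrier (EG e).
      q *\<^sub>v vt_coord (src e) (inc (rev_arc e) i) = of_nat (b * d) \<cdot>\<^sub>v rvec n z" by fastforce
  moreover have "\<forall>z\<in>Zn n. \<exists>c\<in>carrier (VG x). vt_coord x c = of_nat (b * d) \<cdot>\<^sub>v rvec n z"
    using lattice_multiple[OF b(2), of d] by (simp only: mult.commute)
  ultimately show ?thesis using b d by (intro exI[of _ "b * d"]) auto
qed

section \<open>Finiteness and commutation for fixed constants N and d\<close>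

context
  fixes N d :: nat
  assumes N: "0 < N" "\<And>w q c i. w \<in> V \<Longrightarrow> q \<in> Q \<Longrightarrow> c \<in> carrier (VG w) \<Longrightarrow> i < n \<Longrightarrow> of_nat N * (q *\<^sub>v vt_coord w c) $ i \<in> \<int>"
    and d: "0 < d" "\<And>q e z. q \<in> Q \<Longrightarrow> e \<in> E \<Longrightarrow> z \<in> Zn n \<Longrightarrow>
        \<exists>i\<in>carrier (EG e). q *\<^sub>v vt_coord (src e) (inc (rev_arc e) i) = of_nat d \<cdot>\<^sub>v rvec n z"
      "\<And>z. z \<in> Zn n \<Longrightarrow> \<exists>c\<in>carrier (VG x). vt_coord x c = of_nat d \<cdot>\<^sub>v rvec n z"
begin

text \<open>The quantifier over all \<open>q\<close> carries the induction across an arc: the matrix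
  \<open>q * arc_mat e\<close> is again in \<open>Q\<close>, so the hypothesis for the rest of the
  path applies.\<close>

lemma \<delta>_denominators:
  assumes "y \<in> Paths u w"
  shows "\<forall>q\<in>Q. \<forall>i<n. of_nat N * (q *\<^sub>v fst (\<delta> y)) $ i \<in> \<int>"
  using assms
proof (induction rule: path_induct)
  case one
  have "(q *\<^sub>v 0\<^sub>v n) $ i = 0" if "q \<in> Q" "i < n" for q i
    using that Q_carrier mult_zero_vec_right by (metis index_zero_vec(1))
  then show ?case by (simp add: \<delta>_one)
next
  case (vt w' c y)
  have yc: "y \<in> carrier F" using vt path_classes_closed by blast
  obtain t r where tr: "\<delta> y = (t, r)" "t \<in> carrier_vec n" "r \<in> Q" using \<delta>_cases[OF yc] by metis
  show ?case
  proof (intro ballI allI impI)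
    fix q i assume q: "q \<in> Q" and i: "i < n"
    have "fst (\<delta> (vt w' c \<star> y)) = vt_coord w' c + t" using vt tr yc by (simp add: \<delta>_mult \<delta>_vt)
    then have "of_nat N * (q *\<^sub>v fst (\<delta> (vt w' c \<star> y))) $ i =
        of_nat N * (q *\<^sub>v vt_coord w' c) $ i + of_nat N * (q *\<^sub>v t) $ i"
      using i tr Q_carrier[OF q] mult_add_distrib_mat_vec[OF Q_carrier[OF q] vt_coord_carrier(1) tr(2)]
      by (simp add: distrib_left del: index_mult_mat_vec)
    then show "of_nat N * (q *\<^sub>v fst (\<delta> (vt w' c \<star> y))) $ i \<in> \<int>"
      using N(2)[OF vt(1) q vt(2) i] vt(4) tr q i by (simp del: index_mult_mat_vec)
  qed
next
  case (ed e y)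
  have yc: "y \<in> carrier F" using ed path_classes_closed by blast
  obtain t r where tr: "\<delta> y = (t, r)" "t \<in> carrier_vec n" "r \<in> Q" using \<delta>_cases[OF yc] by metis
  have arc_mat: "arc_mat e \<in> carrier_mat n n" using arc_mat_Q ed Q_carrier by blast
  show ?case
  proof (intro ballI allI impI)
    fix q i assume q: "q \<in> Q" and i: "i < n"
    have "fst (\<delta> (ed e \<star> y)) = arc_mat e *\<^sub>v t" using ed tr yc arc_mat by (simp add: \<delta>_mult \<delta>_ed)
    then have "q *\<^sub>v fst (\<delta> (ed e \<star> y)) = (q * arc_mat e) *\<^sub>v t"
      using assoc_mult_mat_vec[OF Q_carrier[OF q] arc_mat tr(2)] by simp
    moreover have "of_nat N * ((q * arc_mat e) *\<^sub>v t) $ i \<in> \<int>"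
      using ed(3) Q_mult[OF q arc_mat_Q[OF ed(1)]] i tr by (simp del: index_mult_mat_vec)
    ultimately show "of_nat N * (q *\<^sub>v fst (\<delta> (ed e \<star> y))) $ i \<in> \<int>" by simp
  qed
qed

lemma \<delta>_path:
  assumes "y \<in> Paths u w"
  obtains t q where "\<delta> y = (t, q)" "t \<in> carrier_vec n" "q \<in> Q" "q \<in> carrier_mat n n"
    "\<And>i. i < n \<Longrightarrow> of_nat N * t $ i \<in> \<int>"
proof -
  obtain t q where tq: "\<delta> y = (t, q)" "t \<in> carrier_vec n" "q \<in> Q" "q \<in> carrier_mat n n"
    using \<delta>_cases[OF path_classes_closed[OF assms]] .
  have "1\<^sub>m n *\<^sub>v t = t" using tq by simp
  then have "of_nat N * t $ i \<in> \<int>" if "i < n" for i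
    using \<delta>_denominators[OF assms] Q_one that tq(1) by (metis fst_conv)
  with tq that show thesis by blast
qed

text \<open>For translation parts \<open>t\<close> of elements in the image of \<open>\<delta>\<close>, which lie in \<open>1/N\<close> times the integer
  lattice, \<open>residue t\<close> is the class of \<open>t\<close> modulo \<open>d\<close> times the integer lattice.\<close>

definition residue :: "rat vec \<Rightarrow> nat \<Rightarrow> int" where
  "residue t = (\<lambda>i\<in>{..<n}. \<lfloor>of_nat N * t $ i\<rfloor> mod int (N * d))"

lemma residue_range: "residue t \<in> (\<Pi>\<^sub>E i\<in>{..<n}. {0..<int (N * d)})"
  using N(1) d(1) by (auto simp: residue_def)

lemma residue_eqD:
  assumes t: "t \<in> carrier_vec n" "\<And>i. i < n \<Longrightarrow> of_nat N * t $ i \<in> \<int>"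
    and s: "s \<in> carrier_vec n" "\<And>i. i < n \<Longrightarrow> of_nat N * s $ i \<in> \<int>"
    and eq: "residue t = residue s"
  obtains z where "z \<in> Zn n" "t = s + of_nat d \<cdot>\<^sub>v rvec n z"
proof -
  \<comment> \<open>Translation parts become integral after multiplication by \<open>N\<close>, so a
    difference in d Z^n becomes divisibility by \<open>N * d\<close>; this quotient is the lattice
    coordinate.\<close>
  let ?k = "\<lambda>i. (\<lfloor>of_nat N * t $ i\<rfloor> - \<lfloor>of_nat N * s $ i\<rfloor>) div int (N * d)"
  let ?z = "\<lambda>i\<in>{..<n}. ?k i"
  have z: "?z \<in> Zn n" by (simp add: Zn_group_simps)
  have "t = s + of_nat d \<cdot>\<^sub>v rvec n ?z"
  proof (rule eq_vecI)
    fix i assume "i < dim_vec (s + of_nat d \<cdot>\<^sub>v rvec n ?z)"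
    then have i: "i < n" by simp
    have "\<lfloor>of_nat N * t $ i\<rfloor> mod int (N * d) = \<lfloor>of_nat N * s $ i\<rfloor> mod int (N * d)"
      using fun_cong[OF eq, of i] i by (simp add: residue_def)
    then have "int (N * d) dvd \<lfloor>of_nat N * t $ i\<rfloor> - \<lfloor>of_nat N * s $ i\<rfloor>"
      by (simp add: mod_eq_dvd_iff)
    then have "int (N * d) * ?k i = \<lfloor>of_nat N * t $ i\<rfloor> - \<lfloor>of_nat N * s $ i\<rfloor>"
      by (rule dvd_mult_div_cancel)
    then have "(of_int (int (N * d) * ?k i) :: rat) = of_int \<lfloor>of_nat N * t $ i\<rfloor> - of_int \<lfloor>of_nat N * s $ i\<rfloor>"
      by (simp only: of_int_diff)
    also have "of_int \<lfloor>of_nat N * t $ i\<rfloor> = of_nat N * t $ i" using t(2)[OF i]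
      by (auto elim!: Ints_cases)
    also have "of_int \<lfloor>of_nat N * s $ i\<rfloor> = of_nat N * s $ i" using s(2)[OF i]
      by (auto elim!: Ints_cases)
    finally have "of_nat N * (of_nat d * of_int (?k i)) = of_nat N * (t $ i - s $ i)"
      by (simp add: algebra_simps)
    then have "of_nat d * of_int (?k i) = t $ i - s $ i" using N(1) by simp
    then show "t $ i = (s + of_nat d \<cdot>\<^sub>v rvec n ?z) $ i" using i s(1) by simp
  qed (use t s in simp)
  with z show thesis by (rule that)
qed

text \<open>An arc of the quotient graph is determined by \<open>e\<close>, the linear part and the
  residue of a state. If these agree, the translation parts differ by a vector of d Z^n, and
  \<open>edge_lattice\<close> realizes this difference by right multiplication with an edge element,
  which leaves the arc unchanged.\<close>

lemma finite_carcs: "finite {C.carc e p | e p. e \<in> E \<and> p \<in> C.states (src e)}"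
proof -
  let ?S = "{(e, p). e \<in> E \<and> p \<in> C.states (src e)}"
  let ?f = "\<lambda>(e, p). (e, snd p, residue (fst p))"
  let ?g = "\<lambda>(e, p). C.carc e p"
  have fin: "finite (E \<times> Q \<times> (\<Pi>\<^sub>E i\<in>{..<n}. {0..<int (N * d)}))"
    using fin_E fin_Q by (intro finite_cartesian_product finite_PiE) (auto simp: Q_def)
  have sub: "?f ` ?S \<subseteq> E \<times> Q \<times> (\<Pi>\<^sub>E i\<in>{..<n}. {0..<int (N * d)})"
  proof (rule subsetI)
    fix u assume "u \<in> ?f ` ?S"
    then obtain e p where u: "u = (e, snd p, residue (fst p))" "e \<in> E" "p \<in> C.states (src e)"
      by auto
    then have "p \<in> carrier P" using C.states_closed by blast
    then show "u \<in> E \<times> Q \<times> (\<Pi>\<^sub>E i\<in>{..<n}. {0..<int (N * d)})"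
      using u residue_range by (cases p) simp
  qed
  have "finite (?g ` ?S)"
  proof (rule finite_image_of_invariant[OF finite_subset[OF sub fin]])
    fix k l assume kl: "k \<in> ?S" "l \<in> ?S" "?f k = ?f l"
    obtain e p p' where k: "k = (e, p)" "l = (e, p')" "e \<in> E" "p \<in> C.states (src e)" "p' \<in> C.states (src e)"
      using kl by (cases k; cases l) auto
    obtain y y' where y: "y \<in> Paths x (src e)" "p = \<delta> y" "y' \<in> Paths x (src e)" "p' = \<delta> y'"
      using k(4,5) by (auto simp: C.states_def)
    obtain t q where t: "p = (t, q)" "t \<in> carrier_vec n" "q \<in> Q" "q \<in> carrier_mat n n" "\<And>i. i < n \<Longrightarrow> of_nat N * t $ i \<in> \<int>"
      using \<delta>_path[OF y(1)] y(2) by metis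
    obtain s q' where s: "p' = (s, q')" "s \<in> carrier_vec n" "\<And>i. i < n \<Longrightarrow> of_nat N * s $ i \<in> \<int>"
      using \<delta>_path[OF y(3)] y(4) by metis
    have q': "q' = q" and "residue t = residue s" using kl(3) k t s by auto
    then obtain z where z: "z \<in> Zn n" "t = s + of_nat d \<cdot>\<^sub>v rvec n z"
      using residue_eqD[OF t(2,5) s(2,3)] by blast
    obtain i where i: "i \<in> carrier (EG e)" "q *\<^sub>v vt_coord (src e) (inc (rev_arc e) i) = of_nat d \<cdot>\<^sub>v rvec n z"
      using d(2)[OF t(3) k(3) z(1)] by blast
    have "p = p' \<otimes>\<^bsub>P\<^esub> \<delta> (tail_elt e i)"
      using t(1,4) s(1) q' z(2) i inc_rev_closed[OF k(3) i(1)] k(3) by (simp add: \<delta>_vt)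
    then have "C.carc e p = C.carc e p'" using C.carc_vt[OF k(3) _ i(1)] C.states_closed[OF k(5)]
      by simp
    then show "?g k = ?g l" using k by simp
  qed
  moreover have "?g ` ?S = {C.carc e p | e p. e \<in> E \<and> p \<in> C.states (src e)}" by auto
  ultimately show ?thesis by simp
qed

text \<open>An element of the base group with coordinates in d Z^n can be moved along every path,
  hence fixes the whole Bass-Serre tree: at each arc it has already become an edge element. Its
  coordinates change by the linear part of the path.\<close>

lemma base_conj:
  assumes "y \<in> Paths u x" "c \<in> carrier (VG x)" "z \<in> Zn n" "vt_coord x c = of_nat d \<cdot>\<^sub>v rvec n z"
  shows "\<exists>b\<in>carrier (VG u). y \<star> vt x c = vt u b \<star> y \<and> vt_coord u b = snd (\<delta> y) *\<^sub>v vt_coord x c"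
  using assms(1)
proof (induction rule: path_induct)
  case one
  show ?case using assms(2) x by (intro bexI[of _ c]) (auto simp: \<delta>_one)
next
  case (vt w b y)
  then obtain f where f: "f \<in> carrier (VG w)" "y \<star> vt x c = vt w f \<star> y" "vt_coord w f = snd (\<delta> y) *\<^sub>v vt_coord x c" by blast
  have yc: "y \<in> carrier F" using vt path_classes_closed by blast
  obtain t q where tq: "\<delta> y = (t, q)" "q \<in> carrier_mat n n" using \<delta>_cases[OF yc] by metis
  note cl = yc vt_closed[OF vt(1,2)] vt_closed[OF vt(1) f(1)] vt_closed[OF x assms(2)]
  have "vt w b \<star> y \<star> vt x c = vt w b \<star> vt w f \<star> y" using cl f(2) by (simp add: F.m_assoc)
  also have "\<dots> = vt w f \<star> (vt w b \<star> y)" unfolding vt_commute[OF vt(1,2) f(1)] using cl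
    by (simp add: F.m_assoc)
  finally have "vt w b \<star> y \<star> vt x c = vt w f \<star> (vt w b \<star> y)" .
  moreover have "snd (\<delta> (vt w b \<star> y)) = snd (\<delta> y)"
    using cl vt tq by (simp add: \<delta>_mult \<delta>_vt)
  ultimately show ?case using f by (intro bexI[of _ f]) auto
next
  case (ed e y)
  then obtain f where f: "f \<in> carrier (VG (tgt e))" "y \<star> vt x c = vt (tgt e) f \<star> y"
    "vt_coord (tgt e) f = snd (\<delta> y) *\<^sub>v vt_coord x c" by blast
  have V: "src e \<in> V" "tgt e \<in> V" using ed by auto
  have yc: "y \<in> carrier F" using ed path_classes_closed by blast
  obtain t q where tq: "\<delta> y = (t, q)" "t \<in> carrier_vec n" "q \<in> Q" "q \<in> carrier_mat n n"
    using \<delta>_cases[OF yc] by metis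
  \<comment> \<open>The lattice property is applied to the reversed arc and to the inverse
    \<open>r\<close> of the linear part. It yields an edge element with the same coordinates as
    \<open>f\<close>, so by injectivity \<open>f\<close> is that edge element and can cross the
    arc.\<close>
  obtain r where r: "r \<in> Q" "r * q = 1\<^sub>m n" "q * r = 1\<^sub>m n" using Q_inv[OF tq(3)] .
  obtain i where i: "i \<in> carrier (EG e)" "r *\<^sub>v vt_coord (tgt e) (inc e i) = of_nat d \<cdot>\<^sub>v rvec n z"
    using d(2)[OF r(1), of "rev_arc e" z] ed(1) assms(3) EG_rev[OF ed(1)] by auto
  note ic = inc_closed[OF ed(1) i(1)] inc_rev_closed[OF ed(1) i(1)]
  have "q *\<^sub>v (r *\<^sub>v vt_coord (tgt e) (inc e i)) = vt_coord (tgt e) (inc e i)"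
    using assoc_mult_mat_vec[OF tq(4) Q_carrier[OF r(1)] vt_coord_carrier(1)] r(3) by simp
  then have "vt_coord (tgt e) f = vt_coord (tgt e) (inc e i)" using f(3) assms(4) i(2) tq(1) by simp
  then have fi: "f = inc e i" using vt_coord_eq_iff[OF V(2) f(1) ic(1)] by blast
  note cl = yc ed_closed[OF ed(1)] vt_closed[OF V(2) f(1)] vt_closed[OF x assms(2)] vt_closed[OF V(1) ic(2)]
  have "ed e \<star> y \<star> vt x c = ed e \<star> vt (tgt e) f \<star> y" using cl f(2) by (simp add: F.m_assoc)
  also have "\<dots> = tail_elt e i \<star> (ed e \<star> y)"
    unfolding fi ed_vt[OF ed(1) i(1)] using cl by (simp add: F.m_assoc)
  finally have "ed e \<star> y \<star> vt x c = tail_elt e i \<star> (ed e \<star> y)" .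
  moreover have "vt_coord (src e) (inc (rev_arc e) i) = snd (\<delta> (ed e \<star> y)) *\<^sub>v vt_coord x c"
  proof -
    have arc_mat: "arc_mat e \<in> carrier_mat n n" using arc_mat_Q ed Q_carrier by blast
    have "snd (\<delta> (ed e \<star> y)) = arc_mat e * q" using cl ed tq by (simp add: \<delta>_mult \<delta>_ed)
    moreover have "vt_coord (src e) (inc (rev_arc e) i) = arc_mat e *\<^sub>v (q *\<^sub>v vt_coord x c)"
      using arc_mat_io[OF ed(1) i(1)] f(3) tq(1) fi by simp
    ultimately show ?thesis using assoc_mult_mat_vec[OF arc_mat tq(4) vt_coord_carrier(1), of x c]
      by simp
  qed
  ultimately show ?case using ic(2) by blast
qed

section \<open>The finite index subgroup and its central lattice\<close>

definition H :: "'g set" where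
  "H = {g \<in> carrier G. \<exists>z\<in>Zn n. \<delta> (phi g) = (of_nat d \<cdot>\<^sub>v rvec n z, 1\<^sub>m n)}"

definition base_lattice :: "(nat \<Rightarrow> int) \<Rightarrow> 'a" where
  "base_lattice z = (SOME c. c \<in> carrier (VG x) \<and> vt_coord x c = of_nat d \<cdot>\<^sub>v rvec n z)"

lemma base_lattice_props:
  assumes "z \<in> Zn n"
  shows "base_lattice z \<in> carrier (VG x)" "vt_coord x (base_lattice z) = of_nat d \<cdot>\<^sub>v rvec n z"
proof -
  have "\<exists>c. c \<in> carrier (VG x) \<and> vt_coord x c = of_nat d \<cdot>\<^sub>v rvec n z" using d(3)[OF assms] by blast
  from someI_ex[OF this] have "base_lattice z \<in> carrier (VG x) \<and> vt_coord x (base_lattice z) = of_nat d \<cdot>\<^sub>v rvec n z"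
    by (simp only: base_lattice_def)
  then show "base_lattice z \<in> carrier (VG x)" "vt_coord x (base_lattice z) = of_nat d \<cdot>\<^sub>v rvec n z"
    by auto
qed

lemma scaled_mult:
  assumes "z \<in> Zn n" "w \<in> Zn n"
  shows "of_nat d \<cdot>\<^sub>v rvec n (z \<otimes>\<^bsub>Zn_group n\<^esub> w) = of_nat d \<cdot>\<^sub>v rvec n z + of_nat d \<cdot>\<^sub>v rvec n w"
  using hom_mult[OF rvec_hom assms]
    by (simp add: smult_add_distrib_vec[OF rvec_carrier(1) rvec_carrier(1)])

lemma scaled_inj:
  assumes "z \<in> Zn n" "w \<in> Zn n" "of_nat d \<cdot>\<^sub>v rvec n z = of_nat d \<cdot>\<^sub>v rvec n w"
  shows "z = w"
proof -
  have "(1 / of_nat d) \<cdot>\<^sub>v (of_nat d \<cdot>\<^sub>v u) = u" for u :: "rat vec" using d(1)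
    by (simp add: smult_smult_assoc)
  then have "rvec n z = rvec n w" using assms(3) by metis
  then show ?thesis using rvec_inj assms by blast
qed

lemma base_lattice_mult:
  assumes "z \<in> Zn n" "w \<in> Zn n"
  shows "base_lattice (z \<otimes>\<^bsub>Zn_group n\<^esub> w) = base_lattice z \<otimes>\<^bsub>VG x\<^esub> base_lattice w"
proof -
  interpret VG: group "VG x" using group_VG[OF x] .
  have zw: "z \<otimes>\<^bsub>Zn_group n\<^esub> w \<in> Zn n" using assms by simp
  have "vt_coord x (base_lattice (z \<otimes>\<^bsub>Zn_group n\<^esub> w)) = vt_coord x (base_lattice z \<otimes>\<^bsub>VG x\<^esub> base_lattice w)"
    using base_lattice_props[OF zw] base_lattice_props[OF assms(1)] base_lattice_props[OF assms(2)] scaled_mult[OF assms]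
    by (simp add: vt_coord_mult x)
  then show ?thesis
    using vt_coord_eq_iff[OF x base_lattice_props(1)[OF zw] VG.m_closed[OF base_lattice_props(1)[OF assms(1)] base_lattice_props(1)[OF assms(2)]]]
    by blast
qed

definition central_elt :: "(nat \<Rightarrow> int) \<Rightarrow> 'g" where
  "central_elt z = psi (vt x (base_lattice z))"

lemma central_elt_props:
  assumes "z \<in> Zn n"
  shows "central_elt z \<in> carrier G" "phi (central_elt z) = vt x (base_lattice z)" "\<delta> (phi (central_elt z)) = (of_nat d \<cdot>\<^sub>v rvec n z, 1\<^sub>m n)"
  using base_lattice_props[OF assms] x by (simp_all add: central_elt_def psi_closed phi_psi \<delta>_vt)

lemma central_elt_mult:
  assumes "z \<in> Zn n" "w \<in> Zn n"
  shows "central_elt (z \<otimes>\<^bsub>Zn_group n\<^esub> w) = central_elt z \<otimes> central_elt w"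
  using assms base_lattice_props(1) x
    by (simp add: central_elt_def base_lattice_mult vt_mult psi_mult)

lemma \<delta>_phi_mult:
  "g \<in> carrier G \<Longrightarrow> h \<in> carrier G \<Longrightarrow> \<delta> (phi (g \<otimes> h)) = \<delta> (phi g) \<otimes>\<^bsub>P\<^esub> \<delta> (phi h)"
  by (simp add: phi_mult \<delta>_mult phi_carrier)

lemma H_mult_props:
  assumes "\<delta> (phi g) = (of_nat d \<cdot>\<^sub>v rvec n z, 1\<^sub>m n)" "\<delta> (phi h) = (of_nat d \<cdot>\<^sub>v rvec n w, 1\<^sub>m n)"
    and "g \<in> carrier G" "h \<in> carrier G" "z \<in> Zn n" "w \<in> Zn n"
  shows "\<delta> (phi (g \<otimes> h)) = (of_nat d \<cdot>\<^sub>v rvec n (z \<otimes>\<^bsub>Zn_group n\<^esub> w), 1\<^sub>m n)"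
  using assms by (simp add: \<delta>_phi_mult scaled_mult)

text \<open>Moving the lattice element along the loop of \<open>h\<close> transforms its coordinates
  by the linear part of \<open>h\<close>, which is the identity on \<open>H\<close>; injectivity of
  the coordinates returns the same element.\<close>

lemma central_elt_commute:
  assumes h: "h \<in> H" and z: "z \<in> Zn n"
  shows "h \<otimes> central_elt z = central_elt z \<otimes> h"
proof -
  have hc: "h \<in> carrier G" and lin: "snd (\<delta> (phi h)) = 1\<^sub>m n" using h by (auto simp: H_def)
  note b = base_lattice_props[OF z]
  obtain c where c: "c \<in> carrier (VG x)" "phi h \<star> vt x (base_lattice z) = vt x c \<star> phi h" "vt_coord x c = snd (\<delta> (phi h)) *\<^sub>v vt_coord x (base_lattice z)"
    using base_conj[OF phi_closed[OF hc] b(1) z b(2)] by blast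
  have "vt_coord x c = vt_coord x (base_lattice z)" using c(3) lin by simp
  then have "c = base_lattice z" using vt_coord_eq_iff[OF x c(1) b(1)] by blast
  then have "phi (h \<otimes> central_elt z) = phi (central_elt z \<otimes> h)"
    using c(2) hc central_elt_props[OF z] by (simp add: phi_mult)
  then show ?thesis using hc central_elt_props[OF z] by (intro phi_inj) auto
qed

lemma Zn_one_scaled: "of_nat d \<cdot>\<^sub>v rvec n \<one>\<^bsub>Zn_group n\<^esub> = 0\<^sub>v n"
  by (intro eq_vecI) (auto simp: Zn_group_simps)

lemma \<delta>_phi_one: "\<delta> (phi \<one>) = (of_nat d \<cdot>\<^sub>v rvec n \<one>\<^bsub>Zn_group n\<^esub>, 1\<^sub>m n)"
  by (simp add: phi_one \<delta>_one Zn_one_scaled)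

lemma central_elt_inverse:
  assumes "g \<in> carrier G" "z \<in> Zn n" "\<delta> (phi g) = (of_nat d \<cdot>\<^sub>v rvec n z, 1\<^sub>m n)"
  shows "\<delta> (phi (inv central_elt z \<otimes> g)) = \<one>\<^bsub>P\<^esub>"
proof -
  have e: "\<delta> (phi (central_elt z)) = \<delta> (phi g)" using central_elt_props[OF assms(2)] assms by simp
  have "\<delta> (phi (central_elt z)) \<otimes>\<^bsub>P\<^esub> \<delta> (phi (inv central_elt z \<otimes> g)) = \<delta> (phi g)"
  proof -
    have "central_elt z \<otimes> (inv central_elt z \<otimes> g) = g"
      using central_elt_props(1)[OF assms(2)] assms(1) by (simp flip: G.m_assoc)
    then show ?thesis
      using \<delta>_phi_mult[of "central_elt z" "inv central_elt z \<otimes> g"] central_elt_props(1)[OF assms(2)] assms(1) by simp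
  qed
  then show ?thesis
    using e C.P.l_cancel_one[of "\<delta> (phi g)" "\<delta> (phi (inv central_elt z \<otimes> g))"]
      C.\<delta>.hom_closed[OF phi_carrier] central_elt_props(1)[OF assms(2)] assms(1) by simp
qed

lemma subgroup_H: "subgroup H G"
proof (rule G.subgroupI)
  show "H \<subseteq> carrier G" by (auto simp: H_def)
  have "\<one> \<in> H" unfolding H_def using \<delta>_phi_one by blast
  then show "H \<noteq> {}" by blast
  fix g assume "g \<in> H"
  then obtain z where g: "g \<in> carrier G" "z \<in> Zn n" "\<delta> (phi g) = (of_nat d \<cdot>\<^sub>v rvec n z, 1\<^sub>m n)"
    by (auto simp: H_def)
  let ?w = "inv\<^bsub>Zn_group n\<^esub> z"
  have w: "?w \<in> Zn n" using g by simp
  \<comment> \<open>The image of the inverse is found by comparison: the central element for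
    \<open>?w\<close>, with the opposite translation, is another right inverse of the image of
    \<open>g\<close>.\<close>
  have "\<delta> (phi (g \<otimes> central_elt ?w)) = (of_nat d \<cdot>\<^sub>v rvec n \<one>\<^bsub>Zn_group n\<^esub>, 1\<^sub>m n)"
    using H_mult_props[OF g(3) central_elt_props(3)[OF w] g(1) central_elt_props(1)[OF w] g(2) w] g(2) by simp
  then have "\<delta> (phi g) \<otimes>\<^bsub>P\<^esub> \<delta> (phi (central_elt ?w)) = \<one>\<^bsub>P\<^esub>"
    using g w central_elt_props(1) by (simp add: \<delta>_phi_mult Zn_one_scaled)
  moreover have "\<delta> (phi g) \<otimes>\<^bsub>P\<^esub> \<delta> (phi (inv g)) = \<one>\<^bsub>P\<^esub>"
    using \<delta>_phi_mult[OF g(1) G.inv_closed[OF g(1)]] g(1) by (simp add: phi_one \<delta>_one)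
  ultimately have "\<delta> (phi (inv g)) = \<delta> (phi (central_elt ?w))"
    using C.P.l_cancel C.\<delta>.hom_closed[OF phi_carrier] g(1) central_elt_props(1)[OF w] G.inv_closed
      by metis
  then show "inv g \<in> H" unfolding H_def using g w central_elt_props(3)[OF w] by auto
  fix h assume "h \<in> H"
  then obtain u where h: "h \<in> carrier G" "u \<in> Zn n" "\<delta> (phi h) = (of_nat d \<cdot>\<^sub>v rvec n u, 1\<^sub>m n)"
    by (auto simp: H_def)
  show "g \<otimes> h \<in> H" unfolding H_def
    using H_mult_props[OF g(3) h(3) g(1) h(1) g(2) h(2)] g h
      by (auto intro!: bexI[of _ "z \<otimes>\<^bsub>Zn_group n\<^esub> u"])
qed

text \<open>The linear part and the residue of the translation part together take finitely many
  values. If they agree for \<open>g\<close> and \<open>h\<close>, the quotient of \<open>g\<close>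
  by \<open>h\<close> is sent to a translation by d Z^n, so they lie in the same coset.\<close>

lemma finite_index_H: "finite_index_subgroup H G"
  unfolding finite_index_subgroup_def
proof (intro conjI subgroup_H finite_rcosets_of_invariant[OF G.is_group subgroup_H])
  let ?f = "\<lambda>g. (snd (\<delta> (phi g)), residue (fst (\<delta> (phi g))))"
  have fin: "finite (Q \<times> (\<Pi>\<^sub>E i\<in>{..<n}. {0..<int (N * d)}))"
    using fin_Q by (intro finite_cartesian_product finite_PiE) (auto simp: Q_def)
  have "?f ` carrier G \<subseteq> Q \<times> (\<Pi>\<^sub>E i\<in>{..<n}. {0..<int (N * d)})"
  proof (rule image_subsetI)
    fix g assume "g \<in> carrier G"
    then obtain t q where "\<delta> (phi g) = (t, q)" "q \<in> Q" using \<delta>_cases[OF phi_carrier] by metis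
    then show "?f g \<in> Q \<times> (\<Pi>\<^sub>E i\<in>{..<n}. {0..<int (N * d)})" using residue_range by simp
  qed
  then show "finite (?f ` carrier G)" using fin by (rule finite_subset)
  fix g h assume g: "g \<in> carrier G" and h: "h \<in> carrier G" and eq: "?f g = ?f h"
  obtain t q where t: "\<delta> (phi g) = (t, q)" "t \<in> carrier_vec n" "q \<in> Q" "q \<in> carrier_mat n n" "\<And>i. i < n \<Longrightarrow> of_nat N * t $ i \<in> \<int>"
    using \<delta>_path[OF phi_closed[OF g]] by metis
  obtain s q' where s: "\<delta> (phi h) = (s, q')" "s \<in> carrier_vec n" "\<And>i. i < n \<Longrightarrow> of_nat N * s $ i \<in> \<int>"
    using \<delta>_path[OF phi_closed[OF h]] by metis
  have q': "q' = q" and "residue t = residue s" using eq t s by auto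
  then obtain z where z: "z \<in> Zn n" "t = s + of_nat d \<cdot>\<^sub>v rvec n z"
    using residue_eqD[OF t(2,5) s(2,3)] by blast
  let ?k = "g \<otimes> inv h"
  have kc: "?k \<in> carrier G" using g h by simp
  have gk: "g = ?k \<otimes> h" using g h by (simp add: G.m_assoc)
  \<comment> \<open>A pure translation multiplied on the left adds its vector without a twist by the
    linear part, which matches the right cosets of \<open>H\<close>.\<close>
  have "(of_nat d \<cdot>\<^sub>v rvec n z, 1\<^sub>m n) \<otimes>\<^bsub>P\<^esub> \<delta> (phi h) = \<delta> (phi g)"
    using t s q' z(2) by (simp add: comm_add_vec[of s n])
  also have "\<dots> = \<delta> (phi ?k) \<otimes>\<^bsub>P\<^esub> \<delta> (phi h)"
    using \<delta>_phi_mult[OF kc h] gk by simp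
  finally have "\<delta> (phi ?k) = (of_nat d \<cdot>\<^sub>v rvec n z, 1\<^sub>m n)"
    using C.P.r_cancel[of "\<delta> (phi h)" "(of_nat d \<cdot>\<^sub>v rvec n z, 1\<^sub>m n)" "\<delta> (phi ?k)"]
      C.\<delta>.hom_closed[OF phi_carrier] kc h Q_one by simp
  then have "?k \<in> H" unfolding H_def using kc z by blast
  with gk show "\<exists>k\<in>H. g = k \<otimes> h" by blast
qed

text \<open>The translation part of an element of \<open>H\<close> determines its lattice factor,
  and dividing by that central element leaves an element of the kernel. The kernel factor has
  trivial translation, so the decomposition is unique.\<close>

lemma H_iso: "\<exists>r. G\<lparr>carrier := H\<rparr> \<cong> Zn_group n \<times>\<times> free_group r"
proof -
  obtain r \<theta> where \<theta>: "\<theta> \<in> iso (free_group r) (F\<lparr>carrier := C.K\<rparr>)"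
    using C.kernel_free[OF finite_carcs] by blast
  interpret Q: group "free_group r" by (rule group_free_group)
  interpret H: group "G\<lparr>carrier := H\<rparr>" using G.subgroup_imp_group[OF subgroup_H] .
  interpret D: group "Zn_group n \<times>\<times> free_group r" by (rule DirProd_group[OF Z.is_group Q.is_group])
  have tK: "\<theta> f \<in> C.K" if "f \<in> carrier (free_group r)" for f using \<theta> that
    by (auto simp: iso_def hom_def)
  then have tP: "\<theta> f \<in> Paths x x" "\<delta> (\<theta> f) = \<one>\<^bsub>P\<^esub>" if "f \<in> carrier (free_group r)" for f
    using that by (auto simp: C.K_def)
  have tm: "\<theta> (f \<otimes>\<^bsub>free_group r\<^esub> g) = \<theta> f \<star> \<theta> g"
    if "f \<in> carrier (free_group r)" "g \<in> carrier (free_group r)" for f g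
    using \<theta> that by (auto simp: iso_def hom_def)
  have tH: "psi (\<theta> f) \<in> H" if "f \<in> carrier (free_group r)" for f
    unfolding H_def using tP[OF that]
      by (auto simp: psi_closed phi_psi Zn_one_scaled intro!: bexI[of _ "\<one>\<^bsub>Zn_group n\<^esub>"])
  have sH: "central_elt z \<in> H" if "z \<in> Zn n" for z
    unfolding H_def using central_elt_props[OF that] that by auto
  let ?m = "\<lambda>(z, f). central_elt z \<otimes> psi (\<theta> f)"
  have hom: "?m \<in> hom (Zn_group n \<times>\<times> free_group r) (G\<lparr>carrier := H\<rparr>)"
  proof (rule homI)
    fix k assume "k \<in> carrier (Zn_group n \<times>\<times> free_group r)"
    then show "?m k \<in> carrier (G\<lparr>carrier := H\<rparr>)"
      using tH sH subgroup.m_closed[OF subgroup_H] by (auto simp: DirProd_def)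
  next
    fix k l assume "k \<in> carrier (Zn_group n \<times>\<times> free_group r)" "l \<in> carrier (Zn_group n \<times>\<times> free_group r)"
    then obtain z f w g where kl: "k = (z, f)" "l = (w, g)" "z \<in> Zn n" "w \<in> Zn n"
      "f \<in> carrier (free_group r)" "g \<in> carrier (free_group r)" by (auto simp: DirProd_def)
    let ?f = "psi (\<theta> f)" and ?g = "psi (\<theta> g)"
    note cl = central_elt_props(1)[OF kl(3)] central_elt_props(1)[OF kl(4)] psi_closed[OF tP(1)[OF kl(5)]] psi_closed[OF tP(1)[OF kl(6)]]
    have "central_elt (z \<otimes>\<^bsub>Zn_group n\<^esub> w) \<otimes> psi (\<theta> (f \<otimes>\<^bsub>free_group r\<^esub> g)) = central_elt z \<otimes> (central_elt w \<otimes> ?f) \<otimes> ?g"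
      using kl cl by (simp add: central_elt_mult tm psi_mult tP G.m_assoc)
    also have "central_elt w \<otimes> ?f = ?f \<otimes> central_elt w"
      using central_elt_commute[OF tH[OF kl(5)] kl(4)] by simp
    also have "central_elt z \<otimes> (?f \<otimes> central_elt w) \<otimes> ?g = (central_elt z \<otimes> ?f) \<otimes> (central_elt w \<otimes> ?g)" using cl by (simp add: G.m_assoc)
    finally show "?m (k \<otimes>\<^bsub>Zn_group n \<times>\<times> free_group r\<^esub> l) = ?m k \<otimes>\<^bsub>G\<lparr>carrier := H\<rparr>\<^esub> ?m l"
      by (simp add: kl)
  qed
  have inj: "inj_on ?m (carrier (Zn_group n \<times>\<times> free_group r))"
  proof (rule inj_onI)
    fix k l assume "k \<in> carrier (Zn_group n \<times>\<times> free_group r)" "l \<in> carrier (Zn_group n \<times>\<times> free_group r)" and eq: "?m k = ?m l"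
    then obtain z f w g where kl: "k = (z, f)" "l = (w, g)" "z \<in> Zn n" "w \<in> Zn n"
      "f \<in> carrier (free_group r)" "g \<in> carrier (free_group r)" by (auto simp: DirProd_def)
    have dm: "\<delta> (phi (central_elt z \<otimes> psi (\<theta> f))) = (of_nat d \<cdot>\<^sub>v rvec n z, 1\<^sub>m n)"
      if "z \<in> Zn n" "f \<in> carrier (free_group r)" for z f
      using central_elt_props[OF that(1)] tP[OF that(2)]
        by (simp add: \<delta>_phi_mult psi_closed phi_psi mult_zero_vec_right)
    have e: "central_elt z \<otimes> psi (\<theta> f) = central_elt w \<otimes> psi (\<theta> g)" using eq kl by simp
    then have "of_nat d \<cdot>\<^sub>v rvec n z = of_nat d \<cdot>\<^sub>v rvec n w" using dm[OF kl(3,5)] dm[OF kl(4,6)]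
      by simp
    then have zw: "z = w" using scaled_inj kl by blast
    then have "psi (\<theta> f) = psi (\<theta> g)"
      using e central_elt_props(1)[OF kl(3)] psi_closed[OF tP(1)[OF kl(5)]] psi_closed[OF tP(1)[OF kl(6)]] by simp
    then have "\<theta> f = \<theta> g" using phi_psi[OF tP(1)[OF kl(5)]] phi_psi[OF tP(1)[OF kl(6)]] by metis
    then have "f = g" using \<theta> kl by (auto simp: iso_def bij_betw_def dest: inj_onD)
    with zw kl show "k = l" by simp
  qed
  have "H \<subseteq> ?m ` carrier (Zn_group n \<times>\<times> free_group r)"
  proof
    fix h assume "h \<in> H"
    then obtain z where h: "h \<in> carrier G" "z \<in> Zn n" "\<delta> (phi h) = (of_nat d \<cdot>\<^sub>v rvec n z, 1\<^sub>m n)"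
      by (auto simp: H_def)
    let ?k = "inv central_elt z \<otimes> h"
    have kc: "?k \<in> carrier G" using h central_elt_props(1) by simp
    have "phi ?k \<in> C.K" unfolding C.K_def using central_elt_inverse[OF h] phi_closed[OF kc] by blast
    moreover have "\<theta> ` carrier (free_group r) = C.K" using \<theta> by (simp add: iso_def bij_betw_def)
    ultimately obtain f where f: "f \<in> carrier (free_group r)" "phi ?k = \<theta> f" by blast
    have "central_elt z \<otimes> psi (\<theta> f) = h" unfolding f(2)[symmetric] psi_phi[OF kc]
      using h central_elt_props(1)[OF h(2)] by (simp flip: G.m_assoc)
    then show "h \<in> ?m ` carrier (Zn_group n \<times>\<times> free_group r)"
      using f h by (intro image_eqI[of _ _ "(z, f)"]) (auto simp: DirProd_def)
  qed
  moreover have "?m ` carrier (Zn_group n \<times>\<times> free_group r) \<subseteq> H" using hom_carrier[OF hom] by simp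
  ultimately have "?m ` carrier (Zn_group n \<times>\<times> free_group r) = H" by (rule subset_antisym[rotated])
  with hom inj have "?m \<in> iso (Zn_group n \<times>\<times> free_group r) (G\<lparr>carrier := H\<rparr>)"
    unfolding iso_def bij_betw_def by simp
  then have "Zn_group n \<times>\<times> free_group r \<cong> G\<lparr>carrier := H\<rparr>" by (auto simp: is_iso_def)
  then show ?thesis using D.iso_sym by blast
qed

end

lemma virtually_Zn_times_free:
  "\<exists>(r::nat) H. finite_index_subgroup H G \<and> G\<lparr>carrier := H\<rparr> \<cong> Zn_group n \<times>\<times> free_group r"
proof -
  obtain N where N: "0 < N" "\<forall>w\<in>V. \<forall>q\<in>Q. \<forall>c\<in>carrier (VG w). \<forall>i<n. of_nat N * (q *\<^sub>v vt_coord w c) $ i \<in> \<int>"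
    using vt_coord_denominators by blast
  obtain d where d: "0 < d" "\<forall>q\<in>Q. \<forall>e\<in>E. \<forall>z\<in>Zn n. \<exists>i\<in>carrier (EG e).
      q *\<^sub>v vt_coord (src e) (inc (rev_arc e) i) = of_nat d \<cdot>\<^sub>v rvec n z"
    "\<forall>z\<in>Zn n. \<exists>c\<in>carrier (VG x). vt_coord x c = of_nat d \<cdot>\<^sub>v rvec n z"
    using edge_lattice by blast
  note * = N(1) N(2)[rule_format] d(1) d(2)[rule_format] d(3)[rule_format]
  show ?thesis using finite_index_H[of N d, OF *] H_iso[of N d, OF *] by blast
qed

end

theorem theorem3p4:
  fixes n :: nat
    and G :: "'g monoid"
    and \<G> :: "('v, 'e, 'a, 'b) graph_of_groups"
    and x :: 'v
    and \<phi> :: "'g \<Rightarrow> ('v, 'e, 'a) letter list set"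
    and v0 :: "'v \<times> ('v, 'e, 'a) letter list set set"
    and A :: "'g set"
    and a :: "nat \<Rightarrow> 'g"
  assumes "1 \<le> n"
    and "GBS_group n G \<G> x \<phi>"
    and "base_subgroup G \<G> x \<phi> v0 A"
    and "ordered_basis G A n a"
    and "finite (monodromy G A n a)"
  shows "\<exists>(r :: nat) H. finite_index_subgroup H G \<and>
           G\<lparr>carrier := H\<rparr> \<cong> Zn_group n \<times>\<times> free_group r"
proof -
  interpret gbs \<G> G n x \<phi>
    using assms(2) by (intro gbs.intro graph_groups.intro gbs_axioms.intro)
      (auto simp: GBS_group_def fin_digraph_def fin_digraph_axioms_def)
  \<comment> \<open>A vertex of the Bass-Serre tree is a coset; a path representing it makes the
    stabilizer accessible by equations in the path group.\<close>
  obtain v p where p: "p \<in> Paths x v" and v0: "v0 = (v, p <#\<^bsub>F\<^esub> vertex_subgroup \<G> v)"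
    using assms(3) by (auto simp: base_subgroup_def tree_verts_def)
  have index: "finite_index_subgroup A (G\<lparr>carrier := stab v p\<rparr>)"
    using assms(3) stabilizer_eq_stab[OF p] by (simp add: base_subgroup_def v0)
  interpret commensurated_basis G A n a
    using assms(4) commensurated_stab[OF p index]
    by (intro commensurated_basis.intro commensurated_basis_axioms.intro G.is_group) (auto simp: ordered_basis_def)
  \<comment> \<open>Through \<open>monodromy_eq\<close> the finite monodromy becomes finiteness of
    the set of matrices \<open>mod_mat g\<close>, which are the linear parts of the affine
    group.\<close>
  interpret gbs_basis \<G> G n x \<phi> A a v p
    using p index assms(5) by unfold_locales (auto simp: monodromy_eq)
  show ?thesis by (rule virtually_Zn_times_free)
qed

end
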